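(* Let $\theta$ be an inner function in $\mathbb{D}$ and let $\zeta\in\mathbb{T}$. Then the following statements are equivalent: (1) There exists a sequence $\{\lambda_n\}\subset\mathbb{D}$ with $\lambda_n\to\zeta$ such that $\{k_{\lambda_n}\}$ is overcomplete in $K_\theta$. (2) $K_\theta$ has the localization property at $\zeta$. Moreover, if these conditions are satisfied, then $\zeta\in AC(\theta)$.
   Context: $\mathbb{D}$ is the open unit disc, $\mathbb{T}$ the unit circle, $H^2=H^2(\mathbb{D})$ the Hardy space. For an inner function $\theta$ in $\mathbb{D}$, the model space is $K_\theta=H^2\ominus\theta H^2$, and for $\lambda\in\mathbb{D}$, $k_\lambda(z)=\frac{1-\overline{\theta(\lambda)}\theta(z)}{1-\overline{\lambda}z}$ is the reproducing kernel of $K_\theta$ at $\lambda$. A sequence $\{x_n\}$ in a separable Banach space $X$ is overcomplete if every (infinite) subsequence $\{x_{n_k}\}$ is complete in $X$, i.e. has dense linear span. Localization: for $\gamma>1$ the Stolz angle at $\zeta\in\mathbb{T}$ is $\Gamma_\gamma(\zeta)=\{z\in\mathbb{D}:|z-\zeta|\le\gamma(1-|z|)\}$. The space $K_\theta$ has the localization property at $\zeta$ if every nonzero $f\in K_\theta$ has only finitely many zeros in any Stolz angle at $\zeta$. Ahern--Clark set: let $z_j$ be the zeros of $\theta$ (counting multiplicities) and $\nu$ the positive singular measure on $\mathbb{T}$ generating the singular inner factor of $\theta$. Then $AC(\theta)=\Big\{\zeta\in\mathbb{T}:\ \sum_j\frac{1-|z_j|^2}{|\zeta-z_j|^2}+\int_{\mathbb{T}}\frac{d\nu(z)}{|\zeta-z|^2}<\infty\Big\}$.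 *)

theory Defs
  imports "HOL-Complex_Analysis.Complex_Analysis"
begin

text \<open>
  The unit disc is \<^term>\<open>ball (0::complex) 1\<close> and the unit circle is
  \<^term>\<open>sphere (0::complex) 1\<close>.  Functions on the disc are total functions
  \<^typ>\<open>complex \<Rightarrow> complex\<close>; every notion below depends only on their restriction to the disc,
  so that equality of such functions means equality on the disc.
\<close>

definition circle_borel :: "complex measure" where
  "circle_borel = restrict_space borel (sphere 0 1)"

text \<open>Normalized arc length on the unit circle.\<close>

definition arc_measure :: "complex measure" where
  "arc_measure = distr (uniform_measure lborel {0..2 * pi}) circle_borel cis"

text \<open>A push-forward along a non-measurable map would be the null
  measure, so measurability of \<open>cis\<close> is needed here.\<close>

lemma cis_measurable_circle: "cis \<in> uniform_measure lborel {0..2 * pi} \<rightarrow>\<^sub>M circle_borel"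
proof -
  have "cis \<in> borel_measurable borel"
    by (intro borel_measurable_continuous_onI continuous_intros)
  then show ?thesis
    unfolding circle_borel_def
    by (intro measurable_restrict_space2) auto
qed

lemma emeasure_arc_measure_space: "emeasure arc_measure (space arc_measure) = 1"
proof -
  have "space arc_measure = sphere 0 1"
    by (simp add: arc_measure_def circle_borel_def space_restrict_space)
  moreover have "cis -` sphere 0 1 = (UNIV :: real set)" by auto
  moreover have "sphere 0 1 \<in> sets circle_borel"
    by (simp add: circle_borel_def sets_restrict_space_iff)
  ultimately show ?thesis
    unfolding arc_measure_def using emeasure_distr[OF cis_measurable_circle]
    by (simp add: emeasure_uniform_measure ennreal_divide_self)
qed

definition inner_function :: "(complex \<Rightarrow> complex) \<Rightarrow> bool" where
  "inner_function \<theta> \<longleftrightarrow>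
     \<theta> holomorphic_on ball 0 1 \<and> (\<forall>z\<in>ball 0 1. norm (\<theta> z) \<le> 1) \<and>
     (AE \<xi> in arc_measure.
        \<exists>l. norm l = 1 \<and> ((\<lambda>r. \<theta> (of_real r * \<xi>)) \<longlongrightarrow> l) (at_left (1::real)))"


subsection \<open>The Hardy space and model spaces\<close>

definition taylor_coeff :: "(complex \<Rightarrow> complex) \<Rightarrow> nat \<Rightarrow> complex" where
  "taylor_coeff f n = (deriv ^^ n) f 0 / fact n"

definition hardy2 :: "(complex \<Rightarrow> complex) set" where
  "hardy2 = {f. f holomorphic_on ball 0 1 \<and> summable (\<lambda>n. (norm (taylor_coeff f n))\<^sup>2)}"

definition hardy2_inner :: "(complex \<Rightarrow> complex) \<Rightarrow> (complex \<Rightarrow> complex) \<Rightarrow> complex" where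
  "hardy2_inner f g = (\<Sum>n. taylor_coeff f n * cnj (taylor_coeff g n))"

definition hardy2_norm :: "(complex \<Rightarrow> complex) \<Rightarrow> real" where
  "hardy2_norm f = sqrt (\<Sum>n. (norm (taylor_coeff f n))\<^sup>2)"

definition model_space :: "(complex \<Rightarrow> complex) \<Rightarrow> (complex \<Rightarrow> complex) set" where
  "model_space \<theta> = {f \<in> hardy2. \<forall>g\<in>hardy2. hardy2_inner f (\<lambda>z. \<theta> z * g z) = 0}"

definition model_kernel :: "(complex \<Rightarrow> complex) \<Rightarrow> complex \<Rightarrow> complex \<Rightarrow> complex" where
  "model_kernel \<theta> w z = (1 - cnj (\<theta> w) * \<theta> z) / (1 - cnj w * z)"


subsection \<open>Overcompleteness and localization\<close>

definition complex_span :: "(complex \<Rightarrow> complex) set \<Rightarrow> (complex \<Rightarrow> complex) set" where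
  "complex_span S = {\<lambda>z. \<Sum>g\<in>T. c g * g z | T c. finite T \<and> T \<subseteq> S}"

text \<open>Here \<open>X\<close> is a subspace of the Hardy space, with the norm inherited from it.\<close>

definition complete_in :: "(complex \<Rightarrow> complex) set \<Rightarrow> (complex \<Rightarrow> complex) set \<Rightarrow> bool" where
  "complete_in X S \<longleftrightarrow>
     S \<subseteq> X \<and> (\<forall>f\<in>X. \<forall>\<epsilon>>0. \<exists>g\<in>complex_span S. hardy2_norm (\<lambda>z. f z - g z) < \<epsilon>)"

definition overcomplete_in ::
  "(complex \<Rightarrow> complex) set \<Rightarrow> (nat \<Rightarrow> complex \<Rightarrow> complex) \<Rightarrow> bool" where
  "overcomplete_in X x \<longleftrightarrow> (\<forall>s :: nat \<Rightarrow> nat. strict_mono s \<longrightarrow> complete_in X (range (x \<circ> s)))"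

definition stolz_angle :: "real \<Rightarrow> complex \<Rightarrow> complex set" where
  "stolz_angle \<gamma> \<zeta> = {z \<in> ball 0 1. norm (z - \<zeta>) \<le> \<gamma> * (1 - norm z)}"

definition localization_property :: "(complex \<Rightarrow> complex) \<Rightarrow> complex \<Rightarrow> bool" where
  "localization_property \<theta> \<zeta> \<longleftrightarrow>
     (\<forall>f\<in>model_space \<theta>. (\<exists>z\<in>ball 0 1. f z \<noteq> 0) \<longrightarrow>
        (\<forall>\<gamma>>1. finite {z \<in> stolz_angle \<gamma> \<zeta>. f z = 0}))"


subsection \<open>Canonical factorization and the Ahern--Clark set\<close>

definition disc_zeros :: "(complex \<Rightarrow> complex) \<Rightarrow> complex set" where
  "disc_zeros \<theta> = {a \<in> ball 0 1. \<theta> a = 0}"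

definition zero_mult :: "(complex \<Rightarrow> complex) \<Rightarrow> complex \<Rightarrow> nat" where
  "zero_mult \<theta> a = nat (zorder \<theta> a)"

definition blaschke_factor :: "complex \<Rightarrow> complex \<Rightarrow> complex" where
  "blaschke_factor a z =
     (if a = 0 then z else of_real (norm a) / a * ((a - z) / (1 - cnj a * z)))"

text \<open>The Blaschke product over the zeros of \<open>\<theta>\<close>, each repeated according to its multiplicity:
  the limit of the net of finite partial products.\<close>

definition blaschke_product :: "(complex \<Rightarrow> complex) \<Rightarrow> complex \<Rightarrow> complex" where
  "blaschke_product \<theta> z =
     Lim (finite_subsets_at_top (disc_zeros \<theta>))
       (\<lambda>F. \<Prod>a\<in>F. blaschke_factor a z ^ zero_mult \<theta> a)"

definition singular_circle_measure :: "complex measure \<Rightarrow> bool" where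
  "singular_circle_measure \<nu> \<longleftrightarrow>
     finite_measure \<nu> \<and> sets \<nu> = sets circle_borel \<and>
     (\<exists>N\<in>sets circle_borel. emeasure arc_measure N = 0 \<and> emeasure \<nu> (sphere 0 1 - N) = 0)"

definition singular_inner :: "complex measure \<Rightarrow> complex \<Rightarrow> complex" where
  "singular_inner \<nu> z = exp (- (\<integral>\<xi>. (\<xi> + z) / (\<xi> - z) \<partial>\<nu>))"

text \<open>\<open>\<nu>\<close> is the measure of the singular inner factor in the canonical factorization of \<open>\<theta>\<close>;
  for inner \<open>\<theta>\<close> it exists and is unique.\<close>

definition generates_singular_factor :: "complex measure \<Rightarrow> (complex \<Rightarrow> complex) \<Rightarrow> bool" where
  "generates_singular_factor \<nu> \<theta> \<longleftrightarrow>
     singular_circle_measure \<nu> \<and>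
     (\<exists>c. norm c = 1 \<and>
        (\<forall>z\<in>ball 0 1. \<theta> z = c * blaschke_product \<theta> z * singular_inner \<nu> z))"

text \<open>The reciprocal in the integral is taken in \<^typ>\<open>ennreal\<close>, where \<open>1 / 0 = \<infinity>\<close>: an atom of
  \<open>\<nu>\<close> at \<open>\<zeta>\<close> makes the integral infinite.\<close>

definition ahern_clark_set :: "(complex \<Rightarrow> complex) \<Rightarrow> complex set" where
  "ahern_clark_set \<theta> = {\<zeta> \<in> sphere 0 1.
     \<exists>\<nu>. generates_singular_factor \<nu> \<theta> \<and>
       (\<Sum>\<^sub>\<infinity>a\<in>disc_zeros \<theta>.
           ennreal (real (zero_mult \<theta> a) * ((1 - (norm a)\<^sup>2) / (norm (\<zeta> - a))\<^sup>2)))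
       + (\<integral>\<^sup>+\<xi>. 1 / ennreal ((norm (\<zeta> - \<xi>))\<^sup>2) \<partial>\<nu>) < \<infinity>}"

end

theory Submission
  imports Defs "HOL-Probability.Helly_Selection"
begin

text \<open>
  The proof works with Taylor coefficients and with means over circles inside the disc. The boundary
  values of an inner function \<open>\<theta>\<close> enter only through the limits of such means
  (\<open>inner_function_mean_limit\<close>), which make multiplication by \<open>\<theta>\<close> an isometry of the Hardy space.

  By the reproducing property and the projection theorem, the kernels at the points of a set are
  complete in the model space if and only if no nonzero function of the space vanishes on that set
  (\<open>kernels_complete\<close> and \<open>complete_kernels_unique\<close>). So overcompleteness means that no nonzero
  function vanishes along a subsequence of \<open>\<lambda>_n\<close>. If localization holds, points tending to \<open>\<zeta>\<close>
  along the radius have this property, as they lie in a Stolz angle.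

  Conversely, suppose that a nonzero \<open>f\<close> has infinitely many zeros in a Stolz angle at \<open>\<zeta>\<close>. The model
  space is invariant under the backward shift, so a zero \<open>\<mu>\<close> of \<open>f\<close> may be replaced by any other point \<open>\<lambda>\<close>:
  \<open>f (z) (z - \<lambda>) / (z - \<mu>)\<close> is again in the space. If \<open>\<mu>\<close> and \<open>\<lambda>\<close> are close to \<open>\<zeta>\<close>, with \<open>\<mu>\<close> in the Stolz
  angle and \<open>\<lambda>\<close> chosen after \<open>\<mu>\<close>, the multiplier is bounded on the circle and close to one off a neighbourhood
  of \<open>\<zeta>\<close>. Therefore the change of \<open>f\<close> in norm is small (\<open>model_space_move_zero\<close>). Moving one zero after
  another to points \<open>\<lambda>_n\<close>, with summable errors, leads to a nonzero function vanishing along a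
  subsequence (\<open>vanishing_on_subsequence\<close>).

  For the last assertion, suppose that the norms of the kernels tended to infinity along the radius
  at \<open>\<zeta>\<close>. Then prescribing one more zero far out on the radius costs arbitrarily little
  (\<open>small_interpolant\<close>), and the same scheme yields a nonzero function with infinitely many zeros on
  the radius. So localization provides points \<open>z\<close> tending to \<open>\<zeta>\<close> at which the squared norm of the
  kernel, \<open>(1 - |\<theta>(z)|\<^sup>2) / (1 - |z|\<^sup>2)\<close>, stays bounded. The canonical factorization expresses
  \<open>- log |\<theta>(z)|\<^sup>2\<close> as a sum over the zeros plus twice a Poisson integral. Division by \<open>1 - |z|\<^sup>2\<close> and a
  passage to the limit bound the two parts of the Ahern--Clark sum.

  The canonical factorization is proved on the way (\<open>canonical_factorization\<close>). The zeros are divided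
  out one at a time by the Schwarz lemma. The remaining factor is the exponential of a function with a
  Herglotz measure, found by Helly's selection theorem. This measure is singular: otherwise it would
  dominate a multiple of arc length on a set of positive length, and the means of \<open>|\<theta>|\<^sup>2\<close> would stay away
  from one (\<open>dominated_arc_null\<close>).
\<close>

section \<open>Taylor coefficients and the Hardy space\<close>

lemma taylor_sums:
  assumes "f holomorphic_on ball 0 1" "norm z < 1"
  shows "(\<lambda>n. taylor_coeff f n * z ^ n) sums f z"
  using holomorphic_power_series[OF assms(1), of z] assms(2)
  by (simp add: taylor_coeff_def)

lemma taylor_summable_norm:
  assumes "f holomorphic_on ball 0 1" "0 \<le> r" "r < 1"
  shows "summable (\<lambda>n. norm (taylor_coeff f n) * r ^ n)"
proof -
  obtain s where s: "r < s" "s < 1"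
    using assms(3) dense by blast
  have "summable (\<lambda>n. taylor_coeff f n * of_real s ^ n)"
    using taylor_sums[OF assms(1), of "of_real s"] s assms(2) by (auto simp: sums_iff)
  from powser_insidea[OF this, of "of_real r"] s assms(2) show ?thesis
    by (simp add: norm_mult norm_power)
qed

lemma taylor_coeff_cong:
  assumes "\<And>z. norm z < 1 \<Longrightarrow> f z = g z"
  shows "taylor_coeff f n = taylor_coeff g n"
proof -
  have "eventually (\<lambda>z. f z = g z) (nhds 0)"
    using eventually_nhds_in_open[of "ball 0 1" "0::complex"] assms
    by (auto elim: eventually_mono)
  from higher_deriv_cong_ev[OF this refl] show ?thesis
    by (simp add: taylor_coeff_def)
qed

lemma bounded_coeff_conv_radius:
  fixes a :: "nat \<Rightarrow> complex"
  assumes "\<And>n. norm (a n) \<le> C"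
  shows "conv_radius a \<ge> 1"
proof (rule conv_radius_geI_ex)
  fix r :: real assume r: "0 < r" "ereal r < 1"
  have "summable (\<lambda>n. a n * of_real r ^ n)"
  proof (rule summable_comparison_test')
    show "summable (\<lambda>n. C * r ^ n)"
      using r by (intro summable_mult summable_geometric) (auto simp: one_ereal_def)
    show "norm (a n * of_real r ^ n) \<le> C * r ^ n" if "n \<ge> 0" for n
      using assms[of n] r by (simp add: norm_mult norm_power mult_right_mono)
  qed
  thus "\<exists>z. norm z = r \<and> summable (\<lambda>n. a n * z ^ n)"
    using r by (intro exI[of _ "of_real r"]) auto
qed

text \<open>Bounded coefficients give radius of convergence at least one, so the series may be read as a
  formal power series whose expansion at zero is unique.\<close>

lemma powser_bounded_coeffs:
  fixes a :: "nat \<Rightarrow> complex"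
  assumes "\<And>n. norm (a n) \<le> C"
    and f: "\<And>z. norm z < 1 \<Longrightarrow> f z = (\<Sum>n. a n * z ^ n)"
  shows "f holomorphic_on ball 0 1" "taylor_coeff f n = a n"
proof -
  let ?F = "Abs_fps a"
  have rad: "fps_conv_radius ?F \<ge> 1"
    using bounded_coeff_conv_radius[OF assms(1)] by (simp add: fps_conv_radius_def)
  have "ball (0::complex) 1 \<subseteq> eball 0 (fps_conv_radius ?F)"
  proof
    fix z :: complex assume "z \<in> ball 0 1"
    hence "ereal (norm z) < 1" by (simp add: one_ereal_def)
    hence "ereal (norm z) < fps_conv_radius ?F" using rad by (rule less_le_trans)
    thus "z \<in> eball 0 (fps_conv_radius ?F)" by (simp add: in_eball_iff)
  qed
  hence "eval_fps ?F holomorphic_on ball 0 1" by (rule holomorphic_on_eval_fps)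
  moreover have ev: "f z = eval_fps ?F z" if "norm z < 1" for z
    using f[OF that] by (simp add: eval_fps_def)
  ultimately show "f holomorphic_on ball 0 1"
    using holomorphic_transform[of "eval_fps ?F" "ball 0 1" f] by (metis mem_ball_0)
  have "(0::ereal) < 1" by simp
  hence "fps_conv_radius ?F > 0" using rad by (rule less_le_trans)
  from fps_nth_fps_expansion[OF eval_fps_has_fps_expansion[OF this]]
  have "taylor_coeff (eval_fps ?F) n = a n"
    unfolding taylor_coeff_def by (metis fps_nth_Abs_fps)
  with taylor_coeff_cong[of f "eval_fps ?F" n] ev show "taylor_coeff f n = a n" by metis
qed

lemma taylor_coeff_unique:
  assumes "f holomorphic_on ball 0 1" "\<And>n. taylor_coeff f n = taylor_coeff g n"
    "g holomorphic_on ball 0 1" "norm z < 1"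
  shows "f z = g z"
  using taylor_sums[OF assms(1,4)] taylor_sums[OF assms(3,4)] assms(2)
  by (simp add: sums_iff)

lemma taylor_coeff_add:
  assumes "f holomorphic_on ball 0 1" "g holomorphic_on ball 0 1"
  shows "taylor_coeff (\<lambda>z. f z + g z) n = taylor_coeff f n + taylor_coeff g n"
  using higher_deriv_add[OF assms, of 0 n] by (simp add: taylor_coeff_def add_divide_distrib)

lemma taylor_coeff_diff:
  assumes "f holomorphic_on ball 0 1" "g holomorphic_on ball 0 1"
  shows "taylor_coeff (\<lambda>z. f z - g z) n = taylor_coeff f n - taylor_coeff g n"
  using higher_deriv_diff[OF assms, of 0 n] by (simp add: taylor_coeff_def diff_divide_distrib)

lemma taylor_coeff_cmult:
  assumes "f holomorphic_on ball 0 1"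
  shows "taylor_coeff (\<lambda>z. c * f z) n = c * taylor_coeff f n"
  using higher_deriv_cmult[OF assms, of 0 n c] by (simp add: taylor_coeff_def)

lemma taylor_coeff_zero [simp]: "taylor_coeff (\<lambda>z. 0) n = 0"
  using powser_bounded_coeffs(2)[of "\<lambda>_. 0" 0 "\<lambda>_. 0" n] by simp

lemma hardy2_hol: "f \<in> hardy2 \<Longrightarrow> f holomorphic_on ball 0 1"
  and hardy2_summable: "f \<in> hardy2 \<Longrightarrow> summable (\<lambda>n. (norm (taylor_coeff f n))\<^sup>2)"
  by (auto simp: hardy2_def)

lemma hardy2_summable_prod:
  assumes "f \<in> hardy2" "g \<in> hardy2"
  shows "summable (\<lambda>n. norm (taylor_coeff f n) * norm (taylor_coeff g n))"
proof (rule summable_comparison_test')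
  show "summable (\<lambda>n. (norm (taylor_coeff f n))\<^sup>2 + (norm (taylor_coeff g n))\<^sup>2)"
    using assms by (intro summable_add hardy2_summable)
  show "norm (norm (taylor_coeff f n) * norm (taylor_coeff g n))
      \<le> (norm (taylor_coeff f n))\<^sup>2 + (norm (taylor_coeff g n))\<^sup>2" for n
  proof -
    have "0 \<le> (norm (taylor_coeff f n) - norm (taylor_coeff g n))\<^sup>2" by simp
    moreover have nn: "0 \<le> norm (taylor_coeff f n) * norm (taylor_coeff g n)" by simp
    ultimately show ?thesis
      unfolding power2_diff real_norm_def abs_of_nonneg[OF nn] by linarith
  qed
qed

lemma hardy2_summable_inner:
  assumes "f \<in> hardy2" "g \<in> hardy2"
  shows "summable (\<lambda>n. taylor_coeff f n * cnj (taylor_coeff g n))"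
  by (rule summable_norm_cancel) (use hardy2_summable_prod[OF assms] in \<open>simp add: norm_mult\<close>)

lemma hardy2_zero [simp]: "(\<lambda>z. 0) \<in> hardy2"
  by (simp add: hardy2_def)

lemma hardy2_add:
  assumes "f \<in> hardy2" "g \<in> hardy2"
  shows "(\<lambda>z. f z + g z) \<in> hardy2"
proof -
  note [simp] = taylor_coeff_add[OF hardy2_hol hardy2_hol, OF assms]
  have "summable (\<lambda>n. (norm (taylor_coeff (\<lambda>z. f z + g z) n))\<^sup>2)"
  proof (rule summable_comparison_test')
    show "summable (\<lambda>n. ((norm (taylor_coeff f n))\<^sup>2 + (norm (taylor_coeff g n))\<^sup>2) +
             2 * (norm (taylor_coeff f n) * norm (taylor_coeff g n)))"
      using assms by (intro summable_add hardy2_summable summable_mult hardy2_summable_prod)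
    show "norm ((norm (taylor_coeff (\<lambda>z. f z + g z) n))\<^sup>2) \<le> ((norm (taylor_coeff f n))\<^sup>2 +
       (norm (taylor_coeff g n))\<^sup>2) + 2 * (norm (taylor_coeff f n) * norm (taylor_coeff g n))" for n
      using power_mono[OF norm_triangle_ineq[of "taylor_coeff f n" "taylor_coeff g n"], of 2]
      by (simp add: power2_sum algebra_simps)
  qed
  thus ?thesis using assms by (auto simp: hardy2_def intro!: holomorphic_intros)
qed

lemma hardy2_cmult:
  assumes "f \<in> hardy2"
  shows "(\<lambda>z. c * f z) \<in> hardy2"
  using assms taylor_coeff_cmult[OF hardy2_hol[OF assms], of c]
  by (auto simp: hardy2_def norm_mult power_mult_distrib intro!: holomorphic_intros summable_mult)

lemma hardy2_diff:
  assumes "f \<in> hardy2" "g \<in> hardy2"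
  shows "(\<lambda>z. f z - g z) \<in> hardy2"
  using hardy2_add[OF assms(1) hardy2_cmult[OF assms(2), of "-1"]] by simp

lemma hardy2_inner_add_left:
  assumes "f \<in> hardy2" "g \<in> hardy2" "h \<in> hardy2"
  shows "hardy2_inner (\<lambda>z. f z + g z) h = hardy2_inner f h + hardy2_inner g h"
  unfolding hardy2_inner_def
  using suminf_add[OF hardy2_summable_inner[OF assms(1,3)] hardy2_summable_inner[OF assms(2,3)]]
  by (simp add: taylor_coeff_add hardy2_hol assms algebra_simps)

lemma hardy2_inner_cmult_left:
  assumes "f \<in> hardy2" "g \<in> hardy2"
  shows "hardy2_inner (\<lambda>z. c * f z) g = c * hardy2_inner f g"
  unfolding hardy2_inner_def
  using suminf_mult[OF hardy2_summable_inner[OF assms], of c]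
  by (simp add: taylor_coeff_cmult hardy2_hol assms algebra_simps)

lemma hardy2_inner_diff_left:
  assumes "f \<in> hardy2" "g \<in> hardy2" "h \<in> hardy2"
  shows "hardy2_inner (\<lambda>z. f z - g z) h = hardy2_inner f h - hardy2_inner g h"
  using hardy2_inner_add_left[OF assms(1) hardy2_cmult[OF assms(2), of "-1"] assms(3)]
    hardy2_inner_cmult_left[OF assms(2,3), of "-1"] by simp

lemma hardy2_inner_commute:
  assumes "f \<in> hardy2" "g \<in> hardy2"
  shows "hardy2_inner g f = cnj (hardy2_inner f g)"
proof -
  have "(\<lambda>n. cnj (taylor_coeff f n * cnj (taylor_coeff g n))) sums cnj (hardy2_inner f g)"
    unfolding sums_cnj hardy2_inner_def
    using hardy2_summable_inner[OF assms] by (simp add: summable_sums)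
  thus ?thesis by (simp add: hardy2_inner_def sums_iff mult.commute)
qed

lemma hardy2_inner_add_right:
  assumes "f \<in> hardy2" "g \<in> hardy2" "h \<in> hardy2"
  shows "hardy2_inner h (\<lambda>z. f z + g z) = hardy2_inner h f + hardy2_inner h g"
  using hardy2_inner_commute[OF hardy2_add[OF assms(1,2)] assms(3)] hardy2_inner_add_left[OF assms]
    hardy2_inner_commute[OF assms(1,3)] hardy2_inner_commute[OF assms(2,3)] by simp

lemma hardy2_inner_cmult_right:
  assumes "f \<in> hardy2" "g \<in> hardy2"
  shows "hardy2_inner g (\<lambda>z. c * f z) = cnj c * hardy2_inner g f"
  using hardy2_inner_commute[OF hardy2_cmult[OF assms(1), of c] assms(2)]
    hardy2_inner_cmult_left[OF assms, of c] hardy2_inner_commute[OF assms] by simp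

lemma hardy2_inner_diff_right:
  assumes "f \<in> hardy2" "g \<in> hardy2" "h \<in> hardy2"
  shows "hardy2_inner h (\<lambda>z. f z - g z) = hardy2_inner h f - hardy2_inner h g"
  using hardy2_inner_commute[OF hardy2_diff[OF assms(1,2)] assms(3)] hardy2_inner_diff_left[OF assms]
    hardy2_inner_commute[OF assms(1,3)] hardy2_inner_commute[OF assms(2,3)] by simp

lemma hardy2_norm_nonneg [simp]: "0 \<le> hardy2_norm f" if "f \<in> hardy2"
  using hardy2_summable[OF that] by (simp add: hardy2_norm_def suminf_nonneg)

lemma hardy2_norm_sq:
  assumes "f \<in> hardy2"
  shows "(hardy2_norm f)\<^sup>2 = (\<Sum>n. (norm (taylor_coeff f n))\<^sup>2)"
  using hardy2_summable[OF assms] by (simp add: hardy2_norm_def suminf_nonneg)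

lemma hardy2_inner_self:
  assumes "f \<in> hardy2"
  shows "hardy2_inner f f = of_real ((hardy2_norm f)\<^sup>2)"
  unfolding hardy2_norm_sq[OF assms] hardy2_inner_def
  using suminf_of_real[OF hardy2_summable[OF assms], where 'a=complex]
  by (simp only: complex_norm_square)

lemma hardy2_norm_cong:
  assumes "\<And>z. norm z < 1 \<Longrightarrow> f z = g z"
  shows "hardy2_norm f = hardy2_norm g"
  unfolding hardy2_norm_def using taylor_coeff_cong[OF assms] by simp

text \<open>Reduced to the finite-dimensional inequality for the norms \<open>L2_set\<close> by bounding the partial sums.\<close>

lemma hardy2_cauchy_schwarz_abs:
  assumes "f \<in> hardy2" "g \<in> hardy2"
  shows "(\<Sum>n. norm (taylor_coeff f n) * norm (taylor_coeff g n)) \<le> hardy2_norm f * hardy2_norm g"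
proof (rule suminf_le_const[OF hardy2_summable_prod[OF assms]])
  have L: "L2_set (\<lambda>n. norm (taylor_coeff h n)) {..<N} \<le> hardy2_norm h" if "h \<in> hardy2" for h N
    unfolding hardy2_norm_def L2_set_def
    using hardy2_summable[OF that] by (auto intro!: sum_le_suminf)
  fix N
  have "(\<Sum>n<N. norm (taylor_coeff f n) * norm (taylor_coeff g n))
    \<le> L2_set (\<lambda>n. norm (taylor_coeff f n)) {..<N} * L2_set (\<lambda>n. norm (taylor_coeff g n)) {..<N}"
    using L2_set_mult_ineq[of "\<lambda>n. norm (taylor_coeff f n)" "\<lambda>n. norm (taylor_coeff g n)" "{..<N}"]
    by simp
  also have "\<dots> \<le> hardy2_norm f * hardy2_norm g"
    using assms by (intro mult_mono L) (auto simp: L2_set_nonneg)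
  finally show "(\<Sum>n<N. norm (taylor_coeff f n) * norm (taylor_coeff g n)) \<le> hardy2_norm f * hardy2_norm g" .
qed

lemma hardy2_cauchy_schwarz:
  assumes "f \<in> hardy2" "g \<in> hardy2"
  shows "norm (hardy2_inner f g) \<le> hardy2_norm f * hardy2_norm g"
proof -
  have "norm (hardy2_inner f g) \<le> (\<Sum>n. norm (taylor_coeff f n * cnj (taylor_coeff g n)))"
    unfolding hardy2_inner_def using hardy2_summable_prod[OF assms]
    by (intro summable_norm) (simp add: norm_mult)
  with hardy2_cauchy_schwarz_abs[OF assms] show ?thesis by (simp add: norm_mult)
qed

lemma hardy2_norm_cmult:
  assumes "f \<in> hardy2"
  shows "hardy2_norm (\<lambda>z. c * f z) = norm c * hardy2_norm f"
  unfolding hardy2_norm_def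
  using suminf_mult[OF hardy2_summable[OF assms], of "(norm c)\<^sup>2"]
  by (simp add: taylor_coeff_cmult hardy2_hol assms norm_mult power_mult_distrib real_sqrt_mult)

lemma hardy2_norm_zero [simp]: "hardy2_norm (\<lambda>z. 0) = 0"
  by (simp add: hardy2_norm_def)

lemma hardy2_norm_add_sq:
  assumes "f \<in> hardy2" "g \<in> hardy2"
  shows "(hardy2_norm (\<lambda>z. f z + g z))\<^sup>2 = (hardy2_norm f)\<^sup>2 + (hardy2_norm g)\<^sup>2 + 2 * Re (hardy2_inner f g)"
proof -
  note m = hardy2_add[OF assms]
  have "of_real ((hardy2_norm (\<lambda>z. f z + g z))\<^sup>2) =
     hardy2_inner f f + hardy2_inner g g + (hardy2_inner f g + cnj (hardy2_inner f g))"
    unfolding hardy2_inner_self[OF m, symmetric] hardy2_inner_commute[OF assms, symmetric]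
    by (simp add: hardy2_inner_add_left hardy2_inner_add_right assms m)
  from arg_cong[OF this, of Re] show ?thesis
    by (simp add: hardy2_inner_self assms)
qed

lemma hardy2_norm_triangle:
  assumes "f \<in> hardy2" "g \<in> hardy2"
  shows "hardy2_norm (\<lambda>z. f z + g z) \<le> hardy2_norm f + hardy2_norm g"
proof (rule power2_le_imp_le)
  have "Re (hardy2_inner f g) \<le> hardy2_norm f * hardy2_norm g"
    using hardy2_cauchy_schwarz[OF assms] complex_Re_le_cmod order_trans by blast
  thus "(hardy2_norm (\<lambda>z. f z + g z))\<^sup>2 \<le> (hardy2_norm f + hardy2_norm g)\<^sup>2"
    using hardy2_norm_add_sq[OF assms] by (simp add: power2_sum)
qed (use assms in simp)

lemma hardy2_norm_minus_commute:
  assumes "f \<in> hardy2" "g \<in> hardy2"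
  shows "hardy2_norm (\<lambda>z. f z - g z) = hardy2_norm (\<lambda>z. g z - f z)"
  using hardy2_norm_cmult[OF hardy2_diff[OF assms], of "-1"] by simp

lemma hardy2_norm_eq_0:
  assumes "f \<in> hardy2" "hardy2_norm f = 0" "norm z < 1"
  shows "f z = 0"
proof -
  have "(\<Sum>n. (norm (taylor_coeff f n))\<^sup>2) = 0"
    using hardy2_norm_sq[OF assms(1)] assms(2) by simp
  hence "taylor_coeff f n = 0" for n
    using suminf_eq_zero_iff[OF hardy2_summable[OF assms(1)]] by auto
  thus ?thesis
    using taylor_coeff_unique[OF hardy2_hol[OF assms(1)], of "\<lambda>z. 0"] assms by simp
qed

lemma hardy2_coeff_le_norm:
  assumes "f \<in> hardy2"
  shows "norm (taylor_coeff f n) \<le> hardy2_norm f"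
proof (rule power2_le_imp_le)
  show "(norm (taylor_coeff f n))\<^sup>2 \<le> (hardy2_norm f)\<^sup>2"
    unfolding hardy2_norm_sq[OF assms]
    using sum_le_suminf[OF hardy2_summable[OF assms], of "{n}"] by simp
qed (use assms in simp)

text \<open>Together with \<open>hardy2_hol\<close> and \<open>hardy2_summable\<close> this identifies the Hardy space, up to values
  outside the disc, with the square-summable sequences.\<close>

lemma hardy2_of_coeffs:
  assumes "summable (\<lambda>n. (norm (a n :: complex))\<^sup>2)"
    and f: "\<And>z. norm z < 1 \<Longrightarrow> f z = (\<Sum>n. a n * z ^ n)"
  shows "f \<in> hardy2" "taylor_coeff f n = a n"
proof -
  have b: "norm (a n) \<le> sqrt (\<Sum>n. (norm (a n))\<^sup>2)" for n
    using sum_le_suminf[OF assms(1), of "{n}"] by (simp add: real_le_rsqrt)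
  show "taylor_coeff f n = a n"
    by (rule powser_bounded_coeffs(2)[OF b f]) auto
  have "taylor_coeff f n = a n" for n
    by (rule powser_bounded_coeffs(2)[OF b f]) auto
  thus "f \<in> hardy2"
    using powser_bounded_coeffs(1)[OF b f] assms(1) by (simp add: hardy2_def)
qed

text \<open>The Taylor coefficients of a Cauchy sequence converge one by one; the partial sums of the squared
  distance pass to the limit with a bound independent of their length.\<close>

lemma hardy2_complete:
  assumes h: "\<And>n. f n \<in> hardy2"
    and cauchy: "\<And>e. e > 0 \<Longrightarrow> \<exists>N. \<forall>m\<ge>N. \<forall>n\<ge>N. hardy2_norm (\<lambda>z. f m z - f n z) < e"
  obtains g where "g \<in> hardy2" "(\<lambda>n. hardy2_norm (\<lambda>z. f n z - g z)) \<longlonglongrightarrow> 0"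
proof -
  note hol = hardy2_hol[OF h]
  have "Cauchy (\<lambda>n. taylor_coeff (f n) k)" for k
  proof (rule CauchyI)
    fix e :: real assume "e > 0"
    then obtain N where N: "\<forall>m\<ge>N. \<forall>n\<ge>N. hardy2_norm (\<lambda>z. f m z - f n z) < e" using cauchy by blast
    have "norm (taylor_coeff (f m) k - taylor_coeff (f n) k) < e" if "m \<ge> N" "n \<ge> N" for m n
      using hardy2_coeff_le_norm[OF hardy2_diff[OF h h], of m n k] N that
      by (simp add: taylor_coeff_diff hol) (meson le_less_trans)
    thus "\<exists>M. \<forall>m\<ge>M. \<forall>n\<ge>M. norm (taylor_coeff (f m) k - taylor_coeff (f n) k) < e" by blast
  qed
  hence "\<forall>k. \<exists>l. (\<lambda>n. taylor_coeff (f n) k) \<longlonglongrightarrow> l"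
    using Cauchy_convergent_iff convergent_def by blast
  then obtain a where a: "\<And>k. (\<lambda>n. taylor_coeff (f n) k) \<longlonglongrightarrow> a k" by metis
  have fin: "(\<Sum>k<K. (norm (taylor_coeff (f n) k - a k))\<^sup>2) \<le> e\<^sup>2"
    if N: "\<forall>m\<ge>N. \<forall>n\<ge>N. hardy2_norm (\<lambda>z. f m z - f n z) < e" and n: "n \<ge> N" for N e n K
  proof (rule tendsto_upperbound)
    show "(\<lambda>m. \<Sum>k<K. (norm (taylor_coeff (f n) k - taylor_coeff (f m) k))\<^sup>2)
          \<longlonglongrightarrow> (\<Sum>k<K. (norm (taylor_coeff (f n) k - a k))\<^sup>2)"
      by (intro tendsto_intros a)
    show "\<forall>\<^sub>F m in sequentially. (\<Sum>k<K. (norm (taylor_coeff (f n) k - taylor_coeff (f m) k))\<^sup>2) \<le> e\<^sup>2"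
      using eventually_ge_at_top[of N]
    proof eventually_elim
      case (elim m)
      note d = hardy2_diff[OF h h, of n m]
      have "(\<Sum>k<K. (norm (taylor_coeff (f n) k - taylor_coeff (f m) k))\<^sup>2)
          \<le> (hardy2_norm (\<lambda>z. f n z - f m z))\<^sup>2"
        unfolding hardy2_norm_sq[OF d] using sum_le_suminf[OF hardy2_summable[OF d], of "{..<K}"]
        by (simp add: taylor_coeff_diff hol)
      also have "\<dots> \<le> e\<^sup>2"
        using N n elim d by (intro power_mono) (auto intro: less_imp_le)
      finally show ?case .
    qed
  qed auto
  have summ: "summable (\<lambda>k. (norm (taylor_coeff (f n) k - a k))\<^sup>2)"
    and le: "(\<Sum>k. (norm (taylor_coeff (f n) k - a k))\<^sup>2) \<le> e\<^sup>2"
    if N: "\<forall>m\<ge>N. \<forall>n\<ge>N. hardy2_norm (\<lambda>z. f m z - f n z) < e" and n: "n \<ge> N" for N e n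
  proof -
    show s: "summable (\<lambda>k. (norm (taylor_coeff (f n) k - a k))\<^sup>2)"
      by (rule summableI_nonneg_bounded[of _ "e\<^sup>2"]) (use fin[OF N n] in auto)
    show "(\<Sum>k. (norm (taylor_coeff (f n) k - a k))\<^sup>2) \<le> e\<^sup>2"
      by (rule suminf_le_const[OF s]) (use fin[OF N n] in auto)
  qed
  obtain N where N: "\<forall>m\<ge>N. \<forall>n\<ge>N. hardy2_norm (\<lambda>z. f m z - f n z) < 1" using cauchy[of 1] by auto
  define d where "d z = (\<Sum>k. (taylor_coeff (f N) k - a k) * z ^ k)" for z
  have d: "d \<in> hardy2" "\<And>k. taylor_coeff d k = taylor_coeff (f N) k - a k"
    using hardy2_of_coeffs[OF summ[OF N order_refl], of d] d_def by auto
  define g where "g z = f N z - d z" for z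
  have g: "g \<in> hardy2" unfolding g_def by (intro hardy2_diff h d)
  have tg: "taylor_coeff g k = a k" for k
    using taylor_coeff_diff[OF hol[of N] hardy2_hol[OF d(1)], of k] d(2)[of k]
    by (simp add: g_def[abs_def])
  have "(\<lambda>n. hardy2_norm (\<lambda>z. f n z - g z)) \<longlonglongrightarrow> 0"
  proof (rule LIMSEQ_I)
    fix e :: real assume e: "e > 0"
    then obtain M where M: "\<forall>m\<ge>M. \<forall>n\<ge>M. hardy2_norm (\<lambda>z. f m z - f n z) < e/2"
      using cauchy[of "e/2"] by auto
    have "norm (hardy2_norm (\<lambda>z. f n z - g z) - 0) < e" if n: "n \<ge> M" for n
    proof -
      note fg = hardy2_diff[OF h g, of n]
      have "(hardy2_norm (\<lambda>z. f n z - g z))\<^sup>2 \<le> (e/2)\<^sup>2"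
        unfolding hardy2_norm_sq[OF fg] using le[OF M n]
        by (simp add: taylor_coeff_diff hol hardy2_hol g tg)
      hence "hardy2_norm (\<lambda>z. f n z - g z) \<le> e/2"
        using e by (meson half_gt_zero less_imp_le power2_le_imp_le)
      thus ?thesis using e fg by simp
    qed
    thus "\<exists>no. \<forall>n\<ge>no. norm (hardy2_norm (\<lambda>z. f n z - g z) - 0) < e" by blast
  qed
  with g that show ?thesis by blast
qed

section \<open>Integration over the circle\<close>

lemma prob_space_arc_measure: "prob_space arc_measure"
  by (rule prob_spaceI) (rule emeasure_arc_measure_space)

lemma sets_arc_measure [simp, measurable_cong]: "sets arc_measure = sets circle_borel"
  by (simp add: arc_measure_def)

lemma space_circle_borel [simp]: "space circle_borel = sphere 0 1"
  by (simp add: circle_borel_def space_restrict_space)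

lemma space_arc_measure [simp]: "space arc_measure = sphere 0 1"
  by (simp add: arc_measure_def)

lemma borel_measurable_circle:
  fixes g :: "complex \<Rightarrow> 'a::topological_space"
  assumes "continuous_on (sphere 0 1) g"
  shows "g \<in> borel_measurable circle_borel"
  using borel_measurable_continuous_on_restrict[OF assms] by (simp add: circle_borel_def)

lemma arc_integral:
  fixes g :: "complex \<Rightarrow> 'a::{banach, second_countable_topology}"
  assumes g: "g \<in> borel_measurable circle_borel"
  shows "(\<integral>\<xi>. g \<xi> \<partial>arc_measure) = (\<integral>t. indicator {0..2*pi} t *\<^sub>R (g (cis t) /\<^sub>R (2 * pi)) \<partial>lborel)"
proof -
  have u: "uniform_measure lborel {0..2*pi} = density lborel (\<lambda>t. ennreal (indicator {0..2*pi} t / (2*pi)))"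
    unfolding uniform_measure_def
    by (rule density_cong) (auto simp: indicator_def divide_ennreal simp flip: ennreal_1)
  have c: "cis \<in> lborel \<rightarrow>\<^sub>M circle_borel"
    using cis_measurable_circle by (simp add: measurable_def uniform_measure_def)
  have "(\<integral>\<xi>. g \<xi> \<partial>arc_measure) = (\<integral>t. g (cis t) \<partial>uniform_measure lborel {0..2*pi})"
    unfolding arc_measure_def by (rule integral_distr[OF cis_measurable_circle g])
  also have "\<dots> = (\<integral>t. (indicator {0..2*pi} t / (2*pi)) *\<^sub>R g (cis t) \<partial>lborel)"
    unfolding u using measurable_compose[OF c g] by (intro integral_density) auto
  finally show ?thesis by (simp add: field_simps)
qed

lemma circle_bound:
  fixes g :: "complex \<Rightarrow> 'a::real_normed_vector"
  assumes "continuous_on (sphere 0 1) g"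
  obtains C where "\<And>\<xi>. norm \<xi> = 1 \<Longrightarrow> norm (g \<xi>) \<le> C"
proof -
  have "compact (g ` sphere 0 1)" by (intro compact_continuous_image assms) auto
  then obtain C where "\<And>x. x \<in> g ` sphere 0 1 \<Longrightarrow> norm x \<le> C"
    using compact_imp_bounded bounded_iff by metis
  thus ?thesis by (intro that[of C]) auto
qed

lemma circle_integrable:
  fixes g :: "complex \<Rightarrow> 'a::{banach, second_countable_topology}"
  assumes "finite_measure \<nu>" and sets: "sets \<nu> = sets circle_borel" and g: "continuous_on (sphere 0 1) g"
  shows "integrable \<nu> g"
proof -
  interpret finite_measure \<nu> by fact
  obtain C where "\<And>\<xi>. norm \<xi> = 1 \<Longrightarrow> norm (g \<xi>) \<le> C" using circle_bound[OF g] by blast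
  hence "AE \<xi> in \<nu>. norm (g \<xi>) \<le> C"
    by (intro AE_I2) (simp add: sets_eq_imp_space_eq[OF sets])
  moreover have "g \<in> borel_measurable \<nu>"
    using borel_measurable_circle[OF g] by (simp add: measurable_cong_sets[OF sets refl])
  ultimately show ?thesis by (rule integrable_const_bound)
qed

lemma arc_integrable:
  fixes g :: "complex \<Rightarrow> 'a::{banach, second_countable_topology}"
  assumes "continuous_on (sphere 0 1) g"
  shows "integrable arc_measure g"
  using prob_space_arc_measure assms
  by (intro circle_integrable) (auto simp: prob_space_def)

text \<open>For different exponents the integrand is \<open>cis (k t)\<close> with an integer \<open>k\<close> other than zero, which has
  a periodic primitive.\<close>

lemma arc_integral_character:
  "(\<integral>\<xi>. \<xi> ^ n * cnj \<xi> ^ m \<partial>arc_measure) = (if n = m then 1 else 0)"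
proof (cases "n = m")
  case True
  interpret prob_space arc_measure by (rule prob_space_arc_measure)
  have "(\<integral>\<xi>. \<xi> ^ n * cnj \<xi> ^ m \<partial>arc_measure) = (\<integral>\<xi>. 1 \<partial>arc_measure)"
    by (rule Bochner_Integration.integral_cong)
      (use True in \<open>auto simp: complex_norm_square[symmetric] simp flip: power_mult_distrib\<close>)
  thus ?thesis using True prob_space by simp
next
  case False
  define k where "k = real n - real m"
  have k: "k \<noteq> 0" using False by (simp add: k_def)
  have c: "cis t ^ n * cnj (cis t) ^ m = cis (k * t)" for t
    by (simp add: Complex.DeMoivre cis_cnj cis_mult k_def algebra_simps)
  define E where "E z = exp (\<i> * of_real k * z) / (\<i> * of_real k) /\<^sub>R (2 * pi)" for z
  define F where "F t = E (of_real t)" for t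
  have F: "F t = cis (k * t) / (\<i> * of_real k) /\<^sub>R (2 * pi)" for t
    by (simp add: F_def E_def cis_conv_exp mult.assoc)
  have "(E has_field_derivative exp (\<i> * of_real k * z) /\<^sub>R (2 * pi)) (at z)" for z
    unfolding E_def scaleR_conv_of_real using k by (auto intro!: derivative_eq_intros)
  from has_vector_derivative_real_field[OF this[of "of_real _"]]
  have d: "(F has_vector_derivative cis (k * t) /\<^sub>R (2 * pi)) (at t within {0..2*pi})" for t
    unfolding F_def by (simp add: cis_conv_exp mult.assoc)
  have "(\<integral>\<xi>. \<xi> ^ n * cnj \<xi> ^ m \<partial>arc_measure) =
     (\<integral>t. indicator {0..2*pi} t *\<^sub>R (cis (k * t) /\<^sub>R (2 * pi)) \<partial>lborel)"
    by (subst arc_integral) (auto intro!: borel_measurable_circle continuous_intros simp: c)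
  also have "\<dots> = F (2 * pi) - F 0"
  proof (rule integral_FTC_Icc)
    show "(F has_vector_derivative cis (k * t) /\<^sub>R (2 * pi)) (at t within {0..2*pi})" for t by (rule d)
  qed (auto intro!: continuous_intros)
  also have "cis (k * (2 * pi)) = 1"
  proof -
    have "cis (k * (2 * pi)) = cis (2 * pi * real n) / cis (2 * pi * real m)"
      by (simp add: cis_divide k_def algebra_simps)
    also have "\<dots> = 1" by (simp add: cis_multiple_2pi)
    finally show ?thesis .
  qed
  hence "F (2 * pi) - F 0 = 0" by (simp add: F)
  finally show ?thesis using False by simp
qed

text \<open>The terms are dominated by a constant multiple of the absolutely summable coefficients, so the sum
  and the integral may be interchanged. All moment computations below rest on this.\<close>

lemma arc_integral_powser:
  fixes a :: "nat \<Rightarrow> complex"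
  assumes a: "summable (\<lambda>n. norm (a n))"
    and g: "continuous_on (sphere 0 1) g"
  shows "(\<lambda>n. a n * (\<integral>\<xi>. \<xi> ^ n * g \<xi> \<partial>arc_measure)) sums (\<integral>\<xi>. (\<Sum>n. a n * \<xi> ^ n) * g \<xi> \<partial>arc_measure)"
proof -
  interpret prob_space arc_measure by (rule prob_space_arc_measure)
  obtain C where C: "\<And>\<xi>. norm \<xi> = 1 \<Longrightarrow> norm (g \<xi>) \<le> C" using circle_bound[OF g] by blast
  have int: "integrable arc_measure (\<lambda>\<xi>. \<xi> ^ n * g \<xi>)" for n
    by (intro arc_integrable continuous_intros g)
  have s: "summable (\<lambda>n. norm (a n * (\<xi> ^ n * g \<xi>)))" if "norm \<xi> = 1" for \<xi>
    using summable_mult2[OF a, of "norm (g \<xi>)"] that by (simp add: norm_mult norm_power)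
  have "(\<lambda>n. \<integral>\<xi>. a n * (\<xi> ^ n * g \<xi>) \<partial>arc_measure) sums (\<integral>\<xi>. (\<Sum>n. a n * (\<xi> ^ n * g \<xi>)) \<partial>arc_measure)"
  proof (rule sums_integral)
    show "AE \<xi> in arc_measure. summable (\<lambda>n. norm (a n * (\<xi> ^ n * g \<xi>)))"
      by (rule AE_I2) (use s in simp)
    show "summable (\<lambda>n. \<integral>\<xi>. norm (a n * (\<xi> ^ n * g \<xi>)) \<partial>arc_measure)"
    proof (rule summable_comparison_test')
      show "summable (\<lambda>n. norm (a n) * C)" using a by (rule summable_mult2)
      fix n
      have "(\<integral>\<xi>. norm (a n * (\<xi> ^ n * g \<xi>)) \<partial>arc_measure) \<le> (\<integral>\<xi>. norm (a n) * C \<partial>arc_measure)"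
        using C int by (intro integral_mono integrable_norm integrable_mult_right integrable_const)
          (auto simp: norm_mult norm_power mult_left_mono)
      thus "norm (\<integral>\<xi>. norm (a n * (\<xi> ^ n * g \<xi>)) \<partial>arc_measure) \<le> norm (a n) * C"
        using prob_space by simp
    qed
  qed (use int in \<open>intro integrable_mult_right\<close>)
  also have "(\<integral>\<xi>. (\<Sum>n. a n * (\<xi> ^ n * g \<xi>)) \<partial>arc_measure) = (\<integral>\<xi>. (\<Sum>n. a n * \<xi> ^ n) * g \<xi> \<partial>arc_measure)"
  proof (rule Bochner_Integration.integral_cong[OF refl])
    fix \<xi> :: complex assume "\<xi> \<in> space arc_measure"
    hence "summable (\<lambda>n. a n * \<xi> ^ n)"
      by (intro summable_norm_cancel[of "\<lambda>n. a n * \<xi> ^ n"]) (use a in \<open>simp add: norm_mult norm_power\<close>)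
    from suminf_mult2[OF this, of "g \<xi>"] show "(\<Sum>n. a n * (\<xi> ^ n * g \<xi>)) = (\<Sum>n. a n * \<xi> ^ n) * g \<xi>"
      by (simp add: mult.assoc)
  qed
  finally show ?thesis by simp
qed

lemma disc_circle_continuous:
  fixes f :: "complex \<Rightarrow> complex"
  assumes "f holomorphic_on ball 0 1" "0 \<le> r" "r < 1"
  shows "continuous_on (sphere 0 1) (\<lambda>\<xi>. f (of_real r * \<xi>))"
proof (rule continuous_on_compose2[OF holomorphic_on_imp_continuous_on[OF assms(1)]])
  show "(\<lambda>\<xi>::complex. of_real r * \<xi>) ` sphere 0 1 \<subseteq> ball 0 1" using assms by (auto simp: dist_norm norm_mult)
qed (intro continuous_intros)

lemma disc_circle_series:
  assumes "f holomorphic_on ball 0 1" "0 \<le> r" "r < 1" "norm \<xi> = 1"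
  shows "f (of_real r * \<xi>) = (\<Sum>n. (taylor_coeff f n * of_real r ^ n) * \<xi> ^ n)"
  using taylor_sums[OF assms(1), of "of_real r * \<xi>"] assms
  by (simp add: sums_iff norm_mult power_mult_distrib mult.assoc)

lemma arc_integral_disc_function:
  assumes f: "f holomorphic_on ball 0 1" "0 \<le> r" "r < 1"
    and g: "continuous_on (sphere 0 1) g"
  shows "(\<lambda>n. (taylor_coeff f n * of_real r ^ n) * (\<integral>\<xi>. \<xi> ^ n * g \<xi> \<partial>arc_measure)) sums
           (\<integral>\<xi>. f (of_real r * \<xi>) * g \<xi> \<partial>arc_measure)"
proof -
  have "summable (\<lambda>n. norm (taylor_coeff f n * of_real r ^ n))"
    using taylor_summable_norm[OF f] f(2) by (simp add: norm_mult norm_power)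
  from arc_integral_powser[OF this g]
  have "(\<lambda>n. (taylor_coeff f n * of_real r ^ n) * (\<integral>\<xi>. \<xi> ^ n * g \<xi> \<partial>arc_measure)) sums
     (\<integral>\<xi>. (\<Sum>n. (taylor_coeff f n * of_real r ^ n) * \<xi> ^ n) * g \<xi> \<partial>arc_measure)" .
  also have "(\<integral>\<xi>. (\<Sum>n. (taylor_coeff f n * of_real r ^ n) * \<xi> ^ n) * g \<xi> \<partial>arc_measure) =
      (\<integral>\<xi>. f (of_real r * \<xi>) * g \<xi> \<partial>arc_measure)"
    by (rule Bochner_Integration.integral_cong[OF refl]) (use disc_circle_series[OF f] in simp)
  finally show ?thesis .
qed

lemma arc_moment_antiholomorphic:
  assumes f: "f holomorphic_on ball 0 1" "0 \<le> r" "r < 1"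
  shows "(\<integral>\<xi>. f (of_real r * \<xi>) * cnj \<xi> ^ n \<partial>arc_measure) = taylor_coeff f n * of_real r ^ n"
proof -
  have "(\<lambda>k. (taylor_coeff f k * of_real r ^ k) * (\<integral>\<xi>. \<xi> ^ k * cnj \<xi> ^ n \<partial>arc_measure)) sums
           (\<integral>\<xi>. f (of_real r * \<xi>) * cnj \<xi> ^ n \<partial>arc_measure)"
    by (intro arc_integral_disc_function f continuous_intros)
  hence "(\<lambda>k. if k = n then taylor_coeff f k * of_real r ^ k else 0) sums
           (\<integral>\<xi>. f (of_real r * \<xi>) * cnj \<xi> ^ n \<partial>arc_measure)"
    by (simp add: arc_integral_character if_distrib cong: if_cong)
  moreover have "(\<lambda>k. if k = n then taylor_coeff f k * of_real r ^ k else 0) sums (taylor_coeff f n * of_real r ^ n)"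
    using sums_single[of n "\<lambda>k. taylor_coeff f k * of_real r ^ k"] by simp
  ultimately show ?thesis using sums_unique2 by blast
qed

lemma arc_moment_holomorphic:
  assumes f: "f holomorphic_on ball 0 1" "0 \<le> r" "r < 1"
  shows "(\<integral>\<xi>. f (of_real r * \<xi>) * \<xi> ^ n \<partial>arc_measure) = (if n = 0 then taylor_coeff f 0 else 0)"
proof -
  have e: "(\<integral>\<xi>. \<xi> ^ k * \<xi> ^ n \<partial>arc_measure) = (if k + n = 0 then 1 else 0)" for k
    using arc_integral_character[of "k + n" 0] by (simp add: power_add)
  have "(\<lambda>k. (taylor_coeff f k * of_real r ^ k) * (\<integral>\<xi>. \<xi> ^ k * \<xi> ^ n \<partial>arc_measure)) sums
           (\<integral>\<xi>. f (of_real r * \<xi>) * \<xi> ^ n \<partial>arc_measure)"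
    by (intro arc_integral_disc_function f continuous_intros)
  hence "(\<lambda>k. if k = 0 then (if n = 0 then taylor_coeff f 0 else 0) else 0) sums
           (\<integral>\<xi>. f (of_real r * \<xi>) * \<xi> ^ n \<partial>arc_measure)"
    unfolding e by (elim back_subst[of "\<lambda>f. f sums _"]) auto
  moreover have "(\<lambda>k. if k = 0 then (if n = 0 then taylor_coeff f 0 else 0) else 0) sums (if n = 0 then taylor_coeff f 0 else 0)"
    using sums_single[of 0 "\<lambda>k. if n = 0 then taylor_coeff f 0 else 0"] by simp
  ultimately show ?thesis using sums_unique2 by blast
qed

text \<open>Parseval's identity, from two applications of the termwise integration: first to \<open>f\<close>, then to
  each moment of its conjugate. It replaces boundary values by means over circles inside the disc.\<close>

lemma parseval_circle:
  assumes f: "f holomorphic_on ball 0 1" "0 \<le> r" "r < 1"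
  shows "(\<lambda>n. (norm (taylor_coeff f n))\<^sup>2 * r ^ (2 * n)) sums
           (\<integral>\<xi>. (norm (f (of_real r * \<xi>)))\<^sup>2 \<partial>arc_measure)"
proof -
  have coef: "(\<integral>\<xi>. \<xi> ^ n * cnj (f (of_real r * \<xi>)) \<partial>arc_measure) = cnj (taylor_coeff f n * of_real r ^ n)" for n
    using Bochner_Integration.integral_cnj[of arc_measure "\<lambda>\<xi>. f (of_real r * \<xi>) * cnj \<xi> ^ n"]
    unfolding arc_moment_antiholomorphic[OF f] by (simp add: mult.commute)
  have "(\<lambda>n. (taylor_coeff f n * of_real r ^ n) * (\<integral>\<xi>. \<xi> ^ n * cnj (f (of_real r * \<xi>)) \<partial>arc_measure)) sums
         (\<integral>\<xi>. f (of_real r * \<xi>) * cnj (f (of_real r * \<xi>)) \<partial>arc_measure)"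
    by (intro arc_integral_disc_function f continuous_on_cnj disc_circle_continuous)
  also have "(\<integral>\<xi>. f (of_real r * \<xi>) * cnj (f (of_real r * \<xi>)) \<partial>arc_measure) =
       of_real (\<integral>\<xi>. (norm (f (of_real r * \<xi>)))\<^sup>2 \<partial>arc_measure)"
    unfolding integral_complex_of_real[symmetric] complex_norm_square ..
  also have "(\<lambda>n. (taylor_coeff f n * of_real r ^ n) * (\<integral>\<xi>. \<xi> ^ n * cnj (f (of_real r * \<xi>)) \<partial>arc_measure)) =
     (\<lambda>n. of_real ((norm (taylor_coeff f n))\<^sup>2 * r ^ (2 * n)))"
    unfolding coef complex_norm_square[symmetric] using f(2)
    by (simp add: norm_mult norm_power power_mult_distrib power_mult fun_eq_iff flip: power_mult)
      (simp add: mult.commute)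
  finally show ?thesis by (simp only: sums_of_real_iff)
qed

section \<open>Point evaluation and Taylor polynomials\<close>

definition szego_kernel :: "complex \<Rightarrow> complex \<Rightarrow> complex" where
  "szego_kernel w z = 1 / (1 - cnj w * z)"

lemma szego_kernel:
  assumes "norm w < 1"
  shows "szego_kernel w \<in> hardy2" "taylor_coeff (szego_kernel w) n = cnj w ^ n"
proof -
  have s: "summable (\<lambda>n. (norm (cnj w ^ n))\<^sup>2)"
    using assms by (simp add: norm_power power_mult[symmetric] mult.commute[of _ 2])
      (simp add: power_mult summable_geometric abs_square_less_1)
  have e: "szego_kernel w z = (\<Sum>n. cnj w ^ n * z ^ n)" if "norm z < 1" for z
  proof -
    have "norm (cnj w * z) < 1"
      using mult_strict_mono'[of "norm w" 1 "norm z" 1] assms that by (simp add: norm_mult)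
    from suminf_geometric[OF this] show ?thesis
      by (simp add: szego_kernel_def power_mult_distrib)
  qed
  show "szego_kernel w \<in> hardy2" "taylor_coeff (szego_kernel w) n = cnj w ^ n"
    using hardy2_of_coeffs[OF s e] by auto
qed

lemma szego_reproducing:
  assumes "f \<in> hardy2" "norm w < 1"
  shows "hardy2_inner f (szego_kernel w) = f w"
  using taylor_sums[OF hardy2_hol[OF assms(1)] assms(2)]
  by (simp add: hardy2_inner_def szego_kernel assms sums_iff)

text \<open>By the reproducing property of the Szego kernel and the Cauchy--Schwarz inequality.\<close>

lemma hardy2_eval_bound:
  assumes "norm w < 1"
  shows "\<exists>C>0. \<forall>f\<in>hardy2. norm (f w) \<le> C * hardy2_norm f"
proof (intro exI conjI ballI)
  show "hardy2_norm (szego_kernel w) + 1 > 0"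
    using szego_kernel(1)[OF assms] hardy2_norm_nonneg by (simp add: add_nonneg_pos)
  fix f assume f: "f \<in> hardy2"
  have "norm (f w) \<le> hardy2_norm f * hardy2_norm (szego_kernel w)"
    using hardy2_cauchy_schwarz[OF f szego_kernel(1)[OF assms]] szego_reproducing[OF f assms] by simp
  also have "\<dots> \<le> (hardy2_norm (szego_kernel w) + 1) * hardy2_norm f"
    using f by (simp add: algebra_simps)
  finally show "norm (f w) \<le> (hardy2_norm (szego_kernel w) + 1) * hardy2_norm f" .
qed

definition taylor_poly :: "nat \<Rightarrow> (complex \<Rightarrow> complex) \<Rightarrow> complex \<Rightarrow> complex" where
  "taylor_poly N f z = (\<Sum>n<N. taylor_coeff f n * z ^ n)"

lemma taylor_poly:
  shows "taylor_poly N f \<in> hardy2"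
    and "taylor_coeff (taylor_poly N f) n = (if n < N then taylor_coeff f n else 0)"
proof -
  let ?a = "\<lambda>n. if n < N then taylor_coeff f n else 0"
  have s: "summable (\<lambda>n. (norm (?a n))\<^sup>2)"
    by (rule summable_finite[of "{..<N}"]) auto
  have e: "taylor_poly N f z = (\<Sum>n. ?a n * z ^ n)" for z
    unfolding taylor_poly_def by (subst suminf_finite[of "{..<N}"]) auto
  show "taylor_poly N f \<in> hardy2" "taylor_coeff (taylor_poly N f) n = ?a n"
    using hardy2_of_coeffs[OF s e] by auto
qed

lemma taylor_poly_tendsto:
  assumes f: "f \<in> hardy2"
  shows "(\<lambda>N. hardy2_norm (\<lambda>z. f z - taylor_poly N f z)) \<longlonglongrightarrow> 0"
proof -
  let ?c = "\<lambda>n. (norm (taylor_coeff f n))\<^sup>2"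
  have "hardy2_norm (\<lambda>z. f z - taylor_poly N f z) = sqrt (suminf ?c - sum ?c {..<N})" for N
  proof -
    have "(\<Sum>n. (norm (taylor_coeff (\<lambda>z. f z - taylor_poly N f z) n))\<^sup>2) = (\<Sum>n. ?c (n + N))"
    proof -
      have "(norm (taylor_coeff (\<lambda>z. f z - taylor_poly N f z) n))\<^sup>2 = (if n < N then 0 else ?c n)" for n
        by (simp add: taylor_coeff_diff hardy2_hol f taylor_poly)
      hence "(\<Sum>n. (norm (taylor_coeff (\<lambda>z. f z - taylor_poly N f z) n))\<^sup>2) = (\<Sum>n. if n < N then 0 else ?c n)"
        by simp
      moreover have "summable (\<lambda>n. if n < N then 0 else ?c n)"
        by (rule summable_comparison_test'[OF hardy2_summable[OF f]]) auto
      from suminf_split_initial_segment[OF this, of N]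
      have "(\<Sum>n. if n < N then 0 else ?c n) = (\<Sum>n. ?c (n + N))" by simp
      ultimately show ?thesis by simp
    qed
    also have "\<dots> = suminf ?c - sum ?c {..<N}"
      by (rule suminf_minus_initial_segment[OF hardy2_summable[OF f]])
    finally show ?thesis by (simp add: hardy2_norm_def)
  qed
  moreover have "(\<lambda>N. sqrt (suminf ?c - sum ?c {..<N})) \<longlonglongrightarrow> sqrt (suminf ?c - suminf ?c)"
    by (intro tendsto_intros summable_LIMSEQ hardy2_summable f)
  ultimately show ?thesis by simp
qed

section \<open>Multiplication by an inner function\<close>

text \<open>The shift by two keeps the first radius positive.\<close>

definition radii :: "nat \<Rightarrow> real" where "radii k = 1 - 1 / (real k + 2)"

lemma radii_bounds: "0 < radii k" "radii k < 1"
  by (auto simp: radii_def field_simps)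

lemma radii_tendsto: "radii \<longlonglongrightarrow> 1"
proof -
  have "(\<lambda>k. 1 - 1 / (real k + 2)) \<longlonglongrightarrow> 1" by real_asymp
  thus ?thesis by (simp add: radii_def[abs_def])
qed

lemma parseval_circle_le_norm:
  assumes "f \<in> hardy2" "0 \<le> r" "r < 1"
  shows "(\<integral>\<xi>. (norm (f (of_real r * \<xi>)))\<^sup>2 \<partial>arc_measure) \<le> (hardy2_norm f)\<^sup>2"
  unfolding hardy2_norm_sq[OF assms(1)]
proof (rule sums_le[OF _ parseval_circle[OF hardy2_hol[OF assms(1)] assms(2,3)] summable_sums[OF hardy2_summable[OF assms(1)]]])
  show "(norm (taylor_coeff f n))\<^sup>2 * r ^ (2 * n) \<le> (norm (taylor_coeff f n))\<^sup>2" for n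
    using assms by (intro mult_left_le power_le_one) auto
qed

text \<open>Each finite sum of squared coefficients is, after weighting by powers of the radius, at most a
  mean over a circle; the weights tend to one.\<close>

lemma hardy2_from_circle_means:
  assumes f: "f holomorphic_on ball 0 1"
    and B: "\<And>k. (\<integral>\<xi>. (norm (f (of_real (radii k) * \<xi>)))\<^sup>2 \<partial>arc_measure) \<le> u k"
    and u: "u \<longlonglongrightarrow> B" "B \<ge> 0"
  shows "f \<in> hardy2" "(hardy2_norm f)\<^sup>2 \<le> B"
proof -
  have fin: "(\<Sum>n<N. (norm (taylor_coeff f n))\<^sup>2) \<le> B" for N
  proof (rule LIMSEQ_le)
    show "(\<lambda>k. \<Sum>n<N. (norm (taylor_coeff f n))\<^sup>2 * radii k ^ (2 * n)) \<longlonglongrightarrow> (\<Sum>n<N. (norm (taylor_coeff f n))\<^sup>2)"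
      by (rule tendsto_eq_intros radii_tendsto | simp)+
    have "(\<Sum>n<N. (norm (taylor_coeff f n))\<^sup>2 * radii k ^ (2 * n)) \<le> u k" for k
    proof -
      have p: "(\<lambda>n. (norm (taylor_coeff f n))\<^sup>2 * radii k ^ (2 * n)) sums
           (\<integral>\<xi>. (norm (f (of_real (radii k) * \<xi>)))\<^sup>2 \<partial>arc_measure)"
        using radii_bounds[of k] by (intro parseval_circle f) auto
      have "(\<Sum>n<N. (norm (taylor_coeff f n))\<^sup>2 * radii k ^ (2 * n)) \<le>
          (\<integral>\<xi>. (norm (f (of_real (radii k) * \<xi>)))\<^sup>2 \<partial>arc_measure)"
        unfolding sums_unique[OF p]
        by (rule sum_le_suminf) (use p radii_bounds[of k] in \<open>auto simp: sums_iff\<close>)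
      with B[of k] show ?thesis by linarith
    qed
    thus "\<exists>N'. \<forall>k\<ge>N'. (\<Sum>n<N. (norm (taylor_coeff f n))\<^sup>2 * radii k ^ (2 * n)) \<le> u k" by blast
  qed (use u in auto)
  have s: "summable (\<lambda>n. (norm (taylor_coeff f n))\<^sup>2)"
    by (rule summableI_nonneg_bounded[of _ B]) (use fin in auto)
  thus h: "f \<in> hardy2" using f by (simp add: hardy2_def)
  show "(hardy2_norm f)\<^sup>2 \<le> B"
    unfolding hardy2_norm_sq[OF h] by (rule suminf_le_const[OF s]) (use fin in auto)
qed

text \<open>A pointwise bound for the multiplier carries over to the means over circles.\<close>

lemma bounded_multiplier:
  assumes \<theta>: "\<theta> holomorphic_on ball 0 1" "\<And>z. norm z < 1 \<Longrightarrow> norm (\<theta> z) \<le> 1" and g: "g \<in> hardy2"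
  shows "(\<lambda>z. \<theta> z * g z) \<in> hardy2" "hardy2_norm (\<lambda>z. \<theta> z * g z) \<le> hardy2_norm g"
proof -
  have hol: "(\<lambda>z. \<theta> z * g z) holomorphic_on ball 0 1"
    using \<theta>(1) hardy2_hol[OF g] by (intro holomorphic_intros)
  have m: "(\<integral>\<xi>. (norm (\<theta> (of_real (radii k) * \<xi>) * g (of_real (radii k) * \<xi>)))\<^sup>2 \<partial>arc_measure) \<le> (hardy2_norm g)\<^sup>2" for k
  proof -
    have r: "0 \<le> radii k" "radii k < 1" using radii_bounds[of k] by auto
    have "(\<integral>\<xi>. (norm (\<theta> (of_real (radii k) * \<xi>) * g (of_real (radii k) * \<xi>)))\<^sup>2 \<partial>arc_measure) \<le>
       (\<integral>\<xi>. (norm (g (of_real (radii k) * \<xi>)))\<^sup>2 \<partial>arc_measure)"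
    proof (rule integral_mono)
      show "integrable arc_measure (\<lambda>\<xi>. (norm (\<theta> (of_real (radii k) * \<xi>) * g (of_real (radii k) * \<xi>)))\<^sup>2)"
        by (intro arc_integrable continuous_intros disc_circle_continuous \<theta>(1) hardy2_hol[OF g] r)
      show "integrable arc_measure (\<lambda>\<xi>. (norm (g (of_real (radii k) * \<xi>)))\<^sup>2)"
        by (intro arc_integrable continuous_intros disc_circle_continuous hardy2_hol[OF g] r)
      fix \<xi> assume "\<xi> \<in> space arc_measure"
      hence "norm (of_real (radii k) * \<xi>) < 1" using r by (simp add: norm_mult)
      from \<theta>(2)[OF this] show "(norm (\<theta> (of_real (radii k) * \<xi>) * g (of_real (radii k) * \<xi>)))\<^sup>2
          \<le> (norm (g (of_real (radii k) * \<xi>)))\<^sup>2"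
        by (intro power_mono) (auto simp: norm_mult intro: mult_left_le_one_le)
    qed
    with parseval_circle_le_norm[OF g r] show ?thesis by linarith
  qed
  note * = hardy2_from_circle_means[OF hol m tendsto_const zero_le_power2]
  show "(\<lambda>z. \<theta> z * g z) \<in> hardy2" by (rule *(1))
  show "hardy2_norm (\<lambda>z. \<theta> z * g z) \<le> hardy2_norm g"
    by (rule power2_le_imp_le[OF *(2)]) (use g in simp)
qed

lemma inner_functionD:
  assumes "inner_function \<theta>"
  shows "\<theta> holomorphic_on ball 0 1" "\<And>z. norm z < 1 \<Longrightarrow> norm (\<theta> z) \<le> 1"
    "AE \<xi> in arc_measure. (\<lambda>k. norm (\<theta> (of_real (radii k) * \<xi>))) \<longlonglongrightarrow> 1"
proof -
  show "\<theta> holomorphic_on ball 0 1" "\<And>z. norm z < 1 \<Longrightarrow> norm (\<theta> z) \<le> 1"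
    using assms by (auto simp: inner_function_def)
  have "filterlim radii (at_left 1) sequentially"
    unfolding filterlim_at
    using radii_bounds radii_tendsto by (auto intro!: always_eventually less_imp_neq)
  hence "(\<lambda>k. norm (\<theta> (of_real (radii k) * \<xi>))) \<longlonglongrightarrow> 1"
    if "norm l = 1" "((\<lambda>r. \<theta> (of_real r * \<xi>)) \<longlongrightarrow> l) (at_left (1::real))" for \<xi> l
    using tendsto_norm[OF filterlim_compose[OF that(2)]] that(1) by simp
  moreover have "AE \<xi> in arc_measure.
        \<exists>l. norm l = 1 \<and> ((\<lambda>r. \<theta> (of_real r * \<xi>)) \<longlongrightarrow> l) (at_left (1::real))"
    using assms by (simp add: inner_function_def)
  ultimately show "AE \<xi> in arc_measure. (\<lambda>k. norm (\<theta> (of_real (radii k) * \<xi>))) \<longlonglongrightarrow> 1"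
    by (auto elim!: eventually_mono)
qed

lemma inner_multiplier:
  assumes "inner_function \<theta>" "g \<in> hardy2"
  shows "(\<lambda>z. \<theta> z * g z) \<in> hardy2" "hardy2_norm (\<lambda>z. \<theta> z * g z) \<le> hardy2_norm g"
  by (rule bounded_multiplier; use inner_functionD[OF assms(1)] assms(2) in simp)+

lemma inner_function_const_one: "inner_function (\<lambda>z. 1)"
  by (auto simp: inner_function_def intro!: exI[of _ 1])

text \<open>Bounded convergence: almost every radial limit of an inner function is unimodular.\<close>

lemma inner_function_mean_limit:
  assumes \<theta>: "inner_function \<theta>" and p: "continuous_on (cball 0 1) p" "p holomorphic_on ball 0 1"
  shows "(\<lambda>k. \<integral>\<xi>. (norm (\<theta> (of_real (radii k) * \<xi>) * p (of_real (radii k) * \<xi>)))\<^sup>2 \<partial>arc_measure)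
           \<longlonglongrightarrow> (\<integral>\<xi>. (norm (p \<xi>))\<^sup>2 \<partial>arc_measure)"
proof -
  interpret prob_space arc_measure by (rule prob_space_arc_measure)
  note \<theta>' = inner_functionD[OF \<theta>]
  have "compact (p ` cball 0 1)" by (intro compact_continuous_image p) auto
  then obtain C where C: "\<And>x. norm x \<le> 1 \<Longrightarrow> norm (p x) \<le> C"
    using compact_imp_bounded bounded_iff by (metis imageI mem_cball_0)
  have r: "0 \<le> radii k" "radii k < 1" for k using radii_bounds[of k] by auto
  show ?thesis
  proof (rule integral_dominated_convergence[where w="\<lambda>_. C\<^sup>2"])
    have "(\<lambda>\<xi>. (norm (p \<xi>))\<^sup>2) \<in> borel_measurable circle_borel"
      by (intro borel_measurable_circle continuous_intros continuous_on_subset[OF p(1)]) auto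
    thus "(\<lambda>\<xi>. (norm (p \<xi>))\<^sup>2) \<in> borel_measurable arc_measure" by simp
    fix k
    have "(\<lambda>\<xi>. (norm (\<theta> (of_real (radii k) * \<xi>) * p (of_real (radii k) * \<xi>)))\<^sup>2) \<in> borel_measurable circle_borel"
      by (intro borel_measurable_circle continuous_intros disc_circle_continuous \<theta>' p r)
    thus "(\<lambda>\<xi>. (norm (\<theta> (of_real (radii k) * \<xi>) * p (of_real (radii k) * \<xi>)))\<^sup>2) \<in> borel_measurable arc_measure"
      by simp
    show "AE \<xi> in arc_measure. norm ((norm (\<theta> (of_real (radii k) * \<xi>) * p (of_real (radii k) * \<xi>)))\<^sup>2) \<le> C\<^sup>2"
    proof (rule AE_I2)
      fix \<xi> assume "\<xi> \<in> space arc_measure"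
      hence n: "norm (of_real (radii k) * \<xi>) < 1" using r[of k] by (simp add: norm_mult)
      have "norm (\<theta> (of_real (radii k) * \<xi>) * p (of_real (radii k) * \<xi>)) \<le> 1 * C"
        unfolding norm_mult using \<theta>'(2)[OF n] C[of "of_real (radii k) * \<xi>"] n by (intro mult_mono) auto
      thus "norm ((norm (\<theta> (of_real (radii k) * \<xi>) * p (of_real (radii k) * \<xi>)))\<^sup>2) \<le> C\<^sup>2"
        by (auto intro: power_mono)
    qed
  next
    show "AE \<xi> in arc_measure. (\<lambda>k. (norm (\<theta> (of_real (radii k) * \<xi>) * p (of_real (radii k) * \<xi>)))\<^sup>2)
        \<longlonglongrightarrow> (norm (p \<xi>))\<^sup>2"
      using \<theta>'(3) AE_space
    proof eventually_elim
      case (elim \<xi>)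
      have "(\<lambda>k. of_real (radii k) * \<xi>) \<longlonglongrightarrow> of_real 1 * \<xi>"
        by (intro tendsto_intros radii_tendsto)
      moreover have "\<forall>\<^sub>F k in sequentially. of_real (radii k) * \<xi> \<in> cball 0 1"
        using elim(2) r by (auto simp: norm_mult intro!: always_eventually less_imp_le)
      ultimately have "(\<lambda>k. p (of_real (radii k) * \<xi>)) \<longlonglongrightarrow> p \<xi>"
        using elim(2) by (intro continuous_on_tendsto_compose[OF p(1)]) auto
      from tendsto_power[OF tendsto_mult[OF elim(1) tendsto_norm[OF this]], of 2] show ?case
        by (simp add: norm_mult)
    qed
  qed simp
qed

text \<open>The contraction estimate gives one inequality. For the other one, \<open>inner_function_mean_limit\<close>
  applied to \<open>\<theta>\<close> and to the constant one treats functions continuous on the closed disc, among them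
  the Taylor polynomials; these approximate \<open>g\<close>, and multiplication by \<open>\<theta>\<close> does not increase the error.\<close>

lemma inner_function_isometry_norm:
  assumes \<theta>: "inner_function \<theta>" and g: "g \<in> hardy2"
  shows "hardy2_norm (\<lambda>z. \<theta> z * g z) = hardy2_norm g"
proof (rule antisym)
  note mult = inner_multiplier[OF \<theta>]
  show "hardy2_norm (\<lambda>z. \<theta> z * g z) \<le> hardy2_norm g" using g by (intro mult)
  have poly: "hardy2_norm p \<le> hardy2_norm (\<lambda>z. \<theta> z * p z)"
    if p: "p \<in> hardy2" "continuous_on (cball 0 1) p" for p
  proof (rule power2_le_imp_le)
    note lim = inner_function_mean_limit[OF _ p(2) hardy2_hol[OF p(1)]]
    have "(hardy2_norm p)\<^sup>2 \<le> (\<integral>\<xi>. (norm (p \<xi>))\<^sup>2 \<partial>arc_measure)"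
      using lim[OF inner_function_const_one]
      by (intro hardy2_from_circle_means(2)[OF hardy2_hol[OF p(1)] order_refl]) auto
    also have "\<dots> \<le> (hardy2_norm (\<lambda>z. \<theta> z * p z))\<^sup>2"
    proof (rule tendsto_upperbound[OF lim[OF \<theta>]])
      show "\<forall>\<^sub>F k in sequentially. (\<integral>\<xi>. (norm (\<theta> (of_real (radii k) * \<xi>) * p (of_real (radii k) * \<xi>)))\<^sup>2 \<partial>arc_measure)
          \<le> (hardy2_norm (\<lambda>z. \<theta> z * p z))\<^sup>2"
        using parseval_circle_le_norm[OF mult(1)[OF p(1)]] radii_bounds by (intro always_eventually) (auto intro: less_imp_le)
    qed simp
    finally show "(hardy2_norm p)\<^sup>2 \<le> (hardy2_norm (\<lambda>z. \<theta> z * p z))\<^sup>2" .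
    show "hardy2_norm (\<lambda>z. \<theta> z * p z) \<ge> 0" using mult(1)[OF p(1)] by simp
  qed
  show "hardy2_norm g \<le> hardy2_norm (\<lambda>z. \<theta> z * g z)"
  proof (rule LIMSEQ_le_const)
    define d where "d N z = g z - taylor_poly N g z" for N z
    have d: "d N \<in> hardy2" for N unfolding d_def by (intro hardy2_diff g taylor_poly)
    show "(\<lambda>N. hardy2_norm (\<lambda>z. \<theta> z * g z) + 2 * hardy2_norm (d N)) \<longlonglongrightarrow> hardy2_norm (\<lambda>z. \<theta> z * g z)"
      using tendsto_add[OF tendsto_const tendsto_mult[OF tendsto_const taylor_poly_tendsto[OF g]], of _ 2]
      by (simp add: d_def[abs_def])
    have "hardy2_norm g \<le> hardy2_norm (\<lambda>z. \<theta> z * g z) + 2 * hardy2_norm (d N)" for N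
    proof -
      have "hardy2_norm g \<le> hardy2_norm (d N) + hardy2_norm (taylor_poly N g)"
        using hardy2_norm_triangle[OF d taylor_poly(1), of N N g] by (simp add: d_def)
      also have "hardy2_norm (taylor_poly N g) \<le> hardy2_norm (\<lambda>z. \<theta> z * taylor_poly N g z)"
        by (rule poly[OF taylor_poly(1)]) (unfold taylor_poly_def, intro continuous_intros)
      also have "\<dots> \<le> hardy2_norm (\<lambda>z. \<theta> z * g z) + hardy2_norm (\<lambda>z. - 1 * (\<theta> z * d N z))"
        using hardy2_norm_triangle[OF mult(1)[OF g] hardy2_cmult[OF mult(1)[OF d]], of "-1" N]
        by (simp add: d_def algebra_simps)
      also have "hardy2_norm (\<lambda>z. - 1 * (\<theta> z * d N z)) \<le> hardy2_norm (d N)"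
        using mult(2)[OF d, of N] by (simp only: hardy2_norm_cmult[OF mult(1)[OF d]]) simp
      finally show ?thesis by simp
    qed
    thus "\<exists>N. \<forall>n\<ge>N. hardy2_norm g \<le> hardy2_norm (\<lambda>z. \<theta> z * g z) + 2 * hardy2_norm (d n)" by blast
  qed
qed

text \<open>Polarization: the norms determine the real parts of inner products, and multiplication by the
  imaginary unit turns imaginary parts into real parts.\<close>

lemma inner_function_isometry:
  assumes \<theta>: "inner_function \<theta>" and f: "f \<in> hardy2" and g: "g \<in> hardy2"
  shows "hardy2_inner (\<lambda>z. \<theta> z * f z) (\<lambda>z. \<theta> z * g z) = hardy2_inner f g"
proof -
  note mult = inner_multiplier(1)[OF \<theta>]
  have Re: "Re (hardy2_inner (\<lambda>z. \<theta> z * u z) (\<lambda>z. \<theta> z * g z)) = Re (hardy2_inner u g)" if u: "u \<in> hardy2" for u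
  proof -
    have "hardy2_norm (\<lambda>z. \<theta> z * u z + \<theta> z * g z) = hardy2_norm (\<lambda>z. u z + g z)"
      using inner_function_isometry_norm[OF \<theta> hardy2_add[OF u g]] by (simp add: ring_distribs)
    with hardy2_norm_add_sq[OF u g] hardy2_norm_add_sq[OF mult[OF u] mult[OF g]]
    show ?thesis
      by (simp add: inner_function_isometry_norm[OF \<theta>] u g)
  qed
  have "Im w = - Re (\<i> * w)" for w by simp
  moreover have "\<i> * hardy2_inner (\<lambda>z. \<theta> z * f z) (\<lambda>z. \<theta> z * g z) = hardy2_inner (\<lambda>z. \<theta> z * (\<i> * f z)) (\<lambda>z. \<theta> z * g z)"
    using hardy2_inner_cmult_left[OF mult[OF f] mult[OF g], of \<i>] by (simp add: mult.left_commute)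
  moreover have "\<i> * hardy2_inner f g = hardy2_inner (\<lambda>z. \<i> * f z) g"
    using hardy2_inner_cmult_left[OF f g, of \<i>] by simp
  ultimately show ?thesis
    using Re[OF f] Re[OF hardy2_cmult[OF f, of \<i>]] by (simp add: complex_eq_iff)
qed

section \<open>The model space and its kernels\<close>

lemma model_spaceD:
  assumes "f \<in> model_space \<theta>"
  shows "f \<in> hardy2" "g \<in> hardy2 \<Longrightarrow> hardy2_inner f (\<lambda>z. \<theta> z * g z) = 0"
  using assms by (auto simp: model_space_def)

lemma model_space_zero [simp]: "(\<lambda>z. 0) \<in> model_space \<theta>"
  by (simp add: model_space_def hardy2_inner_def)

lemma model_space_add:
  assumes "inner_function \<theta>" "f \<in> model_space \<theta>" "g \<in> model_space \<theta>"
  shows "(\<lambda>z. f z + g z) \<in> model_space \<theta>"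
  using assms by (auto simp: model_space_def hardy2_add hardy2_inner_add_left inner_multiplier)

lemma model_space_cmult:
  assumes "inner_function \<theta>" "f \<in> model_space \<theta>"
  shows "(\<lambda>z. c * f z) \<in> model_space \<theta>"
  using assms by (auto simp: model_space_def hardy2_cmult hardy2_inner_cmult_left inner_multiplier)

lemma model_space_diff:
  assumes "inner_function \<theta>" "f \<in> model_space \<theta>" "g \<in> model_space \<theta>"
  shows "(\<lambda>z. f z - g z) \<in> model_space \<theta>"
  using assms by (auto simp: model_space_def hardy2_diff hardy2_inner_diff_left inner_multiplier)

text \<open>The defining orthogonality relations are continuous by the Cauchy--Schwarz inequality.\<close>

lemma model_space_closed:
  assumes \<theta>: "inner_function \<theta>" and f: "\<And>n. f n \<in> model_space \<theta>"
    and g: "g \<in> hardy2" and lim: "(\<lambda>n. hardy2_norm (\<lambda>z. f n z - g z)) \<longlonglongrightarrow> 0"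
  shows "g \<in> model_space \<theta>"
proof -
  note fh = model_spaceD(1)[OF f]
  have "hardy2_inner g (\<lambda>z. \<theta> z * h z) = 0" if h: "h \<in> hardy2" for h
  proof -
    note m = inner_multiplier(1)[OF \<theta> h]
    have "norm (hardy2_inner g (\<lambda>z. \<theta> z * h z)) \<le> hardy2_norm (\<lambda>z. f n z - g z) * hardy2_norm (\<lambda>z. \<theta> z * h z)" for n
      using hardy2_cauchy_schwarz[OF hardy2_diff[OF fh g] m, of n]
      by (simp add: hardy2_inner_diff_left fh g m model_spaceD(2)[OF f h])
    moreover have "(\<lambda>n. hardy2_norm (\<lambda>z. f n z - g z) * hardy2_norm (\<lambda>z. \<theta> z * h z)) \<longlonglongrightarrow> 0"
      using tendsto_mult_left_zero[OF lim] .
    ultimately have "norm (hardy2_inner g (\<lambda>z. \<theta> z * h z)) \<le> 0"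
      by (intro tendsto_lowerbound[OF _ always_eventually]) auto
    thus ?thesis by simp
  qed
  thus ?thesis using g by (simp add: model_space_def)
qed

lemma model_space_complete:
  assumes \<theta>: "inner_function \<theta>" and f: "\<And>n. f n \<in> model_space \<theta>"
    and cauchy: "\<And>e. e > 0 \<Longrightarrow> \<exists>N. \<forall>m\<ge>N. \<forall>n\<ge>N. hardy2_norm (\<lambda>z. f m z - f n z) < e"
  obtains g where "g \<in> model_space \<theta>" "(\<lambda>n. hardy2_norm (\<lambda>z. f n z - g z)) \<longlonglongrightarrow> 0"
proof (rule hardy2_complete[OF model_spaceD(1)[OF f] cauchy])
  fix g assume "g \<in> hardy2" "(\<lambda>n. hardy2_norm (\<lambda>z. f n z - g z)) \<longlonglongrightarrow> 0"
  thus ?thesis using model_space_closed[of \<theta> f g, OF \<theta> f] that by blast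
qed

text \<open>The kernel is the Szego kernel \<open>s\<close> at \<open>w\<close> minus \<open>cnj (\<theta> w)\<close> times \<open>\<theta> s\<close>. Elements of the model
  space are orthogonal to the second term. That the difference lies in the model space follows from
  the isometry property of \<open>\<theta>\<close>: against \<open>\<theta> g\<close> both terms give \<open>cnj (\<theta> w * g w)\<close>.\<close>

lemma model_kernel:
  assumes \<theta>: "inner_function \<theta>" and w: "norm w < 1"
  shows "model_kernel \<theta> w \<in> model_space \<theta>"
    and "f \<in> model_space \<theta> \<Longrightarrow> hardy2_inner f (model_kernel \<theta> w) = f w"
proof -
  let ?s = "szego_kernel w"
  note s = szego_kernel(1)[OF w]
  note m = inner_multiplier(1)[OF \<theta>]
  have eq: "model_kernel \<theta> w = (\<lambda>z. ?s z - cnj (\<theta> w) * (\<theta> z * ?s z))"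
    by (auto simp: model_kernel_def szego_kernel_def fun_eq_iff diff_divide_distrib)
  have k: "model_kernel \<theta> w \<in> hardy2" unfolding eq by (intro hardy2_diff hardy2_cmult m s)
  have "hardy2_inner (model_kernel \<theta> w) (\<lambda>z. \<theta> z * g z) = 0" if g: "g \<in> hardy2" for g
  proof -
    have "hardy2_inner ?s (\<lambda>z. \<theta> z * g z) = cnj (\<theta> w * g w)"
      using hardy2_inner_commute[OF m[OF g] s] szego_reproducing[OF m[OF g] w] by simp
    moreover have "hardy2_inner (\<lambda>z. \<theta> z * ?s z) (\<lambda>z. \<theta> z * g z) = cnj (g w)"
      using inner_function_isometry[OF \<theta> s g] hardy2_inner_commute[OF g s] szego_reproducing[OF g w] by simp
    ultimately show ?thesis
      unfolding eq by (simp add: hardy2_inner_diff_left hardy2_inner_cmult_left hardy2_cmult m s g)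
  qed
  thus "model_kernel \<theta> w \<in> model_space \<theta>" using k by (simp add: model_space_def)
  show "hardy2_inner f (model_kernel \<theta> w) = f w" if f: "f \<in> model_space \<theta>"
    unfolding eq using model_spaceD[OF f]
    by (simp add: hardy2_inner_diff_right hardy2_inner_cmult_right hardy2_cmult m s szego_reproducing w)
qed

lemma model_kernel_norm_sq:
  assumes \<theta>: "inner_function \<theta>" and w: "norm w < 1"
  shows "(hardy2_norm (model_kernel \<theta> w))\<^sup>2 = (1 - (norm (\<theta> w))\<^sup>2) / (1 - (norm w)\<^sup>2)"
proof -
  have "complex_of_real ((hardy2_norm (model_kernel \<theta> w))\<^sup>2) = model_kernel \<theta> w w"
    using hardy2_inner_self[OF model_spaceD(1)[OF model_kernel(1)[OF \<theta> w]]]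
      model_kernel(2)[OF \<theta> w model_kernel(1)[OF \<theta> w]] by simp
  also have "\<dots> = of_real ((1 - (norm (\<theta> w))\<^sup>2) / (1 - (norm w)\<^sup>2))"
    using complex_norm_square[of w] complex_norm_square[of "\<theta> w"]
    by (simp add: model_kernel_def mult.commute)
  finally show ?thesis by (simp only: of_real_eq_iff)
qed

lemma model_space_norm_pos:
  assumes "f \<in> model_space \<theta>"
  shows "hardy2_norm f > 0 \<longleftrightarrow> (\<exists>z\<in>ball 0 1. f z \<noteq> 0)"
proof
  note f = model_spaceD(1)[OF assms]
  assume "hardy2_norm f > 0"
  show "\<exists>z\<in>ball 0 1. f z \<noteq> 0"
  proof (rule ccontr)
    assume "\<not> (\<exists>z\<in>ball 0 1. f z \<noteq> 0)"
    hence "hardy2_norm f = hardy2_norm (\<lambda>z. 0)" by (intro hardy2_norm_cong) auto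
    with \<open>hardy2_norm f > 0\<close> show False by simp
  qed
next
  note f = model_spaceD(1)[OF assms]
  assume "\<exists>z\<in>ball 0 1. f z \<noteq> 0"
  hence "hardy2_norm f \<noteq> 0" using hardy2_norm_eq_0[OF f] by auto
  with f show "hardy2_norm f > 0" by (simp add: less_le)
qed

section \<open>Complete systems of kernels\<close>

text \<open>Adding one multiple of a generator at a time is enough to reach every element of the span.\<close>

lemma complex_span_induct:
  assumes "g \<in> complex_span S" "P (\<lambda>z. 0)"
    and step: "\<And>c f g. f \<in> S \<Longrightarrow> P g \<Longrightarrow> P (\<lambda>z. c * f z + g z)"
  shows "P g"
proof -
  obtain T c where T: "finite T" "T \<subseteq> S" "g = (\<lambda>z. \<Sum>f\<in>T. c f * f z)"
    using assms(1) by (auto simp: complex_span_def)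
  from T(1,2) have "P (\<lambda>z. \<Sum>f\<in>T. c f * f z)"
    by (induction rule: finite_induct) (use assms(2) step in auto)
  thus ?thesis using T(3) by simp
qed

lemma complex_span_zero: "(\<lambda>z. 0) \<in> complex_span S"
  unfolding complex_span_def by (intro CollectI exI[of _ "{}"]) auto

lemma complex_span_step:
  assumes "f \<in> S" "g \<in> complex_span S"
  shows "(\<lambda>z. g z + c * f z) \<in> complex_span S"
proof -
  obtain T d where T: "finite T" "T \<subseteq> S" "g = (\<lambda>z. \<Sum>h\<in>T. d h * h z)"
    using assms(2) by (auto simp: complex_span_def)
  let ?d = "\<lambda>h. (if h \<in> T then d h else 0) + (if h = f then c else 0)"
  have "(\<Sum>h\<in>insert f T. ?d h * h z) = g z + c * f z" for z
  proof -
    have "(\<Sum>h\<in>insert f T. ?d h * h z) = (\<Sum>h\<in>insert f T. (if h \<in> T then d h else 0) * h z) +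
        (\<Sum>h\<in>insert f T. (if h = f then c else 0) * h z)"
      by (simp only: distrib_right sum.distrib)
    also have "(\<Sum>h\<in>insert f T. (if h = f then c else 0) * h z) = (\<Sum>h\<in>{f}. c * h z)"
      using T(1) by (intro sum.mono_neutral_cong_right) auto
    also have "(\<Sum>h\<in>insert f T. (if h \<in> T then d h else 0) * h z) = (\<Sum>h\<in>T. d h * h z)"
      using T(1) by (intro sum.mono_neutral_cong_right) auto
    finally show ?thesis using T(3) by simp
  qed
  thus ?thesis
    unfolding complex_span_def using T assms(1)
    by (intro CollectI exI[of _ "insert f T"] exI[of _ ?d]) auto
qed

lemma complex_span_model_space:
  assumes "inner_function \<theta>" "S \<subseteq> model_space \<theta>" "g \<in> complex_span S"
  shows "g \<in> model_space \<theta>"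
  using assms(3)
  by (rule complex_span_induct) (use assms(1,2) in \<open>auto intro!: model_space_add model_space_cmult\<close>)

text \<open>The projection theorem. If some \<open>f\<close> had positive distance \<open>d\<close> from the span, a minimizing sequence
  of differences \<open>f - g\<close> would be Cauchy by the parallelogram law, and its limit \<open>h\<close>, being
  of minimal norm modulo the span, would be orthogonal to all the kernels. Then \<open>h\<close> vanishes
  on \<open>W\<close> by the reproducing property, so \<open>h\<close> is zero by the uniqueness hypothesis, although it has norm \<open>d\<close>.\<close>

lemma kernels_complete:
  assumes \<theta>: "inner_function \<theta>" and W: "W \<subseteq> ball 0 1"
    and uniq: "\<And>f z. f \<in> model_space \<theta> \<Longrightarrow> \<forall>w\<in>W. f w = 0 \<Longrightarrow> norm z < 1 \<Longrightarrow> f z = 0"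
  shows "complete_in (model_space \<theta>) (model_kernel \<theta> ` W)"
proof (rule ccontr)
  let ?S = "model_kernel \<theta> ` W"
  have SK: "?S \<subseteq> model_space \<theta>" using W model_kernel(1)[OF \<theta>] by auto
  assume "\<not> complete_in (model_space \<theta>) ?S"
  then obtain f \<epsilon> where f: "f \<in> model_space \<theta>" and e: "\<epsilon> > 0"
    and far: "\<And>g. g \<in> complex_span ?S \<Longrightarrow> hardy2_norm (\<lambda>z. f z - g z) \<ge> \<epsilon>"
    using SK by (auto simp: complete_in_def not_less)
  define D where "D = (\<lambda>g. hardy2_norm (\<lambda>z. f z - g z)) ` complex_span ?S"
  define d where "d = Inf D"
  have Dne: "D \<noteq> {}" using complex_span_zero by (auto simp: D_def)
  have bdd: "bdd_below D" using far by (intro bdd_belowI[of _ \<epsilon>]) (auto simp: D_def)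
  have d_pos: "d > 0"
    using e cInf_greatest[OF Dne, of \<epsilon>] far by (force simp: D_def d_def)
  have d_le: "d \<le> hardy2_norm (\<lambda>z. f z - g z)" if "g \<in> complex_span ?S" for g
    unfolding d_def by (rule cInf_lower[OF _ bdd]) (use that in \<open>auto simp: D_def\<close>)
  have "\<exists>g\<in>complex_span ?S. hardy2_norm (\<lambda>z. f z - g z) < d + inverse (real (Suc n))" for n
    using cInf_lessD[OF Dne, of "d + inverse (real (Suc n))"] by (auto simp: D_def d_def)
  then obtain g where g: "\<And>n. g n \<in> complex_span ?S"
    and near: "\<And>n. hardy2_norm (\<lambda>z. f z - g n z) < d + inverse (real (Suc n))" by metis
  define u where "u n z = f z - g n z" for n z
  have uK: "u n \<in> model_space \<theta>" for n
    unfolding u_def by (intro model_space_diff \<theta> f complex_span_model_space[OF \<theta> SK] g)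
  note uh = model_spaceD(1)[OF uK]
  have mid: "d \<le> hardy2_norm (\<lambda>z. (u m z + u n z) / 2)" for m n
  proof -
    have "(\<lambda>z. (g m z + g n z) / 2) \<in> complex_span ?S"
    proof -
      have "(\<lambda>z. h z + b * h' z) \<in> complex_span ?S" if "h' \<in> complex_span ?S" "h \<in> complex_span ?S" for b h h'
        using that(1)
      proof (rule complex_span_induct)
        show "(\<lambda>z. h z + b * 0) \<in> complex_span ?S" using that by simp
        fix c k h'' assume "k \<in> ?S" "(\<lambda>z. h z + b * h'' z) \<in> complex_span ?S"
        from complex_span_step[OF this, of "b * c"] show "(\<lambda>z. h z + b * (c * k z + h'' z)) \<in> complex_span ?S"
          by (simp add: algebra_simps)
      qed
      from this[OF g this[OF g complex_span_zero, of "1/2" m], of "1/2" n] show ?thesis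
        by (simp add: add_divide_distrib)
    qed
    from d_le[OF this] show ?thesis by (simp add: u_def field_simps)
  qed
  have par: "(hardy2_norm (\<lambda>z. u m z - u n z))\<^sup>2 \<le> 2 * (hardy2_norm (u m))\<^sup>2 + 2 * (hardy2_norm (u n))\<^sup>2 - 4 * d\<^sup>2" for m n
  proof -
    have "hardy2_norm (\<lambda>z. u m z + u n z) = 2 * hardy2_norm (\<lambda>z. (u m z + u n z) / 2)"
      using hardy2_norm_cmult[OF hardy2_add[OF uh[of m] uh[of n]], of "1/2"] by simp
    hence "hardy2_norm (\<lambda>z. u m z + u n z) \<ge> 2 * d" using mid[of m n] by simp
    hence "(hardy2_norm (\<lambda>z. u m z + u n z))\<^sup>2 \<ge> (2 * d)\<^sup>2" using d_pos by (intro power_mono) auto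
    moreover have "(hardy2_norm (\<lambda>z. u m z - u n z))\<^sup>2 =
        (hardy2_norm (u m))\<^sup>2 + (hardy2_norm (u n))\<^sup>2 - 2 * Re (hardy2_inner (u m) (u n))"
      using hardy2_norm_add_sq[OF uh[of m] hardy2_cmult[OF uh[of n], of "-1"]]
        hardy2_inner_cmult_right[OF uh[of n] uh[of m], of "-1"] hardy2_norm_cmult[OF uh[of n], of "-1"] by simp
    ultimately show ?thesis using hardy2_norm_add_sq[OF uh[of m] uh[of n]] by (simp add: power_mult_distrib)
  qed
  have unorm: "(hardy2_norm (u n))\<^sup>2 < (d + inverse (real (Suc n)))\<^sup>2" for n
    using near[of n] uh[of n] by (intro power_strict_mono) (auto simp: u_def[abs_def])
  have sq_lim: "(\<lambda>n. (d + inverse (real (Suc n)))\<^sup>2) \<longlonglongrightarrow> (d + 0)\<^sup>2"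
    by (intro tendsto_intros LIMSEQ_inverse_real_of_nat)
  have "\<exists>N. \<forall>m\<ge>N. \<forall>n\<ge>N. hardy2_norm (\<lambda>z. u m z - u n z) < e" if "e > 0" for e
  proof -
    have "\<forall>\<^sub>F n in sequentially. (d + inverse (real (Suc n)))\<^sup>2 < d\<^sup>2 + e\<^sup>2 / 4"
      using order_tendstoD(2)[OF sq_lim, of "d\<^sup>2 + e\<^sup>2 / 4"] that by simp
    then obtain N where N: "\<And>n. n \<ge> N \<Longrightarrow> (d + inverse (real (Suc n)))\<^sup>2 < d\<^sup>2 + e\<^sup>2 / 4"
      by (auto simp: eventually_sequentially)
    have "hardy2_norm (\<lambda>z. u m z - u n z) < e" if "m \<ge> N" "n \<ge> N" for m n
    proof (rule power_less_imp_less_base)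
      show "(hardy2_norm (\<lambda>z. u m z - u n z))\<^sup>2 < e\<^sup>2"
        using par[of m n] unorm[of m] unorm[of n] N[OF that(1)] N[OF that(2)] by simp
    qed (use \<open>e > 0\<close> in simp)
    thus ?thesis by blast
  qed
  from model_space_complete[OF \<theta> uK this]
  obtain h where h: "h \<in> model_space \<theta>" and lim: "(\<lambda>n. hardy2_norm (\<lambda>z. u n z - h z)) \<longlonglongrightarrow> 0" .
  note hh = model_spaceD(1)[OF h]
  have h_le: "hardy2_norm h \<le> d"
  proof (rule LIMSEQ_le_const)
    show "(\<lambda>n. (d + inverse (real (Suc n))) + hardy2_norm (\<lambda>z. u n z - h z)) \<longlonglongrightarrow> d"
      using tendsto_add[OF tendsto_add[OF tendsto_const LIMSEQ_inverse_real_of_nat] lim, of d] by simp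
    have "hardy2_norm h \<le> (d + inverse (real (Suc n))) + hardy2_norm (\<lambda>z. u n z - h z)" for n
      using hardy2_norm_triangle[OF uh[of n] hardy2_diff[OF hh uh[of n]]] near[of n]
        hardy2_norm_minus_commute[OF hh uh[of n]]
      by (simp add: u_def[abs_def])
    thus "\<exists>N. \<forall>n\<ge>N. hardy2_norm h \<le> (d + inverse (real (Suc n))) + hardy2_norm (\<lambda>z. u n z - h z)" by blast
  qed
  have h_ge: "d \<le> hardy2_norm (\<lambda>z. h z - c * k z)" if k: "k \<in> ?S" for c k
  proof (rule LIMSEQ_le_const)
    have kh: "k \<in> hardy2" using k SK model_spaceD(1) by blast
    note hk = hardy2_diff[OF hh hardy2_cmult[OF kh, of c]]
    show "(\<lambda>n. hardy2_norm (\<lambda>z. u n z - h z) + hardy2_norm (\<lambda>z. h z - c * k z)) \<longlonglongrightarrow> hardy2_norm (\<lambda>z. h z - c * k z)"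
      using tendsto_add[OF lim tendsto_const] by simp
    have "d \<le> hardy2_norm (\<lambda>z. u n z - h z) + hardy2_norm (\<lambda>z. h z - c * k z)" for n
      using d_le[OF complex_span_step[OF k g[of n], of c]] hardy2_norm_triangle[OF hardy2_diff[OF uh[of n] hh] hk]
      by (simp add: u_def algebra_simps)
    thus "\<exists>N. \<forall>n\<ge>N. d \<le> hardy2_norm (\<lambda>z. u n z - h z) + hardy2_norm (\<lambda>z. h z - c * k z)" by blast
  qed
  have "h w = 0" if w: "w \<in> W" for w
  proof (rule ccontr)
    assume nz: "h w \<noteq> 0"
    let ?k = "model_kernel \<theta> w"
    have w1: "norm w < 1" using w W by auto
    have kS: "?k \<in> ?S" using w by auto
    have kh: "?k \<in> hardy2" using kS SK model_spaceD(1) by blast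
    \<comment> \<open>Any positive \<open>t\<close> below \<open>2 / (hardy2_norm ?k)\<^sup>2\<close> makes the perturbed norm smaller than \<open>d\<close>; the summand 1 keeps the denominator positive.\<close>
    define t where "t = 1 / (1 + (hardy2_norm ?k)\<^sup>2)"
    have t: "t > 0" "t * (hardy2_norm ?k)\<^sup>2 < 1"
      by (auto simp: t_def field_simps add_pos_nonneg)
    define c where "c = - (of_real t * h w)"
    have "(hardy2_norm (\<lambda>z. h z + c * ?k z))\<^sup>2 =
        (hardy2_norm h)\<^sup>2 + (norm c)\<^sup>2 * (hardy2_norm ?k)\<^sup>2 + 2 * Re (cnj c * h w)"
      using hardy2_norm_add_sq[OF hh hardy2_cmult[OF kh], of c] hardy2_norm_cmult[OF kh, of c]
        hardy2_inner_cmult_right[OF kh hh, of c] model_kernel(2)[OF \<theta> w1 h]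
      by (simp add: power_mult_distrib)
    also have "cnj c * h w = - of_real (t * (norm (h w))\<^sup>2)"
      unfolding c_def of_real_mult complex_norm_square by simp
    also have "(norm c)\<^sup>2 = t\<^sup>2 * (norm (h w))\<^sup>2"
      by (simp add: c_def norm_mult power_mult_distrib)
    finally have eq: "(hardy2_norm (\<lambda>z. h z + c * ?k z))\<^sup>2 =
      (hardy2_norm h)\<^sup>2 + t * (norm (h w))\<^sup>2 * (t * (hardy2_norm ?k)\<^sup>2 - 2)"
      by (simp add: power2_eq_square algebra_simps)
    have "t * (norm (h w))\<^sup>2 * (t * (hardy2_norm ?k)\<^sup>2 - 2) < 0"
      using t nz by (intro mult_pos_neg) auto
    moreover have "d\<^sup>2 \<le> (hardy2_norm (\<lambda>z. h z + c * ?k z))\<^sup>2"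
      using h_ge[OF kS, of "-c"] d_pos by (intro power_mono) auto
    moreover have "(hardy2_norm h)\<^sup>2 \<le> d\<^sup>2" using h_le hh by (intro power_mono) auto
    ultimately show False using eq by linarith
  qed
  hence h0: "h z = 0" if "norm z < 1" for z using uniq[OF h] that by blast
  have "W \<noteq> {}"
  proof
    assume "W = {}"
    hence "f z = 0" if "norm z < 1" for z using uniq[OF f] that by blast
    hence "hardy2_norm (\<lambda>z. f z - 0) = hardy2_norm (\<lambda>z. 0)" by (intro hardy2_norm_cong) auto
    with d_le[OF complex_span_zero] d_pos show False by simp
  qed
  then obtain w where "w \<in> W" by blast
  hence "d \<le> hardy2_norm h" using h_ge[of "model_kernel \<theta> w" 0] by simp
  moreover have "hardy2_norm h = hardy2_norm (\<lambda>z. 0)" by (intro hardy2_norm_cong h0)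
  ultimately show False using d_pos by simp
qed

text \<open>A function vanishing on \<open>W\<close> is orthogonal to the span of the kernels, so its distance from every
  element of the span is at least its own norm.\<close>

lemma complete_kernels_unique:
  assumes \<theta>: "inner_function \<theta>" and W: "W \<subseteq> ball 0 1"
    and c: "complete_in (model_space \<theta>) (model_kernel \<theta> ` W)"
    and f: "f \<in> model_space \<theta>" "\<forall>w\<in>W. f w = 0"
  shows "hardy2_norm f = 0"
proof (rule ccontr)
  note fh = model_spaceD(1)[OF f(1)]
  assume "hardy2_norm f \<noteq> 0"
  hence pos: "hardy2_norm f > 0" using fh by (simp add: less_le)
  with c f(1) obtain g where g: "g \<in> complex_span (model_kernel \<theta> ` W)"
    and near: "hardy2_norm (\<lambda>z. f z - g z) < hardy2_norm f"
    unfolding complete_in_def by blast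
  have SK: "model_kernel \<theta> ` W \<subseteq> model_space \<theta>" using W model_kernel(1)[OF \<theta>] by auto
  have "g \<in> model_space \<theta> \<and> hardy2_inner f g = 0"
    using g
  proof (rule complex_span_induct)
    fix a k g assume k: "k \<in> model_kernel \<theta> ` W" and g: "g \<in> model_space \<theta> \<and> hardy2_inner f g = 0"
    then obtain w where w: "w \<in> W" "k = model_kernel \<theta> w" by blast
    hence w1: "norm w < 1" using W by auto
    have kK: "k \<in> model_space \<theta>" using k SK by blast
    have "(\<lambda>z. a * k z + g z) \<in> model_space \<theta>"
      using g kK by (intro model_space_add model_space_cmult \<theta>) auto
    moreover have "hardy2_inner f (\<lambda>z. a * k z + g z) = 0"
      using g fh model_spaceD(1)[OF kK] model_spaceD(1)[of g \<theta>] model_kernel(2)[OF \<theta> w1 f(1)] f(2) w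
      by (simp add: hardy2_inner_add_right hardy2_cmult hardy2_inner_cmult_right)
    ultimately show "(\<lambda>z. a * k z + g z) \<in> model_space \<theta> \<and> hardy2_inner f (\<lambda>z. a * k z + g z) = 0" ..
  qed (simp add: hardy2_inner_def)
  hence gh: "g \<in> hardy2" and fg: "hardy2_inner f g = 0" using model_spaceD(1) by auto
  have "hardy2_inner f (\<lambda>z. f z - g z) = of_real ((hardy2_norm f)\<^sup>2)"
    by (simp add: hardy2_inner_diff_right fh gh fg hardy2_inner_self)
  hence "(hardy2_norm f)\<^sup>2 \<le> hardy2_norm f * hardy2_norm (\<lambda>z. f z - g z)"
    using hardy2_cauchy_schwarz[OF fh hardy2_diff[OF fh gh]] by (simp flip: of_real_power)
  with near pos show False by (simp add: power2_eq_square)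
qed

section \<open>Series in the model space\<close>

lemma hardy2_tendsto_pointwise:
  assumes f: "\<And>n. f n \<in> hardy2" and g: "g \<in> hardy2"
    and lim: "(\<lambda>n. hardy2_norm (\<lambda>z. f n z - g z)) \<longlonglongrightarrow> 0" and z: "norm z < 1"
  shows "(\<lambda>n. f n z) \<longlonglongrightarrow> g z"
proof -
  obtain C where C: "\<And>h. h \<in> hardy2 \<Longrightarrow> norm (h z) \<le> C * hardy2_norm h"
    using hardy2_eval_bound[OF z] by blast
  have "(\<lambda>n. C * hardy2_norm (\<lambda>z. f n z - g z)) \<longlonglongrightarrow> 0"
    using tendsto_mult[OF tendsto_const[of C] lim] by simp
  hence "(\<lambda>n. f n z - g z) \<longlonglongrightarrow> 0"
    by (rule Lim_null_comparison[OF always_eventually, rotated]) (use C[OF hardy2_diff[OF f g]] in blast)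
  thus ?thesis by (simp add: LIM_zero_iff)
qed

lemma model_space_sum:
  assumes "inner_function \<theta>" "finite A" "\<And>k. k \<in> A \<Longrightarrow> v k \<in> model_space \<theta>"
  shows "(\<lambda>z. \<Sum>k\<in>A. v k z) \<in> model_space \<theta> \<and> hardy2_norm (\<lambda>z. \<Sum>k\<in>A. v k z) \<le> (\<Sum>k\<in>A. hardy2_norm (v k))"
  using assms(2,3)
proof (induction rule: finite_induct)
  case (insert k A)
  have v: "v k \<in> model_space \<theta>" and s: "(\<lambda>z. \<Sum>k\<in>A. v k z) \<in> model_space \<theta>" using insert by auto
  show ?case
    using insert model_space_add[OF assms(1) v s] hardy2_norm_triangle[OF model_spaceD(1)[OF v] model_spaceD(1)[OF s]]
    by auto
qed simp

text \<open>Absolutely convergent series converge in a complete space. Both constructions by successive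
  approximation, the difference quotients and the functions with prescribed zeros, are sums of this kind.\<close>

lemma model_space_series:
  assumes \<theta>: "inner_function \<theta>" and v: "\<And>k. v k \<in> model_space \<theta>"
    and s: "summable (\<lambda>k. hardy2_norm (v k))"
  obtains q where "q \<in> model_space \<theta>" "hardy2_norm q \<le> (\<Sum>k. hardy2_norm (v k))"
    "\<And>z. norm z < 1 \<Longrightarrow> (\<lambda>k. v k z) sums q z"
proof -
  define q where "q N z = (\<Sum>k<N. v k z)" for N z
  have q: "q N \<in> model_space \<theta>" "hardy2_norm (q N) \<le> (\<Sum>k<N. hardy2_norm (v k))" for N
    using model_space_sum[OF \<theta> finite_lessThan, of N v] v by (auto simp: q_def[abs_def])
  note qh = model_spaceD(1)[OF q(1)]
  have nn: "hardy2_norm (v k) \<ge> 0" for k using model_spaceD(1)[OF v] by simp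
  have diff: "hardy2_norm (\<lambda>z. q m z - q n z) \<le> norm (\<Sum>k=n..<m. hardy2_norm (v k))" if "n \<le> m" for m n
  proof -
    have "q m z - q n z = (\<Sum>k=n..<m. v k z)" for z
      using sum.atLeastLessThan_concat[of 0 n m "\<lambda>k. v k z"] that
      unfolding q_def lessThan_atLeast0 by (metis add_diff_cancel_left' le0)
    thus ?thesis
      using model_space_sum[OF \<theta>, of "{n..<m}" v] v nn by (simp add: sum_nonneg)
  qed
  have "\<exists>N. \<forall>m\<ge>N. \<forall>n\<ge>N. hardy2_norm (\<lambda>z. q m z - q n z) < e" if e: "e > 0" for e
  proof -
    obtain N where N: "\<And>m n. m \<ge> N \<Longrightarrow> norm (\<Sum>k=m..<n. hardy2_norm (v k)) < e"
      using s e unfolding summable_Cauchy by blast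
    have "hardy2_norm (\<lambda>z. q m z - q n z) < e" if "m \<ge> N" "n \<ge> N" for m n
    proof (cases "n \<le> m")
      case True
      thus ?thesis using diff[OF True] N[OF that(2), of m] by simp
    next
      case False
      thus ?thesis using diff[of m n] N[OF that(1), of n] hardy2_norm_minus_commute[OF qh qh, of m n] by simp
    qed
    thus ?thesis by blast
  qed
  from model_space_complete[OF \<theta> q(1) this] obtain g
    where g: "g \<in> model_space \<theta>" "(\<lambda>n. hardy2_norm (\<lambda>z. q n z - g z)) \<longlonglongrightarrow> 0" .
  note gh = model_spaceD(1)[OF g(1)]
  show ?thesis
  proof (rule that[OF g(1)])
    show "hardy2_norm g \<le> (\<Sum>k. hardy2_norm (v k))"
    proof (rule LIMSEQ_le_const)
      show "(\<lambda>n. (\<Sum>k. hardy2_norm (v k)) + hardy2_norm (\<lambda>z. q n z - g z)) \<longlonglongrightarrow> (\<Sum>k. hardy2_norm (v k))"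
        using tendsto_add[OF tendsto_const g(2)] by simp
      have "hardy2_norm g \<le> (\<Sum>k. hardy2_norm (v k)) + hardy2_norm (\<lambda>z. q n z - g z)" for n
        using hardy2_norm_triangle[OF qh[of n] hardy2_diff[OF gh qh[of n]]] q(2)[of n]
          hardy2_norm_minus_commute[OF gh qh[of n]] sum_le_suminf[OF s, of "{..<n}"] nn by simp
      thus "\<exists>N. \<forall>n\<ge>N. hardy2_norm g \<le> (\<Sum>k. hardy2_norm (v k)) + hardy2_norm (\<lambda>z. q n z - g z)" by blast
    qed
    show "(\<lambda>k. v k z) sums g z" if "norm z < 1" for z
      using hardy2_tendsto_pointwise[OF qh gh g(2) that] by (simp add: sums_def q_def)
  qed
qed

section \<open>The backward shift and moving zeros\<close>

definition backward_shift :: "(complex \<Rightarrow> complex) \<Rightarrow> complex \<Rightarrow> complex" where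
  "backward_shift f z = (\<Sum>n. taylor_coeff f (Suc n) * z ^ n)"

lemma backward_shift:
  assumes "f \<in> hardy2"
  shows "backward_shift f \<in> hardy2" "taylor_coeff (backward_shift f) n = taylor_coeff f (Suc n)"
proof -
  have s: "summable (\<lambda>n. (norm (taylor_coeff f (Suc n)))\<^sup>2)"
    using hardy2_summable[OF assms] by (subst summable_Suc_iff)
  show "backward_shift f \<in> hardy2" "taylor_coeff (backward_shift f) n = taylor_coeff f (Suc n)"
    using hardy2_of_coeffs[OF s, of "backward_shift f"] by (auto simp: backward_shift_def)
qed

lemma backward_shift_eq:
  assumes f: "f \<in> hardy2" and z: "norm z < 1"
  shows "z * backward_shift f z = f z - taylor_coeff f 0"
proof -
  have "(\<lambda>n. z * (taylor_coeff f (Suc n) * z ^ n)) sums (z * backward_shift f z)"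
    using sums_mult[OF taylor_sums[OF hardy2_hol[OF backward_shift(1)[OF f]] z], of z]
    by (simp add: backward_shift f)
  hence "(\<lambda>n. taylor_coeff f (Suc n) * z ^ Suc n) sums (z * backward_shift f z)"
    by (simp add: mult.left_commute)
  hence "(\<lambda>n. taylor_coeff f n * z ^ n) sums (z * backward_shift f z + taylor_coeff f 0)"
    by (subst (asm) sums_Suc_iff) simp
  with taylor_sums[OF hardy2_hol[OF f] z] show ?thesis
    using sums_unique2 by (metis add_diff_cancel_right')
qed

lemma taylor_coeff_times_z:
  assumes h: "h \<in> hardy2"
  shows "(\<lambda>z. z * h z) \<in> hardy2" "taylor_coeff (\<lambda>z. z * h z) n = (case n of 0 \<Rightarrow> 0 | Suc m \<Rightarrow> taylor_coeff h m)"
proof -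
  let ?a = "\<lambda>n. case n of 0 \<Rightarrow> 0 | Suc m \<Rightarrow> taylor_coeff h m"
  have s: "summable (\<lambda>n. (norm (?a n))\<^sup>2)"
    using hardy2_summable[OF h] by (subst summable_Suc_iff[symmetric]) simp
  have e: "z * h z = (\<Sum>n. ?a n * z ^ n)" if "norm z < 1" for z
  proof -
    have "(\<lambda>n. ?a (Suc n) * z ^ Suc n) sums (z * h z)"
      using sums_mult[OF taylor_sums[OF hardy2_hol[OF h] that], of z] by (simp add: mult.left_commute)
    hence "(\<lambda>n. ?a n * z ^ n) sums (z * h z + ?a 0 * z ^ 0)" by (subst (asm) sums_Suc_iff)
    thus ?thesis by (simp add: sums_iff)
  qed
  show "(\<lambda>z. z * h z) \<in> hardy2" "taylor_coeff (\<lambda>z. z * h z) n = ?a n"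
    using hardy2_of_coeffs[OF s e] by auto
qed

text \<open>The backward shift is the adjoint of multiplication by \<open>z\<close>. This is why it preserves the model
  space: multiplication by \<open>z\<close> commutes with multiplication by \<open>\<theta>\<close>.\<close>

lemma backward_shift_adjoint:
  assumes f: "f \<in> hardy2" and h: "h \<in> hardy2"
  shows "hardy2_inner (backward_shift f) h = hardy2_inner f (\<lambda>z. z * h z)"
  using suminf_split_head[OF hardy2_summable_inner[OF f taylor_coeff_times_z(1)[OF h]]]
  by (simp add: hardy2_inner_def backward_shift f taylor_coeff_times_z h)

lemma model_space_backward_shift:
  assumes \<theta>: "inner_function \<theta>" and f: "f \<in> model_space \<theta>"
  shows "backward_shift f \<in> model_space \<theta>"
proof -
  note fh = model_spaceD(1)[OF f]
  have "hardy2_inner (backward_shift f) (\<lambda>z. \<theta> z * g z) = 0" if g: "g \<in> hardy2" for g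
    using backward_shift_adjoint[OF fh inner_multiplier(1)[OF \<theta> g]]
      model_spaceD(2)[OF f taylor_coeff_times_z(1)[OF g]] by (simp add: mult.left_commute)
  thus ?thesis using backward_shift(1)[OF fh] by (simp add: model_space_def)
qed

lemma backward_shift_funpow:
  assumes "f \<in> hardy2"
  shows "(backward_shift ^^ k) f \<in> hardy2 \<and> (\<forall>n. taylor_coeff ((backward_shift ^^ k) f) n = taylor_coeff f (n + k))"
  by (induction k) (use assms in \<open>auto simp: backward_shift\<close>)

text \<open>After \<open>k\<close> shifts only the coefficients from index \<open>k\<close> on are left, and for these \<open>f\<close> agrees with
  its remainder of order \<open>N\<close>.\<close>

lemma backward_shift_funpow_norm:
  assumes f: "f \<in> hardy2" and "N \<le> k"
  shows "hardy2_norm ((backward_shift ^^ k) f) \<le> hardy2_norm (\<lambda>z. f z - taylor_poly N f z)"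
proof -
  let ?d = "\<lambda>z. f z - taylor_poly N f z"
  have d: "?d \<in> hardy2" by (intro hardy2_diff f taylor_poly)
  have "(\<Sum>n. (norm (taylor_coeff ((backward_shift ^^ k) f) n))\<^sup>2) = (\<Sum>n. (norm (taylor_coeff ?d (n + k)))\<^sup>2)"
    using backward_shift_funpow[OF f, of k] \<open>N \<le> k\<close>
    by (simp add: taylor_coeff_diff hardy2_hol f taylor_poly)
  also have "\<dots> \<le> (\<Sum>n. (norm (taylor_coeff ?d n))\<^sup>2)"
    using suminf_split_initial_segment[OF hardy2_summable[OF d], of k]
    by (simp add: sum_nonneg)
  finally show ?thesis by (simp add: hardy2_norm_def)
qed

text \<open>Writing \<open>S\<close> for the backward shift, the difference quotient \<open>(f z - f \<mu>) / (z - \<mu>)\<close> is the Neumann series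
  \<open>\<Sum>k. \<mu> ^ k * S (S ^ k f)\<close>, which stays in the model space. Of its terms the first \<open>N\<close> are bounded by the norm
  of \<open>f\<close> alone and the others by the norm of the Taylor remainder. This two-part bound lets the quotient,
  multiplied by \<open>1 - norm \<mu>\<close>, tend to zero as \<open>\<mu>\<close> approaches the circle.\<close>

lemma model_space_difference_quotient:
  assumes \<theta>: "inner_function \<theta>" and f: "f \<in> model_space \<theta>" and \<mu>: "norm \<mu> < 1"
  obtains q where "q \<in> model_space \<theta>" "\<And>z. norm z < 1 \<Longrightarrow> (z - \<mu>) * q z = f z - f \<mu>"
    "\<And>N. hardy2_norm q \<le> real N * hardy2_norm f + hardy2_norm (\<lambda>z. f z - taylor_poly N f z) / (1 - norm \<mu>)"
proof -
  note fh = model_spaceD(1)[OF f]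
  define b where "b k = (backward_shift ^^ k) f" for k
  have bK: "b k \<in> model_space \<theta>" for k
    unfolding b_def by (induction k) (use f model_space_backward_shift[OF \<theta>] in auto)
  note bh = model_spaceD(1)[OF bK]
  have bN: "hardy2_norm (b k) \<le> hardy2_norm (\<lambda>z. f z - taylor_poly N f z)" if "N \<le> k" for N k
    unfolding b_def by (rule backward_shift_funpow_norm[OF fh that])
  have b0: "hardy2_norm (b k) \<le> hardy2_norm f" for k
    using bN[of 0 k] by (simp add: taylor_poly_def)
  define v where "v k z = \<mu> ^ k * b (Suc k) z" for k z
  have vK: "v k \<in> model_space \<theta>" for k unfolding v_def by (intro model_space_cmult \<theta> bK)
  have vnorm: "hardy2_norm (v k) = norm \<mu> ^ k * hardy2_norm (b (Suc k))" for k
    using hardy2_norm_cmult[OF bh] by (simp add: v_def[abs_def] norm_power)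
  have geo: "summable (\<lambda>k. norm \<mu> ^ k)" using \<mu> by (simp add: summable_geometric)
  have s: "summable (\<lambda>k. hardy2_norm (v k))"
  proof (rule summable_comparison_test')
    show "summable (\<lambda>k. norm \<mu> ^ k * hardy2_norm f)" using geo by (rule summable_mult2)
    show "norm (hardy2_norm (v k)) \<le> norm \<mu> ^ k * hardy2_norm f" for k
      using b0[of "Suc k"] bh[of "Suc k"] by (simp add: vnorm abs_mult mult_left_mono)
  qed
  obtain q where q: "q \<in> model_space \<theta>" "hardy2_norm q \<le> (\<Sum>k. hardy2_norm (v k))"
    "\<And>z. norm z < 1 \<Longrightarrow> (\<lambda>k. v k z) sums q z"
    using model_space_series[OF \<theta> vK s] by blast
  show ?thesis
  proof (rule that[OF q(1)])
    fix z :: complex assume z: "norm z < 1"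
    have part: "(z - \<mu>) * (\<Sum>k<N. v k z) = f z - \<mu> ^ N * b N z - (\<Sum>k<N. taylor_coeff f k * \<mu> ^ k)" for N
    proof (induction N)
      case (Suc N)
      have "taylor_coeff (b N) 0 = taylor_coeff f N"
        using backward_shift_funpow[OF fh, of N] by (simp add: b_def)
      hence "z * b (Suc N) z = b N z - taylor_coeff f N"
        using backward_shift_eq[OF bh[of N] z] by (simp add: b_def)
      hence "(z - \<mu>) * v N z = \<mu> ^ N * (b N z - taylor_coeff f N) - \<mu> ^ Suc N * b (Suc N) z"
        unfolding v_def by (metis (no_types, opaque_lifting) left_diff_distrib mult.assoc mult.left_commute power_Suc)
      moreover have "(z - \<mu>) * (\<Sum>k<Suc N. v k z) = (z - \<mu>) * (\<Sum>k<N. v k z) + (z - \<mu>) * v N z"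
        by (simp add: distrib_left)
      ultimately have "(z - \<mu>) * (\<Sum>k<Suc N. v k z) = (f z - \<mu> ^ N * b N z - (\<Sum>k<N. taylor_coeff f k * \<mu> ^ k)) +
          (\<mu> ^ N * (b N z - taylor_coeff f N) - \<mu> ^ Suc N * b (Suc N) z)"
        using Suc by metis
      thus ?case by (simp add: algebra_simps)
    qed (simp add: b_def)
    obtain C where C: "C > 0" "\<And>h. h \<in> hardy2 \<Longrightarrow> norm (h z) \<le> C * hardy2_norm h"
      using hardy2_eval_bound[OF z] by blast
    have "(\<lambda>N. \<mu> ^ N * b N z) \<longlonglongrightarrow> 0"
    proof (rule Lim_null_comparison)
      show "\<forall>\<^sub>F N in sequentially. norm (\<mu> ^ N * b N z) \<le> norm \<mu> ^ N * (C * hardy2_norm f)"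
      proof (intro always_eventually allI)
        fix N
        have "norm (b N z) \<le> C * hardy2_norm f"
          using order_trans[OF C(2)[OF bh[of N]] mult_left_mono[OF b0[of N]]] C(1) by simp
        thus "norm (\<mu> ^ N * b N z) \<le> norm \<mu> ^ N * (C * hardy2_norm f)"
          by (simp add: norm_mult norm_power mult_left_mono)
      qed
      show "(\<lambda>N. norm \<mu> ^ N * (C * hardy2_norm f)) \<longlonglongrightarrow> 0"
        using tendsto_mult[OF LIMSEQ_power_zero[of "norm \<mu>"] tendsto_const] \<mu> by simp
    qed
    moreover have "(\<lambda>N. \<Sum>k<N. taylor_coeff f k * \<mu> ^ k) \<longlonglongrightarrow> f \<mu>"
      using taylor_sums[OF hardy2_hol[OF fh] \<mu>] by (simp add: sums_def)
    ultimately have "(\<lambda>N. (z - \<mu>) * (\<Sum>k<N. v k z)) \<longlonglongrightarrow> f z - 0 - f \<mu>"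
      unfolding part by (intro tendsto_intros)
    moreover have "(\<lambda>N. (z - \<mu>) * (\<Sum>k<N. v k z)) \<longlonglongrightarrow> (z - \<mu>) * q z"
      using q(3)[OF z] by (intro tendsto_intros) (simp add: sums_def)
    ultimately show "(z - \<mu>) * q z = f z - f \<mu>" using LIMSEQ_unique by fastforce
  next
    fix N
    let ?t = "hardy2_norm (\<lambda>z. f z - taylor_poly N f z)"
    let ?c = "\<lambda>k. (if k < N then hardy2_norm f else 0) + norm \<mu> ^ k * ?t"
    have t: "?t \<ge> 0" by (intro hardy2_norm_nonneg hardy2_diff fh taylor_poly)
    have le: "hardy2_norm (v k) \<le> ?c k" for k
    proof (cases "k < N")
      case True
      have "norm \<mu> ^ k * hardy2_norm (b (Suc k)) \<le> 1 * hardy2_norm f"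
        using b0[of "Suc k"] \<mu> bh by (intro mult_mono power_le_one) auto
      moreover have "0 \<le> norm \<mu> ^ k * ?t" using t by simp
      ultimately show ?thesis using True by (simp add: vnorm)
    next
      case False
      thus ?thesis using bN[of N "Suc k"] by (simp add: vnorm mult_left_mono)
    qed
    have fin: "(\<lambda>k. if k < N then hardy2_norm f else 0) sums (real N * hardy2_norm f)"
      using sums_If_finite_set[of "{..<N}" "\<lambda>_. hardy2_norm f"] by simp
    have cs: "?c sums (real N * hardy2_norm f + 1 / (1 - norm \<mu>) * ?t)"
      using \<mu> by (intro sums_add fin sums_mult2 geometric_sums) simp
    have "(\<Sum>k. hardy2_norm (v k)) \<le> suminf ?c"
      by (rule suminf_le[OF le s sums_summable[OF cs]])
    hence "(\<Sum>k. hardy2_norm (v k)) \<le> real N * hardy2_norm f + 1 / (1 - norm \<mu>) * ?t"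
      unfolding sums_unique[OF cs, symmetric] .
    with q(2) show "hardy2_norm q \<le> real N * hardy2_norm f + ?t / (1 - norm \<mu>)" by simp
  qed
qed

text \<open>A zero \<open>\<mu>\<close> of \<open>f\<close> is replaced by a zero \<open>a\<close>: the new function is \<open>f z * (z - a) / (z - \<mu>)\<close>, that is, \<open>f\<close> plus
  \<open>\<mu> - a\<close> times its difference quotient. The factor \<open>\<mu> - a\<close> is at most \<open>\<gamma> + 1\<close> times \<open>1 - norm \<mu>\<close>, because
  \<open>\<mu>\<close> lies in a Stolz angle and \<open>a\<close> is close to \<open>\<zeta>\<close>. So the correction is small when \<open>\<mu>\<close> is close to \<open>\<zeta>\<close>.\<close>

lemma model_space_move_zero:
  assumes \<theta>: "inner_function \<theta>" and f: "f \<in> model_space \<theta>" and \<zeta>: "norm \<zeta> = 1" and "\<epsilon> > 0" and \<gamma>: "\<gamma> > 1"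
  obtains \<delta> where "\<delta> > 0"
    "\<And>\<mu> a. \<mu> \<in> stolz_angle \<gamma> \<zeta> \<Longrightarrow> f \<mu> = 0 \<Longrightarrow> norm (\<mu> - \<zeta>) < \<delta> \<Longrightarrow> norm a < 1 \<Longrightarrow> norm (a - \<zeta>) < 1 - norm \<mu> \<Longrightarrow>
       \<exists>g\<in>model_space \<theta>. hardy2_norm (\<lambda>z. g z - f z) < \<epsilon> \<and> g a = 0 \<and>
          (\<forall>z. norm z < 1 \<longrightarrow> (z - \<mu>) * g z = (z - a) * f z)"
proof -
  note fh = model_spaceD(1)[OF f]
  have "\<forall>\<^sub>F N in sequentially. hardy2_norm (\<lambda>z. f z - taylor_poly N f z) < \<epsilon> / (2 * (\<gamma> + 1))"
    using \<open>\<epsilon> > 0\<close> \<gamma> by (intro order_tendstoD(2)[OF taylor_poly_tendsto[OF fh]]) auto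
  then obtain N where N: "hardy2_norm (\<lambda>z. f z - taylor_poly N f z) < \<epsilon> / (2 * (\<gamma> + 1))"
    by (auto simp: eventually_sequentially)
  let ?t = "hardy2_norm (\<lambda>z. f z - taylor_poly N f z)"
  \<comment> \<open>\<open>N\<close> makes the remainder part of the correction less than \<open>\<epsilon> / 2\<close>; \<open>\<delta>\<close> does this for the polynomial part.\<close>
  define M where "M = (\<gamma> + 1) * (real N * hardy2_norm f)"
  have M: "M \<ge> 0" using \<gamma> fh by (simp add: M_def)
  define \<delta> where "\<delta> = \<epsilon> / (2 * (M + 1))"
  have \<delta>: "\<delta> > 0" using M \<open>\<epsilon> > 0\<close> by (simp add: \<delta>_def)
  show ?thesis
  proof (rule that[OF \<delta>])
    fix \<mu> a assume \<mu>: "\<mu> \<in> stolz_angle \<gamma> \<zeta>" "f \<mu> = 0" "norm (\<mu> - \<zeta>) < \<delta>"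
      and a: "norm a < 1" "norm (a - \<zeta>) < 1 - norm \<mu>"
    have \<mu>1: "norm \<mu> < 1" and \<mu>s: "norm (\<mu> - \<zeta>) \<le> \<gamma> * (1 - norm \<mu>)"
      using \<mu>(1) by (auto simp: stolz_angle_def)
    obtain q where q: "q \<in> model_space \<theta>" "\<And>z. norm z < 1 \<Longrightarrow> (z - \<mu>) * q z = f z - f \<mu>"
      "\<And>N. hardy2_norm q \<le> real N * hardy2_norm f + hardy2_norm (\<lambda>z. f z - taylor_poly N f z) / (1 - norm \<mu>)"
      using model_space_difference_quotient[OF \<theta> f \<mu>1] by blast
    define g where "g z = f z + (\<mu> - a) * q z" for z
    have gK: "g \<in> model_space \<theta>" unfolding g_def by (intro model_space_add model_space_cmult \<theta> f q)
    have "norm (\<mu> - a) \<le> norm (\<mu> - \<zeta>) + norm (a - \<zeta>)"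
      using norm_triangle_ineq4[of "\<mu> - \<zeta>" "a - \<zeta>"] by simp
    also have "\<dots> \<le> (\<gamma> + 1) * (1 - norm \<mu>)" using \<mu>s a(2) by (simp add: algebra_simps)
    finally have ml: "norm (\<mu> - a) \<le> (\<gamma> + 1) * (1 - norm \<mu>)" .
    have d: "1 - norm \<mu> \<le> norm (\<mu> - \<zeta>)"
      using norm_triangle_ineq2[of \<zeta> \<mu>] \<zeta> by (simp add: norm_minus_commute)
    have "hardy2_norm (\<lambda>z. g z - f z) = norm (\<mu> - a) * hardy2_norm q"
      using hardy2_norm_cmult[OF model_spaceD(1)[OF q(1)]] by (simp add: g_def)
    also have "\<dots> \<le> ((\<gamma> + 1) * (1 - norm \<mu>)) * (real N * hardy2_norm f + ?t / (1 - norm \<mu>))"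
      using ml q(3)[of N] model_spaceD(1)[OF q(1)] \<gamma> \<mu>1 by (intro mult_mono) auto
    also have "\<dots> = (1 - norm \<mu>) * M + (\<gamma> + 1) * ?t"
      using \<mu>1 by (simp add: M_def field_simps)
    also have "(1 - norm \<mu>) * M \<le> \<delta> * M" using d \<mu>(3) M by (intro mult_right_mono) auto
    also have "\<delta> * M \<le> \<epsilon> / 2"
      unfolding \<delta>_def using M \<open>\<epsilon> > 0\<close> by (simp add: field_simps)
    also have "(\<gamma> + 1) * ?t < \<epsilon> / 2" using N \<gamma> by (simp add: field_simps)
    finally have near: "hardy2_norm (\<lambda>z. g z - f z) < \<epsilon>" by simp
    have ga: "g a = 0" using q(2)[OF a(1)] \<mu>(2) by (simp add: g_def algebra_simps)
    have "(z - \<mu>) * g z = (z - a) * f z" if "norm z < 1" for z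
      using q(2)[OF that] \<mu>(2) unfolding g_def
      by (metis (no_types, lifting) add.commute diff_add_cancel diff_zero distrib_left distrib_right mult.left_commute add_diff_eq)
    with gK near ga show "\<exists>g\<in>model_space \<theta>. hardy2_norm (\<lambda>z. g z - f z) < \<epsilon> \<and> g a = 0 \<and>
          (\<forall>z. norm z < 1 \<longrightarrow> (z - \<mu>) * g z = (z - a) * f z)" by blast
  qed
qed

section \<open>Overcompleteness and localization\<close>

text \<open>Common frame of the two constructions. The predicate \<open>P f S\<close> records that \<open>f\<close> has zeros at the points
  with index in \<open>S\<close> and whatever else is needed to continue. If each step may add a further zero at
  arbitrarily small cost, the corrections can be chosen to have total norm at most half the norm of
  the initial function, so the limit is not zero and keeps all the zeros.\<close>

lemma vanishing_on_subsequence: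
  fixes P :: "(complex \<Rightarrow> complex) \<Rightarrow> nat set \<Rightarrow> bool" and w :: "nat \<Rightarrow> complex"
  assumes \<theta>: "inner_function \<theta>" and w: "\<And>n. norm (w n) < 1"
    and P: "\<And>f S. P f S \<Longrightarrow> f \<in> model_space \<theta> \<and> (\<forall>n\<in>S. f (w n) = 0)"
    and step: "\<And>f S \<epsilon> N. P f S \<Longrightarrow> finite S \<Longrightarrow> \<epsilon> > 0 \<Longrightarrow>
        \<exists>n>N. \<exists>g. P g (insert n S) \<and> hardy2_norm (\<lambda>z. g z - f z) < \<epsilon>"
    and f: "P f {}" "hardy2_norm f > 0"
  shows "\<exists>(s :: nat \<Rightarrow> nat) F. strict_mono s \<and> F \<in> model_space \<theta> \<and> hardy2_norm F > 0 \<and> (\<forall>j. F (w (s j)) = 0)"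
proof -
  \<comment> \<open>The state of the recursion is the function, the set of indices already used, and the last index.\<close>
  define \<epsilon> where "\<epsilon> j = hardy2_norm f / 2 * (1/2) ^ Suc j" for j :: nat
  have \<epsilon>: "\<epsilon> j > 0" for j using f(2) by (simp add: \<epsilon>_def)
  let ?inv = "\<lambda>(j::nat) (x :: (complex \<Rightarrow> complex) \<times> nat set \<times> nat). P (fst x) (fst (snd x)) \<and> finite (fst (snd x)) \<and> (j = 0 \<longrightarrow> fst x = f)"
  let ?next = "\<lambda>(j::nat) (x :: (complex \<Rightarrow> complex) \<times> nat set \<times> nat) y. snd (snd x) < snd (snd y) \<and>
     fst (snd y) = insert (snd (snd y)) (fst (snd x)) \<and> hardy2_norm (\<lambda>z. fst y z - fst x z) < \<epsilon> j"
  have "\<exists>X. \<forall>j. ?inv j (X j) \<and> ?next j (X j) (X (Suc j))"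
  proof (rule dependent_nat_choice)
    show "\<exists>x. ?inv 0 x" using f(1) by (intro exI[of _ "(f, {}, 0)"]) simp
    fix x j assume x: "?inv j x"
    obtain n g where "n > snd (snd x)" "P g (insert n (fst (snd x)))" "hardy2_norm (\<lambda>z. g z - fst x z) < \<epsilon> j"
      using step[of "fst x" "fst (snd x)" "\<epsilon> j" "snd (snd x)"] x \<epsilon> by auto
    thus "\<exists>y. ?inv (Suc j) y \<and> ?next j x y"
      using x by (intro exI[of _ "(g, insert n (fst (snd x)), n)"]) simp
  qed
  then obtain X where inv: "\<And>j. ?inv j (X j)" and nxt: "\<And>j. ?next j (X j) (X (Suc j))" by blast
  define h where "h j = fst (X j)" for j
  define s where "s j = snd (snd (X (Suc j)))" for j
  have h0: "h 0 = f" using inv[of 0] by (simp add: h_def)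
  have hP: "P (h j) (fst (snd (X j)))" for j using inv[of j] by (simp add: h_def)
  have hK: "h j \<in> model_space \<theta>" for j using P[OF hP] by simp
  have sm: "strict_mono s"
    unfolding strict_mono_Suc_iff s_def using nxt by blast
  have mem: "s j \<in> fst (snd (X i))" if "j < i" for i j
    using that
  proof (induction i)
    case (Suc i)
    have "fst (snd (X (Suc i))) = insert (s i) (fst (snd (X i)))" using nxt[of i] by (simp add: s_def)
    thus ?case using Suc by (cases "j = i") auto
  qed simp
  define v where "v j z = h (Suc j) z - h j z" for j z
  have vK: "v j \<in> model_space \<theta>" for j unfolding v_def by (intro model_space_diff \<theta> hK)
  have v\<epsilon>: "hardy2_norm (v j) \<le> \<epsilon> j" for j using nxt[of j] by (simp add: v_def[abs_def] h_def less_imp_le)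
  have "\<epsilon> sums (hardy2_norm f / 2 * 1)"
    unfolding \<epsilon>_def by (intro sums_mult power_half_series)
  hence e: "\<epsilon> sums (hardy2_norm f / 2)" by simp
  have summ: "summable (\<lambda>j. hardy2_norm (v j))"
    by (rule summable_comparison_test'[OF sums_summable[OF e]])
      (use v\<epsilon> model_spaceD(1)[OF vK] in simp)
  obtain q where q: "q \<in> model_space \<theta>" "hardy2_norm q \<le> (\<Sum>j. hardy2_norm (v j))"
    "\<And>z. norm z < 1 \<Longrightarrow> (\<lambda>j. v j z) sums q z"
    using model_space_series[OF \<theta> vK summ] by blast
  have q\<epsilon>: "hardy2_norm q \<le> hardy2_norm f / 2"
    using q(2) suminf_le[OF v\<epsilon> summ sums_summable[OF e]] sums_unique[OF e] by simp
  define F where "F z = f z + q z" for z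
  have fK: "f \<in> model_space \<theta>" using hK[of 0] h0 by simp
  have FK: "F \<in> model_space \<theta>" unfolding F_def by (intro model_space_add \<theta> fK q)
  have lim: "(\<lambda>n. h n z) \<longlonglongrightarrow> F z" if "norm z < 1" for z
  proof -
    have "(\<Sum>j<n. v j z) = h n z - f z" for n
      unfolding v_def by (subst sum_lessThan_telescope) (simp add: h0)
    hence "(\<lambda>n. h n z - f z) \<longlonglongrightarrow> q z" using q(3)[OF that] by (simp add: sums_def)
    from tendsto_add[OF this tendsto_const, of "f z"] show ?thesis by (simp add: F_def add.commute)
  qed
  show ?thesis
  proof (intro exI conjI allI)
    show "strict_mono s" by (rule sm)
    show "F \<in> model_space \<theta>" by (rule FK)
    note hh = model_spaceD(1)[OF FK] model_spaceD(1)[OF q(1)]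
    have "hardy2_norm f \<le> hardy2_norm F + hardy2_norm q"
      using hardy2_norm_triangle[OF hh(1) hardy2_cmult[OF hh(2), of "-1"]] hardy2_norm_cmult[OF hh(2), of "-1"]
      by (simp add: F_def)
    with q\<epsilon> f(2) show "hardy2_norm F > 0" by simp
    fix j
    have "\<forall>\<^sub>F n in sequentially. h n (w (s j)) = 0"
      using eventually_gt_at_top[of j] by eventually_elim (use P[OF hP] mem in blast)
    hence "(\<lambda>n. h n (w (s j))) \<longlonglongrightarrow> 0" by (rule tendsto_eventually)
    with lim[OF w] show "F (w (s j)) = 0" using LIMSEQ_unique by blast
  qed
qed

text \<open>A Stolz angle meets the circle only at its vertex: outside a neighbourhood of \<open>\<zeta>\<close> it lies in a smaller
  closed disc, where a nonzero holomorphic function has finitely many zeros.\<close>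

lemma stolz_zeros_accumulate:
  assumes f: "f holomorphic_on ball 0 1" "z0 \<in> ball 0 1" "f z0 \<noteq> 0"
    and \<gamma>: "\<gamma> > 1" and inf: "infinite {z \<in> stolz_angle \<gamma> \<zeta>. f z = 0}" and "\<delta> > 0" "finite E"
  obtains \<mu> where "\<mu> \<in> stolz_angle \<gamma> \<zeta>" "f \<mu> = 0" "norm (\<mu> - \<zeta>) < \<delta>" "\<mu> \<notin> E"
proof -
  have "\<exists>\<mu>. \<mu> \<in> stolz_angle \<gamma> \<zeta> \<and> f \<mu> = 0 \<and> norm (\<mu> - \<zeta>) < \<delta> \<and> \<mu> \<notin> E"
  proof (rule ccontr)
    assume neg: "\<not> ?thesis"
    have nc: "\<not> f constant_on ball 0 1"
    proof
      assume "f constant_on ball 0 1"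
      then obtain c where "\<And>z. z \<in> ball 0 1 \<Longrightarrow> f z = c" by (auto simp: constant_on_def)
      with f(2,3) have "{z \<in> stolz_angle \<gamma> \<zeta>. f z = 0} = {}" by (auto simp: stolz_angle_def)
      with inf show False by simp
    qed
    have "\<delta> / \<gamma> > 0" using \<gamma> \<open>\<delta> > 0\<close> by simp
    hence "finite {z \<in> cball 0 (1 - \<delta> / \<gamma>). f z = 0}"
      by (intro holomorphic_compact_finite_zeros[OF f(1)] nc) auto
    moreover have "{z \<in> stolz_angle \<gamma> \<zeta>. f z = 0} \<subseteq> E \<union> {z \<in> cball 0 (1 - \<delta> / \<gamma>). f z = 0}"
    proof
      fix z assume z: "z \<in> {z \<in> stolz_angle \<gamma> \<zeta>. f z = 0}"
      show "z \<in> E \<union> {z \<in> cball 0 (1 - \<delta> / \<gamma>). f z = 0}"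
      proof (cases "z \<in> E")
        case False
        with neg z have "\<delta> \<le> norm (z - \<zeta>)" by (auto simp: not_less)
        also have "\<dots> \<le> \<gamma> * (1 - norm z)" using z by (simp add: stolz_angle_def)
        finally have "\<delta> / \<gamma> \<le> 1 - norm z" using \<gamma> by (simp add: field_simps)
        thus ?thesis using z by simp
      qed simp
    qed
    ultimately show False using inf \<open>finite E\<close> by (meson finite_UnI finite_subset)
  qed
  thus ?thesis using that by blast
qed

text \<open>If a nonzero function has infinitely many zeros in a Stolz angle, these zeros can be moved one after
  the other to points of the sequence \<open>w\<close>. The limit is a nonzero function orthogonal to a whole
  subsequence of the kernels.\<close>

lemma overcomplete_imp_localization:
  assumes \<theta>: "inner_function \<theta>" and \<zeta>: "norm \<zeta> = 1" and w: "\<And>n. norm (w n) < 1" "w \<longlonglongrightarrow> \<zeta>"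
    and oc: "overcomplete_in (model_space \<theta>) (\<lambda>n. model_kernel \<theta> (w n))"
  shows "localization_property \<theta> \<zeta>"
proof (rule ccontr)
  assume "\<not> localization_property \<theta> \<zeta>"
  then obtain f \<gamma> where f: "f \<in> model_space \<theta>" "\<exists>z\<in>ball 0 1. f z \<noteq> 0" and \<gamma>: "\<gamma> > 1"
    and inf: "infinite {z \<in> stolz_angle \<gamma> \<zeta>. f z = 0}"
    by (auto simp: localization_property_def)
  define P where "P f S \<longleftrightarrow> f \<in> model_space \<theta> \<and> (\<forall>n\<in>S. f (w n) = 0) \<and> (\<exists>z\<in>ball 0 1. f z \<noteq> 0) \<and>
      infinite {z \<in> stolz_angle \<gamma> \<zeta>. f z = 0}" for f and S :: "nat set"
  have step: "\<exists>n>N. \<exists>g. P g (insert n S) \<and> hardy2_norm (\<lambda>z. g z - f z) < \<epsilon>"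
    if Pf: "P f S" and S: "finite S" and e: "\<epsilon> > 0" for f S \<epsilon> N
  proof -
    have fK: "f \<in> model_space \<theta>" and fS: "\<forall>n\<in>S. f (w n) = 0"
      and finf: "infinite {z \<in> stolz_angle \<gamma> \<zeta>. f z = 0}" using Pf by (auto simp: P_def)
    obtain z0 where z0: "z0 \<in> ball 0 1" "f z0 \<noteq> 0" using Pf by (auto simp: P_def)
    obtain \<delta> where \<delta>: "\<delta> > 0" and move: "\<And>\<mu> a. \<mu> \<in> stolz_angle \<gamma> \<zeta> \<Longrightarrow> f \<mu> = 0 \<Longrightarrow> norm (\<mu> - \<zeta>) < \<delta> \<Longrightarrow> norm a < 1 \<Longrightarrow>
       norm (a - \<zeta>) < 1 - norm \<mu> \<Longrightarrow> \<exists>g\<in>model_space \<theta>. hardy2_norm (\<lambda>z. g z - f z) < \<epsilon> \<and> g a = 0 \<and>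
          (\<forall>z. norm z < 1 \<longrightarrow> (z - \<mu>) * g z = (z - a) * f z)"
      by (rule model_space_move_zero[OF \<theta> fK \<zeta> e \<gamma>]) blast
    have fin: "finite (w ` S)" using S by simp
    obtain \<mu> where \<mu>: "\<mu> \<in> stolz_angle \<gamma> \<zeta>" "f \<mu> = 0" "norm (\<mu> - \<zeta>) < \<delta>" "\<mu> \<notin> w ` S"
      by (rule stolz_zeros_accumulate[OF hardy2_hol[OF model_spaceD(1)[OF fK]] z0 \<gamma> finf \<delta> fin])
    have \<mu>1: "norm \<mu> < 1" using \<mu>(1) by (simp add: stolz_angle_def)
    have "\<forall>\<^sub>F n in sequentially. norm (w n - \<zeta>) < 1 - norm \<mu>"
      using tendstoD[OF w(2), of "1 - norm \<mu>"] \<mu>1 by (simp add: dist_norm)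
    hence "\<forall>\<^sub>F n in sequentially. norm (w n - \<zeta>) < 1 - norm \<mu> \<and> n > N"
      by (intro eventually_conj eventually_gt_at_top)
    then obtain n where n: "norm (w n - \<zeta>) < 1 - norm \<mu>" "n > N"
      by (auto simp: eventually_sequentially)
    obtain g where g: "g \<in> model_space \<theta>" "hardy2_norm (\<lambda>z. g z - f z) < \<epsilon>" "g (w n) = 0"
        and eq: "\<And>z. norm z < 1 \<Longrightarrow> (z - \<mu>) * g z = (z - w n) * f z"
      using move[OF \<mu>(1-3) w(1) n(1)] by blast
    have gz: "g z = 0" if "f z = 0" "norm z < 1" "z \<noteq> \<mu>" for z
      using eq[of z] that by auto
    have gS: "g (w m) = 0" if "m \<in> S" for m
      by (rule gz) (use that fS w \<mu>(4) in auto)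
    have "infinite ({z \<in> stolz_angle \<gamma> \<zeta>. f z = 0} - {\<mu>})" using finf by (rule infinite_remove)
    moreover have "{z \<in> stolz_angle \<gamma> \<zeta>. f z = 0} - {\<mu>} \<subseteq> {z \<in> stolz_angle \<gamma> \<zeta>. g z = 0}"
      using gz by (auto simp: stolz_angle_def)
    ultimately have ginf: "infinite {z \<in> stolz_angle \<gamma> \<zeta>. g z = 0}" using infinite_super by blast
    \<comment> \<open>If \<open>g\<close> were zero, \<open>f\<close> would vanish except perhaps at \<open>w n\<close>, contrary to continuity.\<close>
    have "\<exists>z\<in>ball 0 1. g z \<noteq> 0"
    proof (rule ccontr)
      assume "\<not> ?thesis"
      hence "f z = 0" if "norm z < 1" "z \<noteq> w n" for z using eq[of z] that by auto
      with z0 have z0n: "z0 = w n" by auto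
      have "\<exists>u. norm u < 1 \<and> u \<noteq> w n \<and> f u \<noteq> 0"
      proof -
        have "open (ball (0::complex) 1 \<inter> f -` (-{0}))"
          using holomorphic_on_imp_continuous_on[OF hardy2_hol[OF model_spaceD(1)[OF fK]]]
          by (intro continuous_open_preimage) auto
        moreover have "w n \<in> ball 0 1 \<inter> f -` (-{0})" using z0 z0n by auto
        ultimately have "w n islimpt (ball (0::complex) 1 \<inter> f -` (-{0}))"
          by (rule interior_limit_point[OF interior_open[THEN equalityD2, THEN subsetD]])
        then obtain u where "u \<in> ball (0::complex) 1 \<inter> f -` (-{0})" "u \<noteq> w n"
          unfolding islimpt_def by (metis UNIV_I open_UNIV)
        thus ?thesis by auto
      qed
      with \<open>\<And>z. norm z < 1 \<Longrightarrow> z \<noteq> w n \<Longrightarrow> f z = 0\<close> show False by blast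
    qed
    with g gS ginf n(2) show ?thesis by (intro exI[of _ n]) (auto simp: P_def)
  qed
  have PK: "f \<in> model_space \<theta> \<and> (\<forall>n\<in>S. f (w n) = 0)" if "P f S" for f S using that by (simp add: P_def)
  have P0: "P f {}" using f inf by (simp add: P_def)
  have fpos: "hardy2_norm f > 0" using model_space_norm_pos[OF f(1)] f(2) by simp
  have "\<exists>(s :: nat \<Rightarrow> nat) F. strict_mono s \<and> F \<in> model_space \<theta> \<and> hardy2_norm F > 0 \<and> (\<forall>j. F (w (s j)) = 0)"
    by (rule vanishing_on_subsequence[where P = P, OF \<theta> w(1) _ _ P0 fpos]) (fact PK step)+
  then obtain s :: "nat \<Rightarrow> nat" and F where s: "strict_mono s" and F: "F \<in> model_space \<theta>" "hardy2_norm F > 0" "\<And>j. F (w (s j)) = 0" by blast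
  have "complete_in (model_space \<theta>) (model_kernel \<theta> ` range (w \<circ> s))"
    using oc s unfolding overcomplete_in_def by (simp add: image_image comp_def)
  moreover have "range (w \<circ> s) \<subseteq> ball 0 1" using w(1) by auto
  ultimately have "hardy2_norm F = 0" using F(1,3) by (intro complete_kernels_unique[OF \<theta>]) auto
  with F(2) show False by simp
qed

text \<open>The points on the radius lie in the Stolz angle with \<open>\<gamma> = 2\<close>.\<close>

lemma localization_imp_radial_overcomplete:
  assumes \<theta>: "inner_function \<theta>" and \<zeta>: "norm \<zeta> = 1" and loc: "localization_property \<theta> \<zeta>"
    and s: "strict_mono (s :: nat \<Rightarrow> nat)"
    and f: "f \<in> model_space \<theta>" "\<And>j. f (of_real (radii (s j)) * \<zeta>) = 0" and z: "norm z < 1"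
  shows "f z = 0"
proof (rule ccontr)
  assume "f z \<noteq> 0"
  hence fin: "finite {z \<in> stolz_angle 2 \<zeta>. f z = 0}"
    using loc f(1) z by (auto simp: localization_property_def)
  let ?p = "\<lambda>j. of_real (radii (s j)) * \<zeta>"
  have "inj ?p"
  proof (rule injI)
    fix i j assume "?p i = ?p j"
    hence "radii (s i) = radii (s j)" using \<zeta> by auto
    hence "s i = s j" by (auto simp: radii_def)
    thus "i = j" using strict_mono_eq[OF s] by simp
  qed
  hence "infinite (range ?p)" by (simp add: finite_image_iff)
  moreover have "range ?p \<subseteq> {z \<in> stolz_angle 2 \<zeta>. f z = 0}"
  proof clarsimp
    fix j
    have "norm (of_real (radii (s j)) * \<zeta> - \<zeta>) = 1 - radii (s j)"
    proof -
      have "of_real (radii (s j)) * \<zeta> - \<zeta> = of_real (radii (s j) - 1) * \<zeta>" by (simp add: algebra_simps)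
      thus ?thesis using \<zeta> radii_bounds[of "s j"] by (simp only: norm_mult norm_of_real) simp
    qed
    thus "of_real (radii (s j)) * \<zeta> \<in> stolz_angle 2 \<zeta> \<and> f (of_real (radii (s j)) * \<zeta>) = 0"
      using f(2) radii_bounds[of "s j"] \<zeta> by (simp add: stolz_angle_def norm_mult)
  qed
  ultimately show False using fin finite_subset by blast
qed

lemma localization_imp_overcomplete:
  assumes \<theta>: "inner_function \<theta>" and \<zeta>: "norm \<zeta> = 1" and loc: "localization_property \<theta> \<zeta>"
  shows "overcomplete_in (model_space \<theta>) (\<lambda>n. model_kernel \<theta> (of_real (radii n) * \<zeta>))"
  unfolding overcomplete_in_def
proof (intro allI impI)
  fix s :: "nat \<Rightarrow> nat" assume s: "strict_mono s"
  have "complete_in (model_space \<theta>) (model_kernel \<theta> ` range (\<lambda>j. of_real (radii (s j)) * \<zeta>))"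
  proof (rule kernels_complete[OF \<theta>])
    show "range (\<lambda>j. of_real (radii (s j)) * \<zeta>) \<subseteq> ball 0 1"
      using \<zeta> radii_bounds by (auto simp: norm_mult abs_of_pos)
    fix f and z :: complex
    assume f: "f \<in> model_space \<theta>" "\<forall>w\<in>range (\<lambda>j. of_real (radii (s j)) * \<zeta>). f w = 0" and z: "norm z < 1"
    show "f z = 0"
      by (rule localization_imp_radial_overcomplete[OF \<theta> \<zeta> loc s f(1) _ z]) (use f(2) in blast)
  qed
  thus "complete_in (model_space \<theta>) (range ((\<lambda>n. model_kernel \<theta> (of_real (radii n) * \<zeta>)) \<circ> s))"
    by (simp add: image_image comp_def)
qed

section \<open>Kernels of unbounded norm\<close>

text \<open>A single kernel is bounded on the disc because its denominator is at least \<open>1 - norm a\<close>.\<close>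

lemma model_kernel_span_bounded:
  assumes \<theta>: "inner_function \<theta>" and h: "h \<in> complex_span (model_kernel \<theta> ` ball 0 1)"
  shows "\<exists>C>0. \<forall>z. norm z < 1 \<longrightarrow> norm (h z) \<le> C"
  using h
proof (rule complex_span_induct)
  show "\<exists>C>0. \<forall>z::complex. norm z < 1 \<longrightarrow> norm (0::complex) \<le> C" by (intro exI[of _ 1]) auto
  fix c k g assume "k \<in> model_kernel \<theta> ` ball 0 1" and "\<exists>C>0. \<forall>z::complex. norm z < 1 \<longrightarrow> norm (g z :: complex) \<le> C"
  then obtain a C where a: "norm a < 1" "k = model_kernel \<theta> a" and C: "C > 0" "\<And>z::complex. norm z < 1 \<Longrightarrow> norm (g z) \<le> C"
    by auto
  define D where "D = 2 / (1 - norm a)"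
  have D: "D > 0" using a by (simp add: D_def)
  have k: "norm (k z) \<le> D" if z: "norm z < 1" for z
  proof -
    have "norm (cnj (\<theta> a) * \<theta> z) \<le> 1 * 1"
      unfolding norm_mult complex_mod_cnj using inner_functionD(2)[OF \<theta>] a z by (intro mult_mono) auto
    hence 1: "norm (1 - cnj (\<theta> a) * \<theta> z) \<le> 2"
      using norm_triangle_ineq4[of 1 "cnj (\<theta> a) * \<theta> z"] by simp
    have "norm (cnj a * z) \<le> norm a * 1"
      unfolding norm_mult complex_mod_cnj using z by (intro mult_left_mono) auto
    hence "1 - norm a \<le> norm (1 - cnj a * z)"
      using norm_triangle_ineq2[of 1 "cnj a * z"] by simp
    with 1 show ?thesis
      unfolding a(2) model_kernel_def D_def norm_divide using a(1) by (intro frac_le) auto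
  qed
  show "\<exists>C>0. \<forall>z::complex. norm z < 1 \<longrightarrow> norm (c * k z + g z) \<le> C"
  proof (intro exI[of _ "norm c * D + C"] conjI allI impI)
    show "norm c * D + C > 0" using D C by (intro add_nonneg_pos) auto
    fix z :: complex assume z: "norm z < 1"
    have "norm (c * k z) \<le> norm c * D" using k[OF z] by (simp add: norm_mult mult_left_mono)
    with C(2)[OF z] norm_triangle_ineq[of "c * k z" "g z"] show "norm (c * k z + g z) \<le> norm c * D + C" by simp
  qed
qed

text \<open>If the kernels at the points \<open>w n\<close> have norms tending to infinity, interpolating a value of \<open>f\<close> at
  \<open>w n\<close> costs little for large \<open>n\<close>, even with prescribed zeros at finitely many of the points.

  Without prescribed zeros a multiple of the kernel does it: its norm is
  \<open>norm (f (w n))\<close> over the norm of the kernel, and this quotient tends to zero for a combination of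
  kernels, which is bounded, and hence for every \<open>f\<close> by density. To prescribe one more zero \<open>w m\<close>, an element
  \<open>e\<close> with \<open>e (w m) = 1\<close> is corrected so that it vanishes at \<open>w n\<close> while its value at \<open>w m\<close> stays away from zero,
  and a small multiple of it cancels the value of the interpolant at \<open>w m\<close>.\<close>

lemma small_interpolant:
  assumes \<theta>: "inner_function \<theta>" and w: "\<And>n. norm (w n) < 1"
    and unb: "filterlim (\<lambda>n. hardy2_norm (model_kernel \<theta> (w n))) at_top sequentially"
    and "finite S"
  shows "\<lbrakk>f \<in> model_space \<theta>; \<forall>m\<in>S. f (w m) = 0; \<epsilon> > 0\<rbrakk> \<Longrightarrow>
     \<forall>\<^sub>F n in sequentially. \<exists>g\<in>model_space \<theta>. (\<forall>m\<in>S. g (w m) = 0) \<and> hardy2_norm g < \<epsilon> \<and> g (w n) = f (w n)"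
  using \<open>finite S\<close>
proof (induction S arbitrary: f \<epsilon> rule: finite_induct)
  case empty
  have "complete_in (model_space \<theta>) (model_kernel \<theta> ` ball 0 1)"
    by (rule kernels_complete[OF \<theta>]) auto
  then obtain h where h: "h \<in> complex_span (model_kernel \<theta> ` ball 0 1)" and near: "hardy2_norm (\<lambda>z. f z - h z) < \<epsilon> / 2"
    using empty half_gt_zero unfolding complete_in_def by meson
  have hK: "h \<in> model_space \<theta>"
    by (rule complex_span_model_space[OF \<theta> _ h]) (use model_kernel(1)[OF \<theta>] in auto)
  have dK: "(\<lambda>z. f z - h z) \<in> model_space \<theta>" by (intro model_space_diff \<theta> hK empty)
  obtain C where C: "C > 0" "\<And>z. norm z < 1 \<Longrightarrow> norm (h z) \<le> C"
    using model_kernel_span_bounded[OF \<theta> h] by blast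
  have "\<forall>\<^sub>F n in sequentially. hardy2_norm (model_kernel \<theta> (w n)) > 2 * C / \<epsilon>"
    using unb by (simp add: filterlim_at_top_dense)
  thus ?case
  proof eventually_elim
    case (elim n)
    let ?k = "model_kernel \<theta> (w n)"
    note k = model_kernel[OF \<theta> w[of n]]
    note kh = model_spaceD(1)[OF k(1)]
    have "2 * C / \<epsilon> > 0" using C \<open>\<epsilon> > 0\<close> by simp
    hence pos: "hardy2_norm ?k > 0" using elim by linarith
    have kk: "?k (w n) = of_real ((hardy2_norm ?k)\<^sup>2)"
      using k(2)[OF k(1)] hardy2_inner_self[OF kh] by simp
    define c where "c = f (w n) / of_real ((hardy2_norm ?k)\<^sup>2)"
    have "norm (f (w n)) \<le> norm (f (w n) - h (w n)) + norm (h (w n))"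
      using norm_triangle_sub[of "f (w n)" "h (w n)"] by simp
    also have "norm (f (w n) - h (w n)) \<le> hardy2_norm (\<lambda>z. f z - h z) * hardy2_norm ?k"
      using hardy2_cauchy_schwarz[OF model_spaceD(1)[OF dK] kh] k(2)[OF dK] by simp
    also have "\<dots> \<le> \<epsilon> / 2 * hardy2_norm ?k" using near pos by (intro mult_right_mono) auto
    also have "norm (h (w n)) \<le> C" by (rule C(2)[OF w])
    also have "C < \<epsilon> / 2 * hardy2_norm ?k" using elim \<open>\<epsilon> > 0\<close> by (simp add: field_simps)
    finally have fb: "norm (f (w n)) < \<epsilon> * hardy2_norm ?k" by simp
    have "norm c = norm (f (w n)) / (hardy2_norm ?k)\<^sup>2"
      by (simp add: c_def norm_divide norm_power)
    hence "hardy2_norm (\<lambda>z. c * ?k z) = norm (f (w n)) / hardy2_norm ?k"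
      using hardy2_norm_cmult[OF kh, of c] pos by (simp add: power2_eq_square)
    also have "\<dots> < \<epsilon>" using fb pos by (simp add: field_simps)
    finally have "hardy2_norm (\<lambda>z. c * ?k z) < \<epsilon>" .
    moreover have "c * ?k (w n) = f (w n)" unfolding kk c_def using pos by simp
    ultimately show ?case by (intro bexI[of _ "\<lambda>z. c * ?k z"] model_space_cmult \<theta> k) auto
  qed
next
  case (insert m S)
  let ?V = "{g \<in> model_space \<theta>. \<forall>i\<in>S. g (w i) = 0}"
  show ?case
  proof (cases "\<exists>e\<in>?V. e (w m) \<noteq> 0")
    case False
    have "\<forall>\<^sub>F n in sequentially. \<exists>g\<in>model_space \<theta>. (\<forall>i\<in>S. g (w i) = 0) \<and> hardy2_norm g < \<epsilon> \<and> g (w n) = f (w n)"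
      using insert by (intro insert.IH) auto
    thus ?thesis by eventually_elim (use False in auto)
  next
    case True
    then obtain e0 where e0: "e0 \<in> model_space \<theta>" "\<forall>i\<in>S. e0 (w i) = 0" "e0 (w m) \<noteq> 0" by auto
    define e where "e z = (1 / e0 (w m)) * e0 z" for z
    have eK: "e \<in> model_space \<theta>" unfolding e_def by (intro model_space_cmult \<theta> e0)
    have e: "\<forall>i\<in>S. e (w i) = 0" "e (w m) = 1" using e0 by (auto simp: e_def)
    obtain C where C: "C > 0" "\<And>h. h \<in> hardy2 \<Longrightarrow> norm (h (w m)) \<le> C * hardy2_norm h"
      using hardy2_eval_bound[OF w] by blast
    define B where "B = hardy2_norm e + 1 / (2 * C)"
    have B: "B \<ge> 0" using C model_spaceD(1)[OF eK] by (simp add: B_def)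
    \<comment> \<open>The first bound keeps \<open>e'\<close> away from zero at \<open>w m\<close>; the second makes the final norm less than \<open>\<epsilon>\<close>.\<close>
    define \<eta> where "\<eta> = min (1 / (2 * C)) (\<epsilon> / (1 + 2 * C * B + 1))"
    have den: "1 + 2 * C * B + 1 > 0" using B C by (intro add_nonneg_pos) auto
    have \<eta>: "\<eta> > 0" "\<eta> \<le> 1 / (2 * C)" "\<eta> \<le> \<epsilon> / (1 + 2 * C * B + 1)"
      using C den \<open>\<epsilon> > 0\<close> by (auto simp: \<eta>_def)
    have "\<eta> * (1 + 2 * C * B + 1) \<le> \<epsilon>" using \<eta>(3) den by (simp add: pos_le_divide_eq)
    hence \<eta>\<epsilon>: "\<eta> + 2 * C * \<eta> * B < \<epsilon>" using \<eta>(1) by (simp add: algebra_simps)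
    have "\<forall>\<^sub>F n in sequentially. \<exists>g\<in>model_space \<theta>. (\<forall>i\<in>S. g (w i) = 0) \<and> hardy2_norm g < \<eta> \<and> g (w n) = f (w n)"
      using insert \<eta> by (intro insert.IH) auto
    moreover have "\<forall>\<^sub>F n in sequentially. \<exists>g\<in>model_space \<theta>. (\<forall>i\<in>S. g (w i) = 0) \<and> hardy2_norm g < \<eta> \<and> g (w n) = e (w n)"
      using eK e \<eta> by (intro insert.IH) auto
    ultimately show ?thesis
    proof eventually_elim
      case (elim n)
      then obtain g1 g2 where g1: "g1 \<in> model_space \<theta>" "\<forall>i\<in>S. g1 (w i) = 0" "hardy2_norm g1 < \<eta>" "g1 (w n) = f (w n)"
        and g2: "g2 \<in> model_space \<theta>" "\<forall>i\<in>S. g2 (w i) = 0" "hardy2_norm g2 < \<eta>" "g2 (w n) = e (w n)" by blast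
      note h1 = model_spaceD(1)[OF g1(1)] and h2 = model_spaceD(1)[OF g2(1)] and eh = model_spaceD(1)[OF eK]
      define e' where "e' z = e z - g2 z" for z
      have e'K: "e' \<in> model_space \<theta>" unfolding e'_def by (intro model_space_diff \<theta> eK g2)
      have "norm (g2 (w m)) \<le> C * hardy2_norm g2" by (rule C(2)[OF h2])
      also have "\<dots> \<le> C * (1 / (2 * C))" using g2(3) \<eta>(2) C(1) by (intro mult_left_mono) auto
      also have "\<dots> = 1/2" using C(1) by simp
      finally have e'm: "norm (e' (w m)) \<ge> 1/2"
        using norm_triangle_ineq2[of 1 "g2 (w m)"] e(2) by (simp add: e'_def)
      define c where "c = - (g1 (w m) / e' (w m))"
      have "norm (g1 (w m)) \<le> C * \<eta>"
        using order_trans[OF C(2)[OF h1] mult_left_mono[OF less_imp_le[OF g1(3)]]] C(1) by simp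
      hence "norm c \<le> (C * \<eta>) / (1/2)"
        unfolding c_def norm_minus_cancel norm_divide using e'm C(1) \<eta>(1) by (intro frac_le) auto
      hence c: "norm c \<le> 2 * C * \<eta>" by simp
      have e'norm: "hardy2_norm e' \<le> B"
        using hardy2_norm_triangle[OF eh hardy2_cmult[OF h2, of "-1"]] hardy2_norm_cmult[OF h2, of "-1"] g2(3) \<eta>(2)
        by (simp add: e'_def[abs_def] B_def)
      define g where "g z = g1 z + c * e' z" for z
      have "g \<in> model_space \<theta>" unfolding g_def by (intro model_space_add model_space_cmult \<theta> g1 e'K)
      moreover have "hardy2_norm g < \<epsilon>"
      proof -
        have "hardy2_norm g \<le> hardy2_norm g1 + norm c * hardy2_norm e'"
          using hardy2_norm_triangle[OF h1 hardy2_cmult[OF model_spaceD(1)[OF e'K], of c]]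
            hardy2_norm_cmult[OF model_spaceD(1)[OF e'K], of c] by (simp add: g_def[abs_def])
        also have "norm c * hardy2_norm e' \<le> 2 * C * \<eta> * B"
          using c e'norm B C(1) \<eta>(1) model_spaceD(1)[OF e'K] by (intro mult_mono) (auto intro: order_trans[OF norm_ge_zero])
        finally show ?thesis using g1(3) \<eta>\<epsilon> by linarith
      qed
      moreover have "g (w n) = f (w n)" using g1(4) g2(4) by (simp add: g_def e'_def)
      moreover have "g (w m) = 0" using e'm by (auto simp: g_def c_def)
      moreover have "\<forall>i\<in>S. g (w i) = 0" using g1(2) g2(2) e(1) by (simp add: g_def e'_def)
      ultimately show ?case by (intro bexI[of _ g]) auto
    qed
  qed
qed

text \<open>Otherwise subtracting small interpolants one after the other gives a nonzero function that vanishes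
  infinitely often on a radius, hence in a Stolz angle.\<close>

lemma localization_imp_kernels_not_unbounded:
  assumes \<theta>: "inner_function \<theta>" and \<zeta>: "norm \<zeta> = 1" and loc: "localization_property \<theta> \<zeta>"
  shows "\<not> filterlim (\<lambda>n. hardy2_norm (model_kernel \<theta> (of_real (radii n) * \<zeta>))) at_top sequentially"
proof
  define w where "w n = of_real (radii n) * \<zeta>" for n
  have w: "norm (w n) < 1" for n using \<zeta> radii_bounds[of n] by (simp add: w_def norm_mult)
  assume "filterlim (\<lambda>n. hardy2_norm (model_kernel \<theta> (of_real (radii n) * \<zeta>))) at_top sequentially"
  hence unb: "filterlim (\<lambda>n. hardy2_norm (model_kernel \<theta> (w n))) at_top sequentially" by (simp add: w_def)
  define P where "P f S \<longleftrightarrow> f \<in> model_space \<theta> \<and> (\<forall>n\<in>S. f (w n) = 0)" for f and S :: "nat set"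
  have step: "\<exists>n>N. \<exists>g. P g (insert n S) \<and> hardy2_norm (\<lambda>z. g z - f z) < \<epsilon>"
    if "P f S" "finite S" "\<epsilon> > 0" for f S \<epsilon> N
  proof -
    have fK: "f \<in> model_space \<theta>" using that by (simp add: P_def)
    have "\<forall>\<^sub>F n in sequentially. \<exists>g\<in>model_space \<theta>. (\<forall>m\<in>S. g (w m) = 0) \<and> hardy2_norm g < \<epsilon> \<and> g (w n) = f (w n)"
      by (rule small_interpolant[OF \<theta> w unb that(2)]) (use that in \<open>auto simp: P_def\<close>)
    hence "\<forall>\<^sub>F n in sequentially. (\<exists>g\<in>model_space \<theta>. (\<forall>m\<in>S. g (w m) = 0) \<and> hardy2_norm g < \<epsilon> \<and> g (w n) = f (w n)) \<and> n > N"
      by (intro eventually_conj eventually_gt_at_top)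
    then obtain n g where n: "n > N" and g: "g \<in> model_space \<theta>" "\<forall>m\<in>S. g (w m) = 0" "hardy2_norm g < \<epsilon>" "g (w n) = f (w n)"
      by (auto simp: eventually_sequentially)
    have "P (\<lambda>z. f z - g z) (insert n S)"
      using g that by (auto simp: P_def intro!: model_space_diff \<theta>)
    moreover have "hardy2_norm (\<lambda>z. (f z - g z) - f z) < \<epsilon>"
      using g(3) hardy2_norm_cmult[OF model_spaceD(1)[OF g(1)], of "-1"] by simp
    ultimately show ?thesis using n by blast
  qed
  have "\<forall>\<^sub>F n in sequentially. hardy2_norm (model_kernel \<theta> (w n)) > 0"
    using unb by (simp add: filterlim_at_top_dense)
  then obtain n where n: "hardy2_norm (model_kernel \<theta> (w n)) > 0" by (auto simp: eventually_sequentially)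
  have P0: "P (model_kernel \<theta> (w n)) {}" using model_kernel(1)[OF \<theta> w] by (simp add: P_def)
  have PK: "f \<in> model_space \<theta> \<and> (\<forall>n\<in>S. f (w n) = 0)" if "P f S" for f S using that by (simp add: P_def)
  have "\<exists>(s :: nat \<Rightarrow> nat) F. strict_mono s \<and> F \<in> model_space \<theta> \<and> hardy2_norm F > 0 \<and> (\<forall>j. F (w (s j)) = 0)"
    by (rule vanishing_on_subsequence[where P = P, OF \<theta> w _ _ P0 n]) (fact PK step)+
  then obtain s :: "nat \<Rightarrow> nat" and F where s: "strict_mono s" and F: "F \<in> model_space \<theta>" "hardy2_norm F > 0" "\<And>j. F (w (s j)) = 0" by blast
  have "F z = 0" if "norm z < 1" for z
    using localization_imp_radial_overcomplete[OF \<theta> \<zeta> loc s F(1) _ that] F(3) by (simp add: w_def)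
  with F model_space_norm_pos[OF F(1)] show False by auto
qed

section \<open>Blaschke factors\<close>

text \<open>The quotient of a Blaschke factor by \<open>z - a\<close>, without zeros in the disc. The case distinction follows
  \<open>blaschke_factor\<close>, where the factor at the origin is \<open>z\<close> itself.\<close>

definition blaschke_unit :: "complex \<Rightarrow> complex \<Rightarrow> complex" where
  "blaschke_unit a z = (if a = 0 then 1 else - of_real (norm a) / a) / (1 - cnj a * z)"

lemma disc_denominator_nonzero:
  assumes "norm a < 1" "norm z < 1"
  shows "1 - cnj a * z \<noteq> 0"
proof
  assume "1 - cnj a * z = 0"
  hence "norm (cnj a * z) = 1" by (metis norm_one right_minus_eq)
  moreover have "norm (cnj a * z) < 1"
    using mult_strict_mono'[of "norm a" 1 "norm z" 1] assms by (simp add: norm_mult)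
  ultimately show False by simp
qed

lemma blaschke_factor_eq: "blaschke_factor a z = (z - a) * blaschke_unit a z"
proof (cases "a = 0 \<or> 1 - cnj a * z = 0")
  case False
  thus ?thesis by (auto simp: blaschke_factor_def blaschke_unit_def field_simps)
qed (auto simp: blaschke_factor_def blaschke_unit_def)

lemma blaschke_unit_nonzero: "norm a < 1 \<Longrightarrow> norm z < 1 \<Longrightarrow> blaschke_unit a z \<noteq> 0"
  using disc_denominator_nonzero[of a z] by (auto simp: blaschke_unit_def)

lemma holomorphic_blaschke_unit: "norm a < 1 \<Longrightarrow> blaschke_unit a holomorphic_on ball 0 1"
  unfolding blaschke_unit_def using disc_denominator_nonzero by (intro holomorphic_intros) auto

lemma holomorphic_blaschke_factor: "norm a < 1 \<Longrightarrow> blaschke_factor a holomorphic_on ball 0 1"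
  using holomorphic_blaschke_unit[of a] unfolding blaschke_factor_eq[abs_def] by (intro holomorphic_intros)

lemma blaschke_factor_eq_0_iff:
  "norm a < 1 \<Longrightarrow> norm z < 1 \<Longrightarrow> blaschke_factor a z = 0 \<longleftrightarrow> z = a"
  using blaschke_unit_nonzero[of a z] by (simp add: blaschke_factor_eq)

lemma norm_blaschke_factor: "norm (blaschke_factor a z) = norm (z - a) / norm (1 - cnj a * z)"
  by (auto simp: blaschke_factor_eq blaschke_unit_def norm_mult norm_divide)

lemma pseudohyperbolic_identity:
  "(norm (1 - cnj a * z))\<^sup>2 - (norm (z - a))\<^sup>2 = (1 - (norm a)\<^sup>2) * (1 - (norm z)\<^sup>2)"
  unfolding cmod_power2 by (simp add: algebra_simps power2_eq_square)

lemma one_minus_norm_blaschke_factor_sq: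
  assumes "norm a < 1" "norm z < 1"
  shows "1 - (norm (blaschke_factor a z))\<^sup>2 = (1 - (norm a)\<^sup>2) * (1 - (norm z)\<^sup>2) / (norm (1 - cnj a * z))\<^sup>2"
  using disc_denominator_nonzero[OF assms] pseudohyperbolic_identity[of a z]
  by (simp add: norm_blaschke_factor power_divide field_simps)

lemma norm_blaschke_factor_less_1:
  assumes "norm a < 1" "norm z < 1"
  shows "norm (blaschke_factor a z) < 1"
proof -
  have "(1 - (norm a)\<^sup>2) * (1 - (norm z)\<^sup>2) / (norm (1 - cnj a * z))\<^sup>2 > 0"
    using disc_denominator_nonzero[OF assms] assms by (intro divide_pos_pos mult_pos_pos) (auto simp: abs_square_less_1)
  hence "(norm (blaschke_factor a z))\<^sup>2 < 1" using one_minus_norm_blaschke_factor_sq[OF assms] by simp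
  thus ?thesis by (simp add: abs_square_less_1)
qed

text \<open>The numerator of \<open>blaschke_factor a z - 1\<close> is divisible by \<open>1 - norm a\<close>; this is what the normalizing
  constant \<open>norm a / a\<close> is for. Hence Blaschke products converge under the Blaschke condition.\<close>

lemma one_minus_blaschke_factor:
  assumes "norm a < 1" "norm z < 1"
  shows "norm (blaschke_factor a z - 1) \<le> 2 / (1 - norm z) * (1 - (norm a)\<^sup>2)"
proof -
  have "norm (blaschke_factor a z - 1) \<le> (1 + norm z) * (1 - norm a) / (1 - norm z)"
  proof (cases "a = 0")
    case True
    have "norm (z - 1) \<le> (1 + norm z) * 1" using norm_triangle_ineq4[of z 1] by simp
    also have "\<dots> \<le> (1 + norm z) * (1 / (1 - norm z))"
      using assms by (intro mult_left_mono) auto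
    finally show ?thesis using True by (simp add: blaschke_factor_def)
  next
    case False
    note d = disc_denominator_nonzero[OF assms]
    have aa: "a * cnj a = of_real (norm a) * of_real (norm a)"
      using complex_norm_square[of a] by (simp add: power2_eq_square)
    have "(blaschke_factor a z - 1) * (a * (1 - cnj a * z)) = of_real (norm a) * (a - z) - a * (1 - cnj a * z)"
      using False d by (simp add: blaschke_factor_def field_simps)
    also have "\<dots> = of_real (norm a) * (a - z) - a + (a * cnj a) * z" by (simp add: algebra_simps)
    also have "\<dots> = - ((a + of_real (norm a) * z) * of_real (1 - norm a))"
      unfolding aa by (simp add: algebra_simps)
    finally have "norm ((blaschke_factor a z - 1) * (a * (1 - cnj a * z))) = norm (a + of_real (norm a) * z) * (1 - norm a)"
      using assms by (simp only: norm_minus_cancel norm_mult norm_of_real)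
    also have "\<dots> \<le> (norm a + norm a * norm z) * (1 - norm a)"
      using assms norm_triangle_ineq[of a "of_real (norm a) * z"] by (intro mult_right_mono) (auto simp: norm_mult)
    also have "\<dots> = (1 + norm z) * (1 - norm a) * norm a" by (simp add: algebra_simps)
    also have "norm ((blaschke_factor a z - 1) * (a * (1 - cnj a * z))) =
        norm (blaschke_factor a z - 1) * norm (1 - cnj a * z) * norm a"
      by (simp only: norm_mult mult.assoc mult.commute[of "norm a"])
    finally have "norm (blaschke_factor a z - 1) * norm (1 - cnj a * z) * norm a \<le> (1 + norm z) * (1 - norm a) * norm a" .
    hence 1: "norm (blaschke_factor a z - 1) * norm (1 - cnj a * z) \<le> (1 + norm z) * (1 - norm a)"
      using False by simp
    have "norm (cnj a * z) \<le> 1 * norm z"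
      unfolding norm_mult complex_mod_cnj using assms by (intro mult_right_mono) auto
    hence "1 - norm z \<le> norm (1 - cnj a * z)" using norm_triangle_ineq2[of 1 "cnj a * z"] by simp
    hence "norm (blaschke_factor a z - 1) * (1 - norm z) \<le> norm (blaschke_factor a z - 1) * norm (1 - cnj a * z)"
      by (intro mult_left_mono) auto
    with 1 have "norm (blaschke_factor a z - 1) * (1 - norm z) \<le> (1 + norm z) * (1 - norm a)" by linarith
    thus ?thesis using assms by (simp add: pos_le_divide_eq)
  qed
  also have "\<dots> \<le> 2 * (1 - (norm a)\<^sup>2) / (1 - norm z)"
  proof (intro divide_right_mono mult_mono)
    have "(norm a)\<^sup>2 \<le> norm a" using assms by (simp add: power2_eq_square mult_left_le)
    thus "1 - norm a \<le> 1 - (norm a)\<^sup>2" by simp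
  qed (use assms in auto)
  finally show ?thesis by simp
qed

text \<open>The Schwarz lemma, transported to \<open>a\<close> by a Moebius map. The factor \<open>t < 1\<close> makes the bound for \<open>g\<close>
  strict.\<close>

lemma schwarz_at:
  assumes g: "g holomorphic_on ball 0 1" "\<And>z. norm z < 1 \<Longrightarrow> norm (g z) \<le> 1"
    and a: "norm a < 1" "g a = 0" and z: "norm z < 1"
  shows "norm (g z) \<le> norm (blaschke_factor a z)"
proof -
  let ?M = "Moebius_function 0"
  have ma: "norm (- a) < 1" using a by simp
  have nb: "norm (?M a z) = norm (blaschke_factor a z)" for z
    by (simp add: norm_blaschke_factor Moebius_function_simple norm_divide)
  have "t * norm (g z) \<le> norm (blaschke_factor a z)" if t: "0 < t" "t < 1" for t
  proof -
    define G where "G u = of_real t * g (?M (-a) u)" for u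
    have lt: "norm (?M (-a) u) < 1" if "norm u < 1" for u
      by (rule Moebius_function_norm_lt_1[OF ma that])
    have "(g \<circ> ?M (-a)) holomorphic_on ball 0 1"
      using lt by (intro holomorphic_on_compose_gen[OF Moebius_function_holomorphic[OF ma] g(1)]) auto
    hence hol: "G holomorphic_on ball 0 1" unfolding G_def comp_def by (intro holomorphic_intros)
    have G0: "G 0 = 0" using a by (simp add: G_def Moebius_function_of_zero)
    have no: "norm (G u) < 1" if "norm u < 1" for u
    proof -
      have "norm (G u) \<le> t * 1" unfolding G_def norm_mult using g(2)[OF lt[OF that]] t by (intro mult_mono) auto
      with t show ?thesis by simp
    qed
    have 1: "norm (?M a z) < 1" by (rule Moebius_function_norm_lt_1[OF a(1) z])
    have "norm (G (?M a z)) \<le> norm (?M a z)" by (rule Schwarz_Lemma(1)[OF hol G0 no 1])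
    moreover have "?M (-a) (?M a z) = z" by (rule Moebius_function_compose) (use a z in auto)
    ultimately show ?thesis using t by (simp add: G_def nb norm_mult)
  qed
  hence "\<forall>\<^sub>F k in sequentially. radii k * norm (g z) \<le> norm (blaschke_factor a z)"
    using radii_bounds by (intro always_eventually allI) blast
  moreover have "(\<lambda>k. radii k * norm (g z)) \<longlonglongrightarrow> 1 * norm (g z)"
    by (intro tendsto_intros radii_tendsto)
  ultimately show ?thesis using tendsto_upperbound by fastforce
qed

lemma divide_blaschke_factor:
  assumes g: "g holomorphic_on ball 0 1" "\<And>z. norm z < 1 \<Longrightarrow> norm (g z) \<le> 1"
    and a: "norm a < 1" "g a = 0"
  obtains h where "h holomorphic_on ball 0 1" "\<And>z. norm z < 1 \<Longrightarrow> norm (h z) \<le> 1"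
    "\<And>z. norm z < 1 \<Longrightarrow> g z = blaschke_factor a z * h z"
proof -
  define k where "k z = (if z = a then deriv g a else (g z - g a) / (z - a))" for z
  have k: "k holomorphic_on ball 0 1"
    unfolding k_def[abs_def] using a by (intro pole_lemma g) auto
  define h where "h z = k z / blaschke_unit a z" for z
  have h: "h holomorphic_on ball 0 1"
    unfolding h_def[abs_def] using k holomorphic_blaschke_unit[OF a(1)] blaschke_unit_nonzero[OF a(1)]
    by (intro holomorphic_intros) auto
  have eq: "g z = blaschke_factor a z * h z" if "norm z < 1" for z
    using blaschke_unit_nonzero[OF a(1) that] a by (simp add: blaschke_factor_eq h_def k_def)
  have le: "norm (h z) \<le> 1" if z: "norm z < 1" "z \<noteq> a" for z
  proof -
    have "norm (blaschke_factor a z) * norm (h z) \<le> norm (blaschke_factor a z) * 1"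
      using schwarz_at[OF g a z(1)] eq[OF z(1)] by (simp add: norm_mult)
    moreover have "norm (blaschke_factor a z) > 0" using blaschke_factor_eq_0_iff[OF a(1) z(1)] z(2) by simp
    ultimately show ?thesis by (rule mult_left_le_imp_le)
  qed
  have "norm (h a) \<le> 1"
  proof (rule tendsto_upperbound)
    have "isCont h a"
      using holomorphic_on_imp_continuous_on[OF h] a(1) by (simp add: continuous_on_eq_continuous_at)
    thus "((\<lambda>z. norm (h z)) \<longlongrightarrow> norm (h a)) (at a)" by (intro tendsto_intros) (simp add: isCont_def)
    have "\<forall>\<^sub>F z in at a. z \<in> ball 0 1" using a(1) by (intro eventually_at_in_open') auto
    moreover have "\<forall>\<^sub>F z in at a. z \<noteq> a" by (rule eventually_neq_at_within)
    ultimately show "\<forall>\<^sub>F z in at a. norm (h z) \<le> 1" by eventually_elim (use le in simp)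
  qed simp
  with le have "norm (h z) \<le> 1" if "norm z < 1" for z using that by (cases "z = a") auto
  thus ?thesis using that h eq by blast
qed

text \<open>If \<open>a\<close> remained a zero after any number of divisions, \<open>norm (g z)\<close> would be bounded by every power of
  \<open>norm (blaschke_factor a z)\<close>, and \<open>g\<close> would be zero.\<close>

lemma divide_blaschke_power:
  assumes g: "g holomorphic_on ball 0 1" "\<And>z. norm z < 1 \<Longrightarrow> norm (g z) \<le> 1"
    and a: "norm a < 1" and z0: "norm z0 < 1" "g z0 \<noteq> 0"
  obtains n h where "h holomorphic_on ball 0 1" "\<And>z. norm z < 1 \<Longrightarrow> norm (h z) \<le> 1" "h a \<noteq> 0"
    "\<And>z. norm z < 1 \<Longrightarrow> g z = blaschke_factor a z ^ n * h z"
proof -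
  define Q where "Q n h \<longleftrightarrow> h holomorphic_on ball 0 1 \<and> (\<forall>z. norm z < 1 \<longrightarrow> norm (h z) \<le> 1) \<and>
     (\<forall>z. norm z < 1 \<longrightarrow> g z = blaschke_factor a z ^ n * h z)" for n h
  have "\<exists>n h. Q n h \<and> h a \<noteq> 0"
  proof (rule ccontr)
    assume neg: "\<not> ?thesis"
    have "\<exists>h. Q n h" for n
    proof (induction n)
      case 0
      show ?case using g by (intro exI[of _ g]) (simp add: Q_def)
    next
      case (Suc n)
      then obtain h where h: "Q n h" by blast
      with neg have ha: "h a = 0" by blast
      obtain h' where h': "h' holomorphic_on ball 0 1" "\<And>z. norm z < 1 \<Longrightarrow> norm (h' z) \<le> 1"
        "\<And>z. norm z < 1 \<Longrightarrow> h z = blaschke_factor a z * h' z"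
        using divide_blaschke_factor[of h a] h a ha by (auto simp: Q_def)
      thus ?case using h by (intro exI[of _ h']) (auto simp: Q_def)
    qed
    hence "norm (g z0) \<le> norm (blaschke_factor a z0) ^ n" for n
    proof -
      obtain h where h: "Q n h" using \<open>\<And>n. \<exists>h. Q n h\<close> by blast
      hence "norm (g z0) = norm (blaschke_factor a z0) ^ n * norm (h z0)"
        using z0 by (simp add: Q_def norm_mult norm_power)
      also have "\<dots> \<le> norm (blaschke_factor a z0) ^ n * 1"
        using h z0 by (intro mult_left_mono) (auto simp: Q_def)
      finally show ?thesis by simp
    qed
    moreover have "(\<lambda>n. norm (blaschke_factor a z0) ^ n) \<longlonglongrightarrow> 0"
      using norm_blaschke_factor_less_1[OF a z0(1)] by (intro LIMSEQ_power_zero) simp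
    ultimately have "norm (g z0) \<le> 0" by (intro tendsto_lowerbound[OF _ always_eventually]) auto
    with z0 show False by simp
  qed
  thus ?thesis using that unfolding Q_def by metis
qed

section \<open>Dividing an inner function by its Blaschke product\<close>

definition partial_blaschke :: "(complex \<Rightarrow> complex) \<Rightarrow> complex set \<Rightarrow> complex \<Rightarrow> complex" where
  "partial_blaschke \<theta> F z = (\<Prod>a\<in>F. blaschke_factor a z ^ zero_mult \<theta> a)"

lemma partial_blaschke_Un:
  "finite F \<Longrightarrow> finite G \<Longrightarrow> F \<inter> G = {} \<Longrightarrow> partial_blaschke \<theta> (F \<union> G) z = partial_blaschke \<theta> F z * partial_blaschke \<theta> G z"
  unfolding partial_blaschke_def by (rule prod.union_disjoint)

lemma partial_blaschke_le_1:
  assumes "F \<subseteq> ball 0 1" "norm z < 1"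
  shows "norm (partial_blaschke \<theta> F z) \<le> 1"
proof -
  have "norm (blaschke_factor a z) \<le> 1" if "a \<in> F" for a
    using norm_blaschke_factor_less_1[of a z] assms that by (auto intro: less_imp_le)
  thus ?thesis
    unfolding partial_blaschke_def prod_norm[symmetric] norm_power
    by (intro prod_le_1 conjI power_le_one) auto
qed

lemma zero_mult_eqI:
  assumes a: "norm a < 1" and k: "k holomorphic_on ball 0 1" "k a \<noteq> 0"
    and eq: "\<And>z. norm z < 1 \<Longrightarrow> \<theta> z = blaschke_factor a z ^ n * k z"
  shows "zero_mult \<theta> a = n"
proof -
  have "zorder \<theta> a = int n"
  proof (rule zorder_eqI)
    show "(\<lambda>z. blaschke_unit a z ^ n * k z) holomorphic_on ball 0 1"
      using k holomorphic_blaschke_unit[OF a] by (intro holomorphic_intros)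
    show "blaschke_unit a a ^ n * k a \<noteq> 0" using k blaschke_unit_nonzero[OF a a] by simp
    show "\<theta> w = blaschke_unit a w ^ n * k w * (w - a) powi int n" if "w \<in> ball 0 1" for w
      using eq[of w] that by (simp add: blaschke_factor_eq power_mult_distrib power_int_of_nat)
  qed (use a in auto)
  thus ?thesis by (simp add: zero_mult_def)
qed

text \<open>The zeros in \<open>T\<close> are divided out one at a time. The number of divisions possible at a point is its
  multiplicity as a zero of \<open>\<theta>\<close>, since the factors divided out before do not vanish there. Starting from
  the quotient \<open>g\<close> left by the zeros in \<open>S\<close> keeps successive quotients compatible.\<close>

lemma divide_partial_blaschke:
  assumes z0: "norm z0 < 1" "\<theta> z0 \<noteq> 0" and S: "finite S" "S \<subseteq> ball 0 1"
    and g: "g holomorphic_on ball 0 1" "\<And>z. norm z < 1 \<Longrightarrow> norm (g z) \<le> 1" "\<And>a. a \<in> S \<Longrightarrow> g a \<noteq> 0"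
      "\<And>z. norm z < 1 \<Longrightarrow> \<theta> z = partial_blaschke \<theta> S z * g z"
    and T: "finite T" "T \<subseteq> ball 0 1" "S \<inter> T = {}"
  shows "\<exists>h. h holomorphic_on ball 0 1 \<and> (\<forall>z. norm z < 1 \<longrightarrow> norm (h z) \<le> 1) \<and> (\<forall>a\<in>S \<union> T. h a \<noteq> 0) \<and>
     (\<forall>z. norm z < 1 \<longrightarrow> g z = partial_blaschke \<theta> T z * h z)"
  using T
proof (induction T rule: finite_induct)
  case empty
  show ?case using g by (intro exI[of _ g]) (auto simp: partial_blaschke_def)
next
  case (insert a T)
  then obtain h where h: "h holomorphic_on ball 0 1" "\<And>z. norm z < 1 \<Longrightarrow> norm (h z) \<le> 1" "\<forall>a\<in>S \<union> T. h a \<noteq> 0"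
     "\<And>z. norm z < 1 \<Longrightarrow> g z = partial_blaschke \<theta> T z * h z" by auto
  have a: "norm a < 1" "a \<notin> S \<union> T" and ST: "S \<union> T \<subseteq> ball 0 1" "finite (S \<union> T)" "S \<inter> T = {}"
    using insert S by auto
  have "h z0 \<noteq> 0" using g(4)[OF z0(1)] h(4)[OF z0(1)] z0(2) by auto
  then obtain n k where k: "k holomorphic_on ball 0 1" "\<And>z. norm z < 1 \<Longrightarrow> norm (k z) \<le> 1" "k a \<noteq> 0"
    "\<And>z. norm z < 1 \<Longrightarrow> h z = blaschke_factor a z ^ n * k z"
    using divide_blaschke_power[OF h(1,2) a(1) z0(1)] by metis
  have m: "zero_mult \<theta> a = n"
  proof (rule zero_mult_eqI[OF a(1)])
    show "(\<lambda>z. partial_blaschke \<theta> (S \<union> T) z * k z) holomorphic_on ball 0 1"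
      unfolding partial_blaschke_def
      using ST k by (intro holomorphic_intros holomorphic_blaschke_factor) auto
    have "partial_blaschke \<theta> (S \<union> T) a \<noteq> 0"
      unfolding partial_blaschke_def using ST a blaschke_factor_eq_0_iff[of _ a] by (force simp: subset_eq)
    thus "partial_blaschke \<theta> (S \<union> T) a * k a \<noteq> 0" using k by simp
    show "\<theta> z = blaschke_factor a z ^ n * (partial_blaschke \<theta> (S \<union> T) z * k z)" if "norm z < 1" for z
      using g(4)[OF that] h(4)[OF that] k(4)[OF that] ST by (simp add: partial_blaschke_Un algebra_simps)
  qed
  have "k c \<noteq> 0" if "c \<in> S \<union> insert a T" for c
  proof (cases "c = a")
    case False
    hence "c \<in> S \<union> T" using that by auto
    hence "h c \<noteq> 0" "norm c < 1" using h(3) ST by auto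
    thus ?thesis using k(4)[of c] by auto
  qed (use k in simp)
  moreover have "g z = partial_blaschke \<theta> (insert a T) z * k z" if "norm z < 1" for z
    using h(4)[OF that] k(4)[OF that] insert.hyps m by (simp add: partial_blaschke_def algebra_simps)
  ultimately show ?case using k by blast
qed

text \<open>From \<open>2 ln x \<le> x\<^sup>2 - 1\<close>, applied to each factor.\<close>

lemma blaschke_log_sum_le:
  assumes F: "finite F" "F \<subseteq> ball 0 1" and z: "norm z < 1" and u: "0 < u" "u \<le> norm (partial_blaschke \<theta> F z)"
  shows "(\<Sum>a\<in>F. real (zero_mult \<theta> a) * (1 - (norm (blaschke_factor a z))\<^sup>2)) \<le> - 2 * ln u"
proof -
  let ?B = "\<lambda>a. norm (blaschke_factor a z)"
  have ne: "?B a ^ zero_mult \<theta> a > 0" if "a \<in> F" for a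
  proof -
    have "(\<Prod>a\<in>F. blaschke_factor a z ^ zero_mult \<theta> a) \<noteq> 0" using u by (auto simp: partial_blaschke_def)
    hence "blaschke_factor a z ^ zero_mult \<theta> a \<noteq> 0" using F(1) that by auto
    thus ?thesis by (metis norm_power zero_less_norm_iff)
  qed
  have "ln u \<le> ln (\<Prod>a\<in>F. ?B a ^ zero_mult \<theta> a)"
    using u by (simp add: partial_blaschke_def prod_norm[symmetric] norm_power)
  also have "\<dots> = (\<Sum>a\<in>F. ln (?B a ^ zero_mult \<theta> a))"
    by (intro ln_prod F(1)) (use ne in \<open>metis less_irrefl\<close>)
  also have "\<dots> \<le> (\<Sum>a\<in>F. real (zero_mult \<theta> a) * (((?B a)\<^sup>2 - 1) / 2))"
  proof (rule sum_mono)
    fix a assume a: "a \<in> F"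
    show "ln (?B a ^ zero_mult \<theta> a) \<le> real (zero_mult \<theta> a) * (((?B a)\<^sup>2 - 1) / 2)"
    proof (cases "zero_mult \<theta> a = 0")
      case False
      hence pos: "?B a > 0" using ne[OF a] by (cases "?B a = 0") (auto simp: zero_power)
      have "ln (?B a) \<le> ((?B a)\<^sup>2 - 1) / 2"
        using ln_le_minus_one[of "(?B a)\<^sup>2"] pos by (simp add: ln_realpow)
      thus ?thesis unfolding ln_realpow by (rule mult_left_mono) simp
    qed simp
  qed
  also have "\<dots> = - (\<Sum>a\<in>F. real (zero_mult \<theta> a) * (1 - (?B a)\<^sup>2)) / 2"
    by (simp add: sum_negf[symmetric] sum_divide_distrib algebra_simps)
  finally show ?thesis by simp
qed

text \<open>All finite partial products are at least \<open>norm (\<theta> z0)\<close> at a point where \<open>\<theta>\<close> does not vanish.\<close>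

lemma blaschke_condition:
  assumes \<theta>: "\<theta> holomorphic_on ball 0 1" "\<And>z. norm z < 1 \<Longrightarrow> norm (\<theta> z) \<le> 1"
    and z0: "norm z0 < 1" "\<theta> z0 \<noteq> 0"
  shows "(\<lambda>a. real (zero_mult \<theta> a) * (1 - (norm a)\<^sup>2)) summable_on disc_zeros \<theta>"
proof (rule nonneg_bdd_above_summable_on)
  show "real (zero_mult \<theta> a) * (1 - (norm a)\<^sup>2) \<ge> 0" if "a \<in> disc_zeros \<theta>" for a
    using that by (auto simp: disc_zeros_def abs_square_le_1)
  define K where "K = 4 / (1 - (norm z0)\<^sup>2) * (- 2 * ln (norm (\<theta> z0)))"
  have q: "1 - (norm z0)\<^sup>2 > 0" using z0 by (simp add: abs_square_less_1)
  show "bdd_above (sum (\<lambda>a. real (zero_mult \<theta> a) * (1 - (norm a)\<^sup>2)) ` {F. F \<subseteq> disc_zeros \<theta> \<and> finite F})"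
  proof (rule bdd_aboveI2[of _ _ K])
    fix F assume "F \<in> {F. F \<subseteq> disc_zeros \<theta> \<and> finite F}"
    hence F: "finite F" "F \<subseteq> ball 0 1" by (auto simp: disc_zeros_def)
    obtain h where h: "\<forall>z. norm z < 1 \<longrightarrow> norm (h z) \<le> 1" "\<forall>z. norm z < 1 \<longrightarrow> \<theta> z = partial_blaschke \<theta> F z * h z"
      using divide_partial_blaschke[of z0 \<theta> "{}" \<theta> F, OF z0] \<theta> F by (auto simp: partial_blaschke_def)
    have "norm (\<theta> z0) \<le> norm (partial_blaschke \<theta> F z0) * 1"
      using h z0 by (simp add: norm_mult mult_left_le)
    hence "(\<Sum>a\<in>F. real (zero_mult \<theta> a) * (1 - (norm (blaschke_factor a z0))\<^sup>2)) \<le> - 2 * ln (norm (\<theta> z0))"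
      using z0 by (intro blaschke_log_sum_le F) auto
    have le: "(1 - (norm a)\<^sup>2) \<le> 4 / (1 - (norm z0)\<^sup>2) * (1 - (norm (blaschke_factor a z0))\<^sup>2)" if "a \<in> F" for a
    proof -
      have a: "norm a < 1" using that F by auto
      have "norm (cnj a * z0) \<le> 1 * 1"
        unfolding norm_mult complex_mod_cnj using a z0 by (intro mult_mono) auto
      hence "norm (1 - cnj a * z0) \<le> 2" using norm_triangle_ineq4[of 1 "cnj a * z0"] by simp
      hence "(norm (1 - cnj a * z0))\<^sup>2 \<le> 2\<^sup>2" by (intro power_mono) auto
      moreover have "0 \<le> 1 - (norm a)\<^sup>2" using a by (simp add: abs_square_le_1)
      ultimately have "(1 - (norm a)\<^sup>2) * (norm (1 - cnj a * z0))\<^sup>2 \<le> (1 - (norm a)\<^sup>2) * 4"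
        by (intro mult_left_mono) auto
      moreover have "(norm (1 - cnj a * z0))\<^sup>2 > 0" using disc_denominator_nonzero[OF a z0(1)] by simp
      ultimately have "1 - (norm a)\<^sup>2 \<le> 4 * (1 - (norm a)\<^sup>2) / (norm (1 - cnj a * z0))\<^sup>2"
        by (simp add: pos_le_divide_eq mult.commute)
      moreover have "4 / q * (A * q / D) = 4 * A / D" if "q > 0" for q A D :: real using that by simp
      ultimately show ?thesis
        unfolding one_minus_norm_blaschke_factor_sq[OF a z0(1)] using q by metis
    qed
    have "(\<Sum>a\<in>F. real (zero_mult \<theta> a) * (1 - (norm a)\<^sup>2)) \<le>
      (\<Sum>a\<in>F. real (zero_mult \<theta> a) * (4 / (1 - (norm z0)\<^sup>2) * (1 - (norm (blaschke_factor a z0))\<^sup>2)))"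
      using le by (intro sum_mono mult_left_mono) auto
    also have "\<dots> = 4 / (1 - (norm z0)\<^sup>2) * (\<Sum>a\<in>F. real (zero_mult \<theta> a) * (1 - (norm (blaschke_factor a z0))\<^sup>2))"
      by (simp add: sum_distrib_left mult.left_commute)
    also have "\<dots> \<le> K" unfolding K_def
      using q \<open>_ \<le> - 2 * ln (norm (\<theta> z0))\<close> by (intro mult_left_mono) auto
    finally show "(\<Sum>a\<in>F. real (zero_mult \<theta> a) * (1 - (norm a)\<^sup>2)) \<le> K" .
  qed
qed

lemma summable_on_small_tail:
  fixes t :: "'a \<Rightarrow> real"
  assumes "t summable_on A" "\<And>a. a \<in> A \<Longrightarrow> t a \<ge> 0" "\<epsilon> > 0"
  obtains F where "finite F" "F \<subseteq> A" "\<And>G. finite G \<Longrightarrow> G \<subseteq> A - F \<Longrightarrow> sum t G \<le> \<epsilon>"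
proof -
  have "(sum t \<longlongrightarrow> infsum t A) (finite_subsets_at_top A)"
    using has_sum_infsum[OF assms(1)] by (simp add: has_sum_def)
  hence "\<forall>\<^sub>F F in finite_subsets_at_top A. dist (sum t F) (infsum t A) < \<epsilon>"
    using assms(3) by (rule tendstoD)
  then obtain F where F: "finite F" "F \<subseteq> A" "dist (sum t F) (infsum t A) < \<epsilon>"
    by (auto simp: eventually_finite_subsets_at_top)
  have "sum t G \<le> \<epsilon>" if G: "finite G" "G \<subseteq> A - F" for G
  proof -
    have "sum t (F \<union> G) \<le> infsum t A"
      using F G assms by (intro finite_sum_le_infsum) auto
    moreover have "sum t (F \<union> G) = sum t F + sum t G"
      using F G by (intro sum.union_disjoint) auto
    ultimately show ?thesis using F(3) by (simp add: dist_real_def)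
  qed
  with F that show ?thesis by blast
qed

text \<open>For factors in the closed unit disc, the distance of a product from one is at most the sum of the
  distances of its factors.\<close>

lemma partial_blaschke_minus_1:
  assumes "F \<subseteq> ball 0 1" "norm z < 1"
  shows "norm (partial_blaschke \<theta> F z - 1) \<le> 2 / (1 - norm z) * (\<Sum>a\<in>F. real (zero_mult \<theta> a) * (1 - (norm a)\<^sup>2))"
proof -
  have le1: "norm (blaschke_factor a z) \<le> 1" if "a \<in> F" for a
    using norm_blaschke_factor_less_1[of a z] assms that by (auto intro: less_imp_le)
  have "norm (partial_blaschke \<theta> F z - (\<Prod>a\<in>F. 1)) \<le> (\<Sum>a\<in>F. norm (blaschke_factor a z ^ zero_mult \<theta> a - 1))"
    unfolding partial_blaschke_def using le1 by (intro norm_prod_diff) (auto simp: norm_power power_le_one)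
  also have "\<dots> \<le> (\<Sum>a\<in>F. real (zero_mult \<theta> a) * (2 / (1 - norm z) * (1 - (norm a)\<^sup>2)))"
  proof (rule sum_mono)
    fix a assume a: "a \<in> F"
    have "norm (blaschke_factor a z ^ zero_mult \<theta> a - 1 ^ zero_mult \<theta> a) \<le> zero_mult \<theta> a * norm (blaschke_factor a z - 1)"
      using le1[OF a] by (intro norm_power_diff) auto
    also have "\<dots> \<le> real (zero_mult \<theta> a) * (2 / (1 - norm z) * (1 - (norm a)\<^sup>2))"
      using a assms by (intro mult_left_mono one_minus_blaschke_factor) auto
    finally show "norm (blaschke_factor a z ^ zero_mult \<theta> a - 1) \<le> real (zero_mult \<theta> a) * (2 / (1 - norm z) * (1 - (norm a)\<^sup>2))"
      by simp
  qed
  finally show ?thesis by (simp add: sum_distrib_left mult.left_commute)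
qed

text \<open>A cofinal sequence of finite sets along which the tails of \<open>t\<close> decay geometrically. Positivity of \<open>t\<close>
  forces every element of \<open>Z\<close> to be reached.\<close>

lemma exhausting_zeros:
  assumes s: "t summable_on Z" "\<And>a. a \<in> Z \<Longrightarrow> t a > (0::real)"
  shows "\<exists>G :: nat \<Rightarrow> 'a set. incseq G \<and> (\<forall>n. finite (G n)) \<and> (\<forall>n. G n \<subseteq> Z) \<and> (\<Union>n. G n) = Z \<and>
    (\<forall>n F. finite F \<longrightarrow> F \<subseteq> Z - G n \<longrightarrow> sum t F \<le> (1/2) ^ n)"
proof -
  have "\<exists>F. finite F \<and> F \<subseteq> Z \<and> (\<forall>G. finite G \<longrightarrow> G \<subseteq> Z - F \<longrightarrow> sum t G \<le> (1/2) ^ n)" for n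
  proof -
    have "(0::real) < (1/2) ^ n" by simp
    from summable_on_small_tail[OF s(1) less_imp_le[OF s(2)] this] show ?thesis by metis
  qed
  then obtain H where H: "\<And>n. finite (H n)" "\<And>n. H n \<subseteq> Z" "\<And>n F. finite F \<Longrightarrow> F \<subseteq> Z - H n \<Longrightarrow> sum t F \<le> (1/2) ^ n"
    by metis
  define G where "G n = (\<Union>k\<le>n. H k)" for n
  show ?thesis
  proof (intro exI conjI allI impI)
    show "incseq G" by (intro incseq_SucI) (auto simp: G_def atMost_Suc)
    show fin: "finite (G n)" for n using H(1) by (simp add: G_def)
    show sub: "G n \<subseteq> Z" for n using H(2) by (auto simp: G_def)
    have tail: "sum t F \<le> (1/2) ^ n" if "finite F" "F \<subseteq> Z - G n" for n F
      by (rule H(3)) (use that in \<open>auto simp: G_def\<close>)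
    thus "sum t F \<le> (1/2) ^ n" if "finite F" "F \<subseteq> Z - G n" for n F using that .
    have "a \<in> (\<Union>n. G n)" if a: "a \<in> Z" for a
    proof (rule ccontr)
      assume "a \<notin> (\<Union>n. G n)"
      hence "t a \<le> (1/2) ^ n" for n using tail[of "{a}" n] a by auto
      moreover have "(\<lambda>n. (1/2::real) ^ n) \<longlonglongrightarrow> 0" by (intro LIMSEQ_power_zero) simp
      ultimately have "t a \<le> 0" by (intro tendsto_lowerbound[OF _ always_eventually]) auto
      with s(2)[OF a] show False by simp
    qed
    thus "(\<Union>n. G n) = Z" using sub by auto
  qed
qed

text \<open>The quotients \<open>h n\<close> of \<open>\<theta>\<close> by the partial products over an exhaustion of the zeros are uniformly Cauchy
  on smaller discs, because \<open>h n = P * h m\<close> with a partial product \<open>P\<close> close to one. The same relation shows that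
  their limit \<open>g\<close> cannot vanish: where \<open>h n\<close> is not zero, \<open>norm (g z)\<close> is bounded below by a multiple of
  \<open>norm (h n z)\<close>. Dividing, the partial products converge, along the whole net of finite sets of
  zeros, to \<open>\<theta> / g\<close>.\<close>

lemma divide_blaschke_product:
  assumes \<theta>: "\<theta> holomorphic_on ball 0 1" "\<And>z. norm z < 1 \<Longrightarrow> norm (\<theta> z) \<le> 1"
    and z0: "norm z0 < 1" "\<theta> z0 \<noteq> 0"
  obtains g where "g holomorphic_on ball 0 1" "\<And>z. norm z < 1 \<Longrightarrow> norm (g z) \<le> 1" "\<And>z. norm z < 1 \<Longrightarrow> g z \<noteq> 0"
    "\<And>z. norm z < 1 \<Longrightarrow> \<theta> z = blaschke_product \<theta> z * g z"
    "\<And>z F. norm z < 1 \<Longrightarrow> finite F \<Longrightarrow> F \<subseteq> disc_zeros \<theta> \<Longrightarrow> norm (blaschke_product \<theta> z) \<le> norm (partial_blaschke \<theta> F z)"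
proof -
  let ?Z = "disc_zeros \<theta>"
  let ?P = "partial_blaschke \<theta>"
  define t where "t a = real (zero_mult \<theta> a) * (1 - (norm a)\<^sup>2)" for a
  have Z: "?Z \<subseteq> ball 0 1" by (auto simp: disc_zeros_def)
  have t_pos: "t a > 0" if a: "a \<in> ?Z" for a
  proof -
    have a1: "norm a < 1" "\<theta> a = 0" using a by (auto simp: disc_zeros_def)
    obtain h where h: "\<forall>c\<in>{} \<union> {a}. h c \<noteq> 0" "\<forall>z. norm z < 1 \<longrightarrow> \<theta> z = ?P {a} z * h z"
      using divide_partial_blaschke[of z0 \<theta> "{}" \<theta> "{a}", OF z0] \<theta> a1(1) by (auto simp: partial_blaschke_def)
    have "?P {a} a = 0" using h a1 by auto
    hence "zero_mult \<theta> a \<noteq> 0" by (cases "zero_mult \<theta> a = 0") (auto simp: partial_blaschke_def)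
    thus ?thesis using a1 by (simp add: t_def abs_square_less_1)
  qed
  have "t summable_on ?Z" unfolding t_def by (rule blaschke_condition[OF \<theta> z0])
  then obtain G where G: "incseq G" "\<And>n. finite (G n)" "\<And>n. G n \<subseteq> ?Z" "(\<Union>n. G n) = ?Z"
    and tail: "\<And>n F. finite F \<Longrightarrow> F \<subseteq> ?Z - G n \<Longrightarrow> sum t F \<le> (1/2) ^ n"
    using exhausting_zeros[of t ?Z] t_pos by auto
  define Q where "Q n h \<longleftrightarrow> h holomorphic_on ball 0 1 \<and> (\<forall>z. norm z < 1 \<longrightarrow> norm (h z) \<le> 1) \<and> (\<forall>a\<in>G n. h a \<noteq> 0) \<and>
     (\<forall>z. norm z < 1 \<longrightarrow> \<theta> z = ?P (G n) z * h z)" for n h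
  have "\<exists>h. \<forall>n. Q n (h n) \<and> (\<forall>z. norm z < 1 \<longrightarrow> h n z = ?P (G (Suc n) - G n) z * h (Suc n) z)"
  proof (rule dependent_nat_choice)
    have "\<exists>h. h holomorphic_on ball 0 1 \<and> (\<forall>z. norm z < 1 \<longrightarrow> norm (h z) \<le> 1) \<and> (\<forall>a\<in>{} \<union> G 0. h a \<noteq> 0) \<and>
     (\<forall>z. norm z < 1 \<longrightarrow> \<theta> z = ?P (G 0) z * h z)"
      by (rule divide_partial_blaschke[of z0 \<theta> "{}" \<theta>, OF z0]) (use \<theta> G(2)[of 0] G(3)[of 0] Z in \<open>auto simp: partial_blaschke_def\<close>)
    thus "\<exists>h. Q 0 h" by (simp add: Q_def)
    fix h n assume h: "Q n h"
    have mono: "G n \<subseteq> G (Suc n)" using G(1) by (simp add: incseq_SucD)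
    have "\<exists>h'. h' holomorphic_on ball 0 1 \<and> (\<forall>z. norm z < 1 \<longrightarrow> norm (h' z) \<le> 1) \<and> (\<forall>a\<in>G n \<union> (G (Suc n) - G n). h' a \<noteq> 0) \<and>
     (\<forall>z. norm z < 1 \<longrightarrow> h z = ?P (G (Suc n) - G n) z * h' z)"
      by (rule divide_partial_blaschke[of z0 \<theta> "G n" h, OF z0])
        (use h G(2)[of n] G(2)[of "Suc n"] G(3)[of n] G(3)[of "Suc n"] Z in \<open>auto simp: Q_def\<close>)
    then obtain h' where h': "h' holomorphic_on ball 0 1" "\<forall>z. norm z < 1 \<longrightarrow> norm (h' z) \<le> 1"
      "\<forall>a\<in>G n \<union> (G (Suc n) - G n). h' a \<noteq> 0" "\<forall>z. norm z < 1 \<longrightarrow> h z = ?P (G (Suc n) - G n) z * h' z" by blast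
    have "?P (G (Suc n)) z = ?P (G n) z * ?P (G (Suc n) - G n) z" for z
      using partial_blaschke_Un[of "G n" "G (Suc n) - G n" \<theta> z] G(2) mono by (simp add: Un_absorb1)
    thus "\<exists>h'. Q (Suc n) h' \<and> (\<forall>z. norm z < 1 \<longrightarrow> h z = ?P (G (Suc n) - G n) z * h' z)"
      using h h' mono by (intro exI[of _ h']) (auto simp: Q_def)
  qed
  then obtain h where hQ: "\<And>n. Q n (h n)"
    and hs: "\<And>n z. norm z < 1 \<Longrightarrow> h n z = ?P (G (Suc n) - G n) z * h (Suc n) z" by blast
  have h: "h n holomorphic_on ball 0 1" "norm z < 1 \<Longrightarrow> norm (h n z) \<le> 1" "a \<in> G n \<Longrightarrow> h n a \<noteq> 0"
     "norm z < 1 \<Longrightarrow> \<theta> z = ?P (G n) z * h n z" for n z a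
    using hQ[of n] by (auto simp: Q_def)
  have Gm: "G n \<subseteq> G m" if "n \<le> m" for n m using G(1) that by (simp add: incseqD)
  have chain: "h n z = ?P (G m - G n) z * h m z" if z: "norm z < 1" and "n \<le> m" for n m z
    using \<open>n \<le> m\<close>
  proof (induction m rule: dec_induct)
    case base
    show ?case by (simp add: partial_blaschke_def)
  next
    case (step m)
    have "G (Suc m) - G n = (G m - G n) \<union> (G (Suc m) - G m)"
      using Gm[of n m] Gm[of m "Suc m"] step by auto
    moreover have "(G m - G n) \<inter> (G (Suc m) - G m) = {}" by auto
    ultimately have "?P (G (Suc m) - G n) z = ?P (G m - G n) z * ?P (G (Suc m) - G m) z"
      using partial_blaschke_Un[of "G m - G n" "G (Suc m) - G m" \<theta> z] G(2) by simp
    thus ?case using step hs[OF z, of m] by simp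
  qed
  have P1: "norm (?P F z - 1) \<le> 2 / (1 - norm z) * (1/2) ^ n" if "norm z < 1" "finite F" "F \<subseteq> ?Z - G n" for F z n
  proof -
    have "norm (?P F z - 1) \<le> 2 / (1 - norm z) * sum t F"
      unfolding t_def using that Z by (intro partial_blaschke_minus_1) auto
    also have "\<dots> \<le> 2 / (1 - norm z) * (1/2) ^ n"
      using tail[of F n] that by (intro mult_left_mono) auto
    finally show ?thesis .
  qed
  have hdiff: "norm (h n z - h m z) \<le> norm (h m z) * (2 / (1 - norm z) * (1/2) ^ n)" if z: "norm z < 1" and "n \<le> m" for n m z
  proof -
    have "h n z - h m z = h m z * (?P (G m - G n) z - 1)" using chain[OF that] by (simp add: algebra_simps)
    moreover have "norm (?P (G m - G n) z - 1) \<le> 2 / (1 - norm z) * (1/2) ^ n"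
      using G(2,3) by (intro P1 z) auto
    ultimately show ?thesis by (metis norm_mult mult_left_mono norm_ge_zero)
  qed
  have half: "(\<lambda>n. C * (1/2::real) ^ n) \<longlonglongrightarrow> 0" for C
    using tendsto_mult[OF tendsto_const[of C] LIMSEQ_power_zero[of "1/2::real"]] by simp
  have uc: "uniformly_Cauchy_on (cball 0 r) h" if r: "r < 1" for r
    unfolding uniformly_Cauchy_on_def
  proof (intro allI impI)
    fix e :: real assume "e > 0"
    have "\<forall>\<^sub>F n in sequentially. (4 / (1 - r)) * (1/2) ^ n < e"
      using half \<open>e > 0\<close> by (rule order_tendstoD(2))
    then obtain N where N: "(4 / (1 - r)) * (1/2) ^ N < e" by (auto simp: eventually_sequentially)
    show "\<exists>M. \<forall>x\<in>cball 0 r. \<forall>m\<ge>M. \<forall>n\<ge>M. dist (h m x) (h n x) < e"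
    proof (intro exI ballI allI impI)
      fix z :: complex and m n assume z: "z \<in> cball 0 r" and mn: "N \<le> m" "N \<le> n"
      have z1: "norm z < 1" using z r by simp
      have b: "norm (h N z - h k z) \<le> 2 / (1 - r) * (1/2) ^ N" if "N \<le> k" for k
      proof -
        have "norm (h N z - h k z) \<le> norm (h k z) * (2 / (1 - norm z) * (1/2) ^ N)" by (rule hdiff[OF z1 that])
        also have "\<dots> \<le> 1 * (2 / (1 - r) * (1/2) ^ N)"
          using h(2)[OF z1] z z1 r by (intro mult_mono mult_right_mono frac_le) auto
        finally show ?thesis by simp
      qed
      have "dist (h m z) (h n z) \<le> norm (h N z - h m z) + norm (h N z - h n z)"
        using norm_triangle_ineq4[of "h N z - h n z" "h N z - h m z"] by (simp add: dist_norm)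
      also have "\<dots> \<le> (4 / (1 - r)) * (1/2) ^ N" using b[OF mn(1)] b[OF mn(2)] by (simp add: field_simps)
      finally show "dist (h m z) (h n z) < e" using N by simp
    qed
  qed
  define g where "g z = lim (\<lambda>n. h n z)" for z
  have ul: "uniform_limit (cball 0 r) h g sequentially" if "r < 1" for r
    using uniformly_convergent_uniform_limit_iff[of "cball 0 r" h] Cauchy_uniformly_convergent[OF uc[OF that]]
    by (simp add: g_def[abs_def])
  have lim: "(\<lambda>n. h n z) \<longlonglongrightarrow> g z" if "norm z < 1" for z
    by (rule tendsto_uniform_limitI[OF ul[OF that]]) simp
  have ghol: "g holomorphic_on ball 0 1"
  proof (rule holomorphic_uniform_sequence[OF open_ball h(1)])
    fix x :: complex assume x: "x \<in> ball 0 1"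
    define d where "d = (1 - norm x) / 2"
    have d: "d > 0" "norm x + d < 1" using x by (auto simp: d_def field_simps)
    have "cball x d \<subseteq> cball 0 (norm x + d)"
      by (auto simp: dist_norm) (smt (verit) norm_minus_commute norm_triangle_sub)
    with ul[OF d(2)] d have "uniform_limit (cball x d) h g sequentially" "cball x d \<subseteq> ball 0 1"
      by (auto intro: uniform_limit_on_subset)
    with d show "\<exists>d>0. cball x d \<subseteq> ball 0 1 \<and> uniform_limit (cball x d) h g sequentially" by blast
  qed
  have gle: "norm (g z) \<le> 1" if "norm z < 1" for z
    by (rule tendsto_upperbound[OF tendsto_norm[OF lim[OF that]] always_eventually]) (use h(2)[OF that] in auto)
  have gnz: "g z \<noteq> 0" if z: "norm z < 1" for z
  proof
    assume g0: "g z = 0"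
    \<comment> \<open>From index \<open>N\<close> on, \<open>h n\<close> does not vanish at \<open>z\<close>: either \<open>z\<close> has been divided out or it is not a zero of \<open>\<theta>\<close>.\<close>
    obtain N where N: "z \<in> ?Z \<longrightarrow> z \<in> G N" using G(4) by blast
    have hN: "h n z \<noteq> 0" if "n \<ge> N" for n
    proof (cases "z \<in> ?Z")
      case True
      thus ?thesis using N Gm[OF that] h(3) by blast
    next
      case False
      thus ?thesis using h(4)[OF z, of n] z by (auto simp: disc_zeros_def)
    qed
    have "(\<lambda>m. norm (h m z) * (2 / (1 - norm z) * (1/2) ^ N)) \<longlonglongrightarrow> norm (g z) * (2 / (1 - norm z) * (1/2) ^ N)"
      by (intro tendsto_intros lim z)
    moreover have "(\<lambda>m. norm (h N z - h m z)) \<longlonglongrightarrow> norm (h N z - g z)" by (intro tendsto_intros lim z)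
    moreover have "\<forall>\<^sub>F m in sequentially. norm (h N z - h m z) \<le> norm (h m z) * (2 / (1 - norm z) * (1/2) ^ N)"
      using eventually_ge_at_top[of N] by eventually_elim (rule hdiff[OF z])
    ultimately have "norm (h N z - g z) \<le> norm (g z) * (2 / (1 - norm z) * (1/2) ^ N)"
      by (intro tendsto_le[OF sequentially_bot])
    thus False using hN[of N] g0 by simp
  qed
  have Ple: "norm (?P F z) \<le> 1" if "F \<subseteq> ?Z" "norm z < 1" for F z
    using that Z by (intro partial_blaschke_le_1) auto
  have Bnet: "((\<lambda>F. ?P F z) \<longlongrightarrow> \<theta> z / g z) (finite_subsets_at_top ?Z)" if z: "norm z < 1" for z
  proof -
    have seq: "(\<lambda>n. ?P (G n) z) \<longlonglongrightarrow> \<theta> z / g z"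
    proof (rule Lim_transform_eventually)
      show "(\<lambda>n. \<theta> z / h n z) \<longlonglongrightarrow> \<theta> z / g z" by (intro tendsto_intros lim z gnz)
      have "\<forall>\<^sub>F n in sequentially. h n z \<noteq> 0"
        using tendsto_imp_eventually_ne[OF lim[OF z] gnz[OF z]] .
      thus "\<forall>\<^sub>F n in sequentially. \<theta> z / h n z = ?P (G n) z"
        by eventually_elim (simp add: h(4)[OF z, symmetric] nonzero_divide_eq_eq)
    qed
    have near: "norm (?P F z - ?P (G n) z) \<le> 2 / (1 - norm z) * (1/2) ^ n" if "finite F" "F \<subseteq> ?Z" "G n \<subseteq> F" for F n
    proof -
      have "?P F z = ?P (G n) z * ?P (F - G n) z"
        using partial_blaschke_Un[of "G n" "F - G n" \<theta> z] G(2) that by (simp add: Un_absorb1)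
      hence "?P F z - ?P (G n) z = ?P (G n) z * (?P (F - G n) z - 1)" by (simp add: algebra_simps)
      hence "norm (?P F z - ?P (G n) z) = norm (?P (G n) z) * norm (?P (F - G n) z - 1)" by (simp add: norm_mult)
      also have "\<dots> \<le> 1 * (2 / (1 - norm z) * (1/2) ^ n)"
        using that by (intro mult_mono Ple G(3) z P1) auto
      finally show ?thesis by simp
    qed
    show ?thesis
    proof (rule tendstoI)
      fix e :: real assume "e > 0"
      have "\<forall>\<^sub>F n in sequentially. dist (?P (G n) z) (\<theta> z / g z) < e / 2 \<and> 2 / (1 - norm z) * (1/2) ^ n < e / 2"
        using \<open>e > 0\<close> by (intro eventually_conj tendstoD[OF seq] order_tendstoD(2)[OF half]) auto
      then obtain n where n: "dist (?P (G n) z) (\<theta> z / g z) < e / 2" "2 / (1 - norm z) * (1/2) ^ n < e / 2"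
        by (auto simp: eventually_sequentially)
      have "dist (?P F z) (\<theta> z / g z) < e" if "finite F" "F \<subseteq> ?Z" "G n \<subseteq> F" for F
        using dist_triangle[of "?P F z" "\<theta> z / g z" "?P (G n) z"] near[OF that] n by (simp add: dist_norm)
      thus "\<forall>\<^sub>F F in finite_subsets_at_top ?Z. dist (?P F z) (\<theta> z / g z) < e"
        unfolding eventually_finite_subsets_at_top using G(2,3) by (intro exI[of _ "G n"]) auto
    qed
  qed
  have B: "blaschke_product \<theta> z = \<theta> z / g z" if "norm z < 1" for z
    using tendsto_Lim[OF finite_subsets_at_top_neq_bot Bnet[OF that]]
    by (simp add: blaschke_product_def partial_blaschke_def)
  show ?thesis
  proof (rule that[OF ghol gle gnz])
    show "\<theta> z = blaschke_product \<theta> z * g z" if "norm z < 1" for z using B[OF that] gnz[OF that] by simp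
    fix z :: complex and F assume z: "norm z < 1" and F: "finite F" "F \<subseteq> ?Z"
    show "norm (blaschke_product \<theta> z) \<le> norm (?P F z)"
      unfolding B[OF z]
    proof (rule tendsto_upperbound[OF tendsto_norm[OF Bnet[OF z]]])
      have "norm (?P F' z) \<le> norm (?P F z)" if "finite F'" "F' \<subseteq> ?Z" "F \<subseteq> F'" for F'
      proof -
        have "?P F' z = ?P F z * ?P (F' - F) z"
          using partial_blaschke_Un[of F "F' - F" \<theta> z] F that by (simp add: Un_absorb1)
        moreover have "norm (?P (F' - F) z) \<le> 1" using that by (intro Ple z) auto
        ultimately show ?thesis by (simp add: norm_mult mult_left_le)
      qed
      thus "\<forall>\<^sub>F F' in finite_subsets_at_top ?Z. norm (?P F' z) \<le> norm (?P F z)"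
        unfolding eventually_finite_subsets_at_top using F by (intro exI[of _ F]) auto
    qed simp
  qed
qed

section \<open>The Herglotz representation\<close>

text \<open>The real part is half the sum of \<open>f\<close> and its conjugate, and the conjugate contributes only to the
  moment of order zero.\<close>

lemma arc_moment_Re:
  assumes f: "f holomorphic_on ball 0 1" "0 \<le> r" "r < 1"
  shows "(\<integral>\<xi>. of_real (Re (f (of_real r * \<xi>))) * cnj \<xi> ^ n \<partial>arc_measure) =
     (if n = 0 then of_real (Re (taylor_coeff f 0)) else taylor_coeff f n * of_real r ^ n / 2)"
proof -
  have i1: "integrable arc_measure (\<lambda>\<xi>. f (of_real r * \<xi>) * cnj \<xi> ^ n)"
    and i2: "integrable arc_measure (\<lambda>\<xi>. cnj (f (of_real r * \<xi>) * \<xi> ^ n))"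
    by (intro arc_integrable continuous_intros disc_circle_continuous f)+
  have "(\<integral>\<xi>. of_real (Re (f (of_real r * \<xi>))) * cnj \<xi> ^ n \<partial>arc_measure) =
      (\<integral>\<xi>. (f (of_real r * \<xi>) * cnj \<xi> ^ n + cnj (f (of_real r * \<xi>) * \<xi> ^ n)) / 2 \<partial>arc_measure)"
  proof (rule Bochner_Integration.integral_cong[OF refl])
    fix \<xi>
    have Re_eq: "complex_of_real (Re w) = (w + cnj w) / 2" for w by (simp add: complex_eq_iff)
    show "of_real (Re (f (of_real r * \<xi>))) * cnj \<xi> ^ n = (f (of_real r * \<xi>) * cnj \<xi> ^ n + cnj (f (of_real r * \<xi>) * \<xi> ^ n)) / 2"
      unfolding Re_eq by (simp add: distrib_right)
  qed
  also have "\<dots> = ((\<integral>\<xi>. f (of_real r * \<xi>) * cnj \<xi> ^ n \<partial>arc_measure) + cnj (\<integral>\<xi>. f (of_real r * \<xi>) * \<xi> ^ n \<partial>arc_measure)) / 2"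
    using i1 i2 Bochner_Integration.integral_cnj[of arc_measure "\<lambda>\<xi>. f (of_real r * \<xi>) * \<xi> ^ n"]
    by simp
  also have "\<dots> = (if n = 0 then of_real (Re (taylor_coeff f 0)) else taylor_coeff f n * of_real r ^ n / 2)"
    unfolding arc_moment_antiholomorphic[OF f] arc_moment_holomorphic[OF f]
    by (simp add: complex_eq_iff)
  finally show ?thesis .
qed

text \<open>The densities are read as probability densities in the angle on \<open>[0, 2 \<pi>]\<close>. Helly's selection theorem on
  the real line gives a weakly convergent subsequence, and \<open>cis\<close> carries the limit back to the circle.\<close>

lemma circle_weak_limit:
  fixes u :: "nat \<Rightarrow> complex \<Rightarrow> real"
  assumes u: "\<And>k. continuous_on (sphere 0 1) (u k)" "\<And>k \<xi>. norm \<xi> = 1 \<Longrightarrow> u k \<xi> \<ge> 0"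
    and mass: "\<And>k. (\<integral>\<xi>. u k \<xi> \<partial>arc_measure) = 1"
  obtains \<nu> s where "prob_space \<nu>" "sets \<nu> = sets circle_borel" "strict_mono (s :: nat \<Rightarrow> nat)"
    "\<And>n. (\<lambda>k. \<integral>\<xi>. of_real (u (s k) \<xi>) * cnj \<xi> ^ n \<partial>arc_measure) \<longlonglongrightarrow> (\<integral>\<xi>. cnj \<xi> ^ n \<partial>\<nu>)"
proof -
  define d where "d k t = indicator {0..2*pi} t * (u k (cis t) / (2*pi))" for k t
  define \<mu> where "\<mu> k = density lborel (\<lambda>t. ennreal (d k t))" for k
  have um: "u k \<in> borel_measurable circle_borel" for k by (rule borel_measurable_circle[OF u(1)])
  have c: "cis \<in> lborel \<rightarrow>\<^sub>M circle_borel"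
    using cis_measurable_circle by (simp add: measurable_def uniform_measure_def)
  have [measurable]: "(\<lambda>t. u k (cis t)) \<in> borel_measurable lborel" for k
    by (rule measurable_compose[OF c um])
  have dm [measurable]: "d k \<in> borel_measurable lborel" for k unfolding d_def[abs_def] by measurable
  have d0: "d k t \<ge> 0" for k t using u(2)[of "cis t" k] by (simp add: d_def)
  have cont: "continuous_on {0..2*pi} (\<lambda>t. u k (cis t) / (2*pi))" for k
  proof -
    have "continuous_on {0..2*pi} (\<lambda>t. u k (cis t))"
      by (rule continuous_on_compose2[OF u(1)]) (auto intro!: continuous_intros)
    thus ?thesis by (intro continuous_intros) auto
  qed
  have di: "integrable lborel (d k)" for k
    using borel_integrable_atLeastAtMost'[OF cont[of k]]
    unfolding set_integrable_def d_def[abs_def] by simp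
  have dI: "(\<integral>t. d k t \<partial>lborel) = 1" for k
  proof -
    have "(\<integral>t. d k t \<partial>lborel) = (\<integral>t. indicator {0..2*pi} t *\<^sub>R (u k (cis t) /\<^sub>R (2 * pi)) \<partial>lborel)"
    proof (rule Bochner_Integration.integral_cong[OF refl])
      show "d k t = indicator {0..2*pi} t *\<^sub>R (u k (cis t) /\<^sub>R (2 * pi))" for t
        unfolding d_def real_scaleR_def divide_inverse by (simp only: mult_ac)
    qed
    thus ?thesis unfolding arc_integral[OF um, symmetric] mass .
  qed
  have nn1: "(\<integral>\<^sup>+t. ennreal (d k t) \<partial>lborel) = 1" for k
    using nn_integral_eq_integral[OF di[of k]] d0 dI[of k] by simp
  have rd: "real_distribution (\<mu> k)" for k
  proof (intro real_distribution.intro prob_spaceI real_distribution_axioms.intro)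
    show "emeasure (\<mu> k) (space (\<mu> k)) = 1"
      using nn1[of k] by (simp add: \<mu>_def emeasure_density)
    show "sets (\<mu> k) = sets borel" by (simp add: \<mu>_def)
  qed
  have "tight \<mu>"
    unfolding tight_def
  proof (intro conjI allI impI rd)
    fix e :: real assume "e > 0"
    \<comment> \<open>An interval containing \<open>[0, 2 \<pi>]\<close>.\<close>
    have "measure (\<mu> k) {-1<..7} = 1" for k
    proof -
      have pi: "2 * pi \<le> 7" using pi_less_4 pi_approx by simp
      have "emeasure (\<mu> k) {-1<..7} = (\<integral>\<^sup>+t. ennreal (d k t) * indicator {-1<..7} t \<partial>lborel)"
        unfolding \<mu>_def by (rule emeasure_density) auto
      also have "\<dots> = (\<integral>\<^sup>+t. ennreal (d k t) \<partial>lborel)"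
        using pi by (intro nn_integral_cong) (auto simp: d_def indicator_def)
      finally show ?thesis using nn1[of k] by (simp add: measure_def)
    qed
    with \<open>e > 0\<close> show "\<exists>a b. a < b \<and> (\<forall>n. 1 - e < measure (\<mu> n) {a<..b})"
      by (intro exI[of _ "-1"] exI[of _ 7]) simp
  qed
  from tight_imp_convergent_subsubsequence[OF this strict_mono_id]
  obtain s M where s: "strict_mono (s :: nat \<Rightarrow> nat)" and M: "real_distribution M" and wc: "weak_conv_m (\<mu> \<circ> id \<circ> s) M"
    by blast
  interpret M: real_distribution M by (rule M)
  have cM: "cis \<in> M \<rightarrow>\<^sub>M circle_borel"
    using c M.events_eq_borel by (simp add: measurable_def sets_eq_imp_space_eq[OF M.events_eq_borel])
  define \<nu> where "\<nu> = distr M circle_borel cis"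
  show ?thesis
  proof (rule that[of \<nu> s])
    show "prob_space \<nu>" unfolding \<nu>_def by (rule M.prob_space_distr[OF cM])
    show "sets \<nu> = sets circle_borel" by (simp add: \<nu>_def)
    show "strict_mono s" by (rule s)
    fix n
    define f where "f t = cnj (cis t) ^ n" for t
    have cf: "continuous_on UNIV f" unfolding f_def by (intro continuous_intros)
    hence "isCont f t" for t by (simp add: continuous_on_eq_continuous_at)
    hence "(\<lambda>k. integral\<^sup>L ((\<mu> \<circ> id \<circ> s) k) f) \<longlonglongrightarrow> integral\<^sup>L M f"
      by (intro weak_conv_imp_integral_bdd_continuous_conv[where B=1, OF _ M wc])
        (use rd in \<open>auto simp: f_def norm_power\<close>)
    moreover have "integral\<^sup>L ((\<mu> \<circ> id \<circ> s) k) f = (\<integral>\<xi>. of_real (u (s k) \<xi>) * cnj \<xi> ^ n \<partial>arc_measure)" for k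
    proof -
      have fm: "f \<in> borel_measurable lborel"
        using borel_measurable_continuous_onI[OF cf] by simp
      have "integral\<^sup>L (\<mu> (s k)) f = (\<integral>t. d (s k) t *\<^sub>R f t \<partial>lborel)"
        unfolding \<mu>_def using d0 by (intro integral_density fm dm) auto
      also have "\<dots> = (\<integral>t. indicator {0..2*pi} t *\<^sub>R ((of_real (u (s k) (cis t)) * cnj (cis t) ^ n) /\<^sub>R (2 * pi)) \<partial>lborel)"
        by (intro Bochner_Integration.integral_cong refl) (simp add: d_def f_def scaleR_conv_of_real field_simps)
      also have "\<dots> = (\<integral>\<xi>. of_real (u (s k) \<xi>) * cnj \<xi> ^ n \<partial>arc_measure)"
        by (rule arc_integral[symmetric]) (intro borel_measurable_circle continuous_intros u)
      finally show ?thesis by simp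
    qed
    moreover have "integral\<^sup>L M f = (\<integral>\<xi>. cnj \<xi> ^ n \<partial>\<nu>)"
      unfolding \<nu>_def f_def by (rule integral_distr[OF cM, symmetric]) (intro borel_measurable_circle continuous_intros)
    ultimately show "(\<lambda>k. \<integral>\<xi>. of_real (u (s k) \<xi>) * cnj \<xi> ^ n \<partial>arc_measure) \<longlonglongrightarrow> (\<integral>\<xi>. cnj \<xi> ^ n \<partial>\<nu>)"
      by simp
  qed
qed

text \<open>The measure is a weak limit of the positive densities \<open>Re H\<close> on circles with radius tending to one; its
  moments are the limits of those in \<open>arc_moment_Re\<close>. If the total mass \<open>c\<close> is zero, all coefficients of positive
  order vanish and the null measure serves.\<close>

lemma positive_real_part_moments:
  assumes H: "H holomorphic_on ball 0 1" "\<And>z. norm z < 1 \<Longrightarrow> Re (H z) \<ge> 0"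
  obtains \<nu> where "finite_measure \<nu>" "sets \<nu> = sets circle_borel"
    "\<And>n. (\<integral>\<xi>. cnj \<xi> ^ n \<partial>\<nu>) = (if n = 0 then of_real (Re (taylor_coeff H 0)) else taylor_coeff H n / 2)"
proof -
  define c where "c = Re (taylor_coeff H 0)"
  define u where "u k \<xi> = Re (H (of_real (radii k) * \<xi>))" for k \<xi>
  have r: "0 \<le> radii k" "radii k < 1" for k using radii_bounds[of k] by auto
  have uc: "continuous_on (sphere 0 1) (u k)" for k
    unfolding u_def by (intro continuous_intros disc_circle_continuous H r)
  have u0: "u k \<xi> \<ge> 0" if "norm \<xi> = 1" for k \<xi>
    unfolding u_def by (rule H(2)) (use that r[of k] in \<open>simp add: norm_mult\<close>)
  have mom: "(\<integral>\<xi>. of_real (u k \<xi>) * cnj \<xi> ^ n \<partial>arc_measure) =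
     (if n = 0 then of_real c else taylor_coeff H n * of_real (radii k) ^ n / 2)" for k n
    unfolding u_def c_def by (rule arc_moment_Re[OF H(1) r])
  have mean: "(\<integral>\<xi>. u k \<xi> \<partial>arc_measure) = c" for k
    using mom[of k 0] by (simp add: integral_complex_of_real)
  have c0: "c \<ge> 0"
    unfolding mean[of 0, symmetric] using u0 by (intro integral_nonneg_AE AE_I2) simp
  show ?thesis
  proof (cases "c = 0")
    case True
    have "taylor_coeff H n = 0" if "n > 0" for n
    proof -
      have "norm (\<integral>\<xi>. of_real (u 0 \<xi>) * cnj \<xi> ^ n \<partial>arc_measure) \<le> (\<integral>\<xi>. norm (of_real (u 0 \<xi>) * cnj \<xi> ^ n) \<partial>arc_measure)"
        by (rule integral_norm_bound)
      also have "\<dots> = (\<integral>\<xi>. u 0 \<xi> \<partial>arc_measure)"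
        by (intro Bochner_Integration.integral_cong refl) (use u0 in \<open>auto simp: norm_mult norm_power\<close>)
      finally have "(\<integral>\<xi>. of_real (u 0 \<xi>) * cnj \<xi> ^ n \<partial>arc_measure) = 0" using mean True by simp
      thus ?thesis using mom[of 0 n] that radii_bounds(1)[of 0] by simp
    qed
    moreover have "finite_measure (null_measure circle_borel)" by (rule finite_measureI) simp
    ultimately show ?thesis
      using True by (intro that[of "null_measure circle_borel"]) (auto simp: c_def)
  next
    case False
    hence c: "c > 0" using c0 by simp
    obtain \<nu> s where \<nu>: "prob_space \<nu>" "sets \<nu> = sets circle_borel" and s: "strict_mono (s :: nat \<Rightarrow> nat)"
      and lim: "\<And>n. (\<lambda>k. \<integral>\<xi>. of_real (u (s k) \<xi> / c) * cnj \<xi> ^ n \<partial>arc_measure) \<longlonglongrightarrow> (\<integral>\<xi>. cnj \<xi> ^ n \<partial>\<nu>)"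
    proof (rule circle_weak_limit[of "\<lambda>k \<xi>. u k \<xi> / c"])
      show "continuous_on (sphere 0 1) (\<lambda>\<xi>. u k \<xi> / c)" for k using c by (intro continuous_intros uc) auto
      show "u k \<xi> / c \<ge> 0" if "norm \<xi> = 1" for k \<xi> using u0[OF that] c by simp
      show "(\<integral>\<xi>. u k \<xi> / c \<partial>arc_measure) = 1" for k using mean[of k] c by simp
    qed blast
    interpret \<nu>: prob_space \<nu> by (rule \<nu>)
    define \<kappa> where "\<kappa> = density \<nu> (\<lambda>_. ennreal c)"
    show ?thesis
    proof (rule that[of \<kappa>])
      show "finite_measure \<kappa>"
        by (rule finite_measureI)
          (simp add: \<kappa>_def emeasure_density \<nu>.emeasure_space_1 nn_integral_cmult)
      show "sets \<kappa> = sets circle_borel" by (simp add: \<kappa>_def \<nu>)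
      fix n
      have meas: "(\<lambda>\<xi>. cnj \<xi> ^ n) \<in> borel_measurable \<nu>"
      proof -
        have "(\<lambda>\<xi>. cnj \<xi> ^ n) \<in> borel_measurable circle_borel"
          by (intro borel_measurable_circle continuous_intros)
        thus ?thesis by (simp add: measurable_cong_sets[OF \<nu>(2) refl])
      qed
      have "(\<lambda>k. \<integral>\<xi>. of_real (u (s k) \<xi> / c) * cnj \<xi> ^ n \<partial>arc_measure) =
        (\<lambda>k. (if n = 0 then of_real c else taylor_coeff H n * of_real (radii (s k)) ^ n / 2) / of_real c)"
      proof
        fix k
        have "(\<integral>\<xi>. of_real (u (s k) \<xi> / c) * cnj \<xi> ^ n \<partial>arc_measure) =
            (\<integral>\<xi>. (of_real (u (s k) \<xi>) * cnj \<xi> ^ n) / of_real c \<partial>arc_measure)"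
          by (intro Bochner_Integration.integral_cong refl) simp
        also have "\<dots> = (\<integral>\<xi>. of_real (u (s k) \<xi>) * cnj \<xi> ^ n \<partial>arc_measure) / of_real c"
          by (rule integral_divide_zero)
        finally show "(\<integral>\<xi>. of_real (u (s k) \<xi> / c) * cnj \<xi> ^ n \<partial>arc_measure) =
           (if n = 0 then of_real c else taylor_coeff H n * of_real (radii (s k)) ^ n / 2) / of_real c"
          unfolding mom .
      qed
      moreover have "(\<lambda>k. (if n = 0 then of_real c else taylor_coeff H n * of_real (radii (s k)) ^ n / 2) / of_real c)
          \<longlonglongrightarrow> (if n = 0 then of_real c else taylor_coeff H n * of_real 1 ^ n / 2) / of_real c"
      proof -
        have rl: "(\<lambda>k. radii (s k)) \<longlonglongrightarrow> 1" using LIMSEQ_subseq_LIMSEQ[OF radii_tendsto s] by (simp add: comp_def)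
        have "(\<lambda>k. (taylor_coeff H n * of_real (radii (s k)) ^ n / 2) / of_real c)
          \<longlonglongrightarrow> (taylor_coeff H n * of_real 1 ^ n / 2) / of_real c"
          by (intro tendsto_intros rl) (use c in auto)
        thus ?thesis by (cases "n = 0") auto
      qed
      ultimately have "(\<integral>\<xi>. cnj \<xi> ^ n \<partial>\<nu>) = (if n = 0 then of_real c else taylor_coeff H n / 2) / of_real c"
        using LIMSEQ_unique[OF lim[of n]] by simp
      thus "(\<integral>\<xi>. cnj \<xi> ^ n \<partial>\<kappa>) = (if n = 0 then of_real (Re (taylor_coeff H 0)) else taylor_coeff H n / 2)"
        unfolding \<kappa>_def using c meas by (simp add: integral_density scaleR_conv_of_real c_def)
    qed
  qed
qed

text \<open>On the circle, the Herglotz kernel is \<open>1 + 2 * (\<Sum>n. (z * cnj \<xi>) ^ Suc n)\<close>.\<close>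

lemma herglotz_kernel_integral:
  assumes "finite_measure \<nu>" and sets: "sets \<nu> = sets circle_borel" and z: "norm z < 1"
  shows "(\<lambda>n. (if n = 0 then 1 else 2 * z ^ n) * (\<integral>\<xi>. cnj \<xi> ^ n \<partial>\<nu>)) sums (\<integral>\<xi>. (\<xi> + z) / (\<xi> - z) \<partial>\<nu>)"
proof -
  interpret finite_measure \<nu> by fact
  have sp: "space \<nu> = sphere 0 1" using sets_eq_imp_space_eq[OF sets] by simp
  let ?a = "\<lambda>n. if n = 0 then 1 else 2 * z ^ n"
  have a_le: "norm (?a n) \<le> 2 * norm z ^ n" for n by (simp add: norm_mult norm_power)
  have geo: "summable (\<lambda>n. 2 * norm z ^ n)" using z by (intro summable_mult summable_geometric) simp
  have int: "integrable \<nu> (\<lambda>\<xi>. cnj \<xi> ^ n)" for n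
    by (intro circle_integrable assms continuous_intros)
  have "(\<lambda>n. \<integral>\<xi>. ?a n * cnj \<xi> ^ n \<partial>\<nu>) sums (\<integral>\<xi>. (\<Sum>n. ?a n * cnj \<xi> ^ n) \<partial>\<nu>)"
  proof (rule sums_integral)
    show "integrable \<nu> (\<lambda>\<xi>. ?a n * cnj \<xi> ^ n)" for n using int by (rule integrable_mult_right)
    show "AE \<xi> in \<nu>. summable (\<lambda>n. norm (?a n * cnj \<xi> ^ n))"
    proof (rule AE_I2)
      fix \<xi> assume "\<xi> \<in> space \<nu>"
      thus "summable (\<lambda>n. norm (?a n * cnj \<xi> ^ n))"
        by (intro summable_comparison_test'[OF geo]) (use a_le in \<open>auto simp: sp norm_mult norm_power\<close>)
    qed
    show "summable (\<lambda>n. \<integral>\<xi>. norm (?a n * cnj \<xi> ^ n) \<partial>\<nu>)"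
    proof (rule summable_comparison_test'[OF summable_mult2[OF geo, of "measure \<nu> (space \<nu>)"]])
      fix n
      have "(\<integral>\<xi>. norm (?a n * cnj \<xi> ^ n) \<partial>\<nu>) = (\<integral>\<xi>. norm (?a n) \<partial>\<nu>)"
        by (intro Bochner_Integration.integral_cong refl) (auto simp: sp norm_mult norm_power)
      also have "\<dots> = norm (?a n) * measure \<nu> (space \<nu>)" by (simp add: mult.commute)
      also have "\<dots> \<le> 2 * norm z ^ n * measure \<nu> (space \<nu>)" using a_le[of n] by (intro mult_right_mono) auto
      finally show "norm (\<integral>\<xi>. norm (?a n * cnj \<xi> ^ n) \<partial>\<nu>) \<le> 2 * norm z ^ n * measure \<nu> (space \<nu>)" by simp
    qed
  qed
  moreover have "(\<integral>\<xi>. ?a n * cnj \<xi> ^ n \<partial>\<nu>) = ?a n * (\<integral>\<xi>. cnj \<xi> ^ n \<partial>\<nu>)" for n by simp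
  moreover have "(\<integral>\<xi>. (\<Sum>n. ?a n * cnj \<xi> ^ n) \<partial>\<nu>) = (\<integral>\<xi>. (\<xi> + z) / (\<xi> - z) \<partial>\<nu>)"
  proof (rule Bochner_Integration.integral_cong[OF refl])
    fix \<xi> assume "\<xi> \<in> space \<nu>"
    hence x: "norm \<xi> = 1" by (simp add: sp)
    have xx: "\<xi> * cnj \<xi> = 1" using complex_norm_square[of \<xi>] x by simp
    have ne: "\<xi> \<noteq> z" using x z by auto
    have "norm (z * cnj \<xi>) < 1" using x z by (simp add: norm_mult)
    from geometric_sums[OF this] have "(\<lambda>n. 2 * (z * cnj \<xi>) ^ n) sums (2 * (1 / (1 - z * cnj \<xi>)))" by (rule sums_mult)
    hence "(\<lambda>n. 2 * (z * cnj \<xi>) ^ n - (if n = 0 then 1 else 0)) sums (2 * (1 / (1 - z * cnj \<xi>)) - 1)"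
      using sums_single[of 0 "\<lambda>_. 1 :: complex"] by (intro sums_diff) auto
    moreover have "2 * (z * cnj \<xi>) ^ n - (if n = 0 then 1 else 0) = ?a n * cnj \<xi> ^ n" for n
      by (simp add: power_mult_distrib)
    ultimately have "(\<lambda>n. ?a n * cnj \<xi> ^ n) sums (2 * (1 / (1 - z * cnj \<xi>)) - 1)" by simp
    moreover have "2 * (1 / (1 - z * cnj \<xi>)) - 1 = (\<xi> + z) / (\<xi> - z)"
    proof -
      have "1 - z * cnj \<xi> = (\<xi> - z) * cnj \<xi>" using xx by (simp add: algebra_simps)
      moreover have "1 / cnj \<xi> = \<xi>" using xx x by (metis eq_divide_imp mult_zero_right zero_neq_one)
      ultimately have k: "1 / (1 - z * cnj \<xi>) = \<xi> / (\<xi> - z)" by (metis divide_divide_eq_left' divide_divide_eq_left)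
      show ?thesis unfolding k using ne by (simp add: field_simps)
    qed
    ultimately show "(\<Sum>n. ?a n * cnj \<xi> ^ n) = (\<xi> + z) / (\<xi> - z)" by (simp add: sums_iff)
  qed
  ultimately show ?thesis by simp
qed

text \<open>Both sides have the same power series, as the measure has the right moments.\<close>

lemma herglotz_representation:
  assumes H: "H holomorphic_on ball 0 1" "\<And>z. norm z < 1 \<Longrightarrow> Re (H z) \<ge> 0"
  obtains \<nu> where "finite_measure \<nu>" "sets \<nu> = sets circle_borel"
    "\<And>z. norm z < 1 \<Longrightarrow> H z = \<i> * of_real (Im (H 0)) + (\<integral>\<xi>. (\<xi> + z) / (\<xi> - z) \<partial>\<nu>)"
proof -
  obtain \<nu> where \<nu>: "finite_measure \<nu>" "sets \<nu> = sets circle_borel"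
    and mom: "\<And>n. (\<integral>\<xi>. cnj \<xi> ^ n \<partial>\<nu>) = (if n = 0 then of_real (Re (taylor_coeff H 0)) else taylor_coeff H n / 2)"
    using positive_real_part_moments[OF H] by blast
  have H0: "taylor_coeff H 0 = H 0" by (simp add: taylor_coeff_def)
  show ?thesis
  proof (rule that[OF \<nu>])
    fix z :: complex assume z: "norm z < 1"
    have "(\<lambda>n. taylor_coeff H n * z ^ n - (if n = 0 then \<i> * of_real (Im (H 0)) else 0)) sums (H z - \<i> * of_real (Im (H 0)))"
      using sums_single[of 0 "\<lambda>_. \<i> * of_real (Im (H 0))"] by (intro sums_diff taylor_sums H(1) z) auto
    moreover have "taylor_coeff H n * z ^ n - (if n = 0 then \<i> * of_real (Im (H 0)) else 0) =
       (if n = 0 then 1 else 2 * z ^ n) * (\<integral>\<xi>. cnj \<xi> ^ n \<partial>\<nu>)" for n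
      unfolding mom by (cases "n = 0") (auto simp: H0 complex_eq_iff)
    ultimately have "H z - \<i> * of_real (Im (H 0)) = (\<integral>\<xi>. (\<xi> + z) / (\<xi> - z) \<partial>\<nu>)"
      using herglotz_kernel_integral[OF \<nu> z] sums_unique2 by simp
    thus "H z = \<i> * of_real (Im (H 0)) + (\<integral>\<xi>. (\<xi> + z) / (\<xi> - z) \<partial>\<nu>)" by (simp add: algebra_simps)
  qed
qed

section \<open>Singularity of the representing measure\<close>

lemma nn_integral_mono_measure:
  assumes sets: "sets N = sets M" and le: "\<And>X. X \<in> sets M \<Longrightarrow> emeasure M X \<le> emeasure N X"
  shows "(\<integral>\<^sup>+x. f x \<partial>M) \<le> (\<integral>\<^sup>+x. f x \<partial>N)"
proof -
  have sp: "space N = space M" using sets by (rule sets_eq_imp_space_eq)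
  have sf: "simple_function N g = simple_function M g" for g :: "'a \<Rightarrow> ennreal"
    by (simp add: simple_function_def sets sp)
  have "integral\<^sup>S M g \<le> integral\<^sup>S N g" if "simple_function M g" for g
    unfolding simple_integral_def sp
    by (intro sum_mono mult_left_mono le simple_functionD[OF that]) auto
  thus ?thesis
    unfolding nn_integral_def sf by (intro SUP_mono) auto
qed

definition poisson_kernel :: "complex \<Rightarrow> complex \<Rightarrow> real" where
  "poisson_kernel z \<xi> = (1 - (norm z)\<^sup>2) / (norm (\<xi> - z))\<^sup>2"

lemma poisson_kernel_nonneg: "norm z < 1 \<Longrightarrow> poisson_kernel z \<xi> \<ge> 0"
  by (simp add: poisson_kernel_def abs_square_le_1)

lemma Re_herglotz_kernel:
  assumes "norm \<xi> = 1" "norm z < 1"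
  shows "Re ((\<xi> + z) / (\<xi> - z)) = poisson_kernel z \<xi>"
proof -
  have "(Re \<xi>)\<^sup>2 + (Im \<xi>)\<^sup>2 = 1" using assms(1) cmod_power2[of \<xi>] by simp
  thus ?thesis
    unfolding poisson_kernel_def Re_divide cmod_power2
    by (simp add: power2_eq_square algebra_simps)
qed

lemma continuous_on_poisson_kernel:
  assumes "norm z < 1"
  shows "continuous_on (sphere 0 1) (poisson_kernel z)"
  unfolding poisson_kernel_def by (intro continuous_intros) (use assms in auto)

text \<open>Lets \<open>poisson_kernel_mean\<close> be used for either variable.\<close>

lemma poisson_kernel_radial_swap:
  assumes "norm \<xi> = 1" "norm \<eta> = 1"
  shows "poisson_kernel (of_real r * \<xi>) \<eta> = poisson_kernel (of_real r * \<eta>) \<xi>"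
proof -
  have "(Re \<xi>)\<^sup>2 + (Im \<xi>)\<^sup>2 = 1" "(Re \<eta>)\<^sup>2 + (Im \<eta>)\<^sup>2 = 1" using assms cmod_power2[of \<xi>] cmod_power2[of \<eta>] by auto
  hence "(norm (\<eta> - of_real r * \<xi>))\<^sup>2 = (norm (\<xi> - of_real r * \<eta>))\<^sup>2"
    unfolding cmod_power2 by (simp add: power2_eq_square algebra_simps) (algebra)
  thus ?thesis using assms by (simp add: poisson_kernel_def norm_mult)
qed

text \<open>As a function of \<open>\<xi>\<close> this is the real part of a holomorphic function on a circle about the origin, where
  that function has the value one.\<close>

lemma poisson_kernel_mean:
  assumes \<eta>: "norm \<eta> = 1" and r: "0 \<le> r" "r < 1"
  shows "(\<integral>\<^sup>+\<xi>. ennreal (poisson_kernel (of_real r * \<xi>) \<eta>) \<partial>arc_measure) = 1"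
proof -
  define f where "f w = (\<eta> + w) / (\<eta> - w)" for w
  have hol: "f holomorphic_on ball 0 1" unfolding f_def using \<eta> by (intro holomorphic_intros) auto
  have lt: "norm (of_real r * \<xi>) < 1" if "norm \<xi> = 1" for \<xi> :: complex using r that by (simp add: norm_mult)
  have eq: "poisson_kernel (of_real r * \<xi>) \<eta> = Re (f (of_real r * \<xi>))" if "norm \<xi> = 1" for \<xi>
    unfolding f_def by (rule Re_herglotz_kernel[OF \<eta> lt[OF that], symmetric])
  have "complex_of_real (\<integral>\<xi>. Re (f (of_real r * \<xi>)) \<partial>arc_measure) = of_real (Re (taylor_coeff f 0))"
    using arc_moment_Re[OF hol r, of 0] by (simp add: integral_complex_of_real)
  hence "(\<integral>\<xi>. Re (f (of_real r * \<xi>)) \<partial>arc_measure) = Re (taylor_coeff f 0)" by (simp only: of_real_eq_iff)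
  also have "\<dots> = 1" using \<eta> by (auto simp: taylor_coeff_def f_def)
  finally have 1: "(\<integral>\<xi>. Re (f (of_real r * \<xi>)) \<partial>arc_measure) = 1" .
  have int: "integrable arc_measure (\<lambda>\<xi>. Re (f (of_real r * \<xi>)))"
    by (intro arc_integrable continuous_intros disc_circle_continuous hol r)
  have "(\<integral>\<^sup>+\<xi>. ennreal (poisson_kernel (of_real r * \<xi>) \<eta>) \<partial>arc_measure) = (\<integral>\<^sup>+\<xi>. ennreal (Re (f (of_real r * \<xi>))) \<partial>arc_measure)"
    by (intro nn_integral_cong) (use eq in simp)
  also have "\<dots> = ennreal 1"
    using 1 int eq poisson_kernel_nonneg[OF lt, of _ \<eta>]
    by (subst nn_integral_eq_integral) (auto intro!: AE_I2 simp: simp flip: eq)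
  finally show ?thesis by simp
qed

lemma borel_measurable_poisson_kernel_pair:
  "(\<lambda>(\<xi>, \<eta>). poisson_kernel (of_real r * \<xi>) \<eta>) \<in> borel_measurable (arc_measure \<Otimes>\<^sub>M arc_measure)"
proof -
  have [measurable]: "(\<lambda>\<xi>. \<xi>) \<in> borel_measurable circle_borel" by (intro borel_measurable_circle continuous_intros)
  have [measurable]: "fst \<in> borel_measurable (arc_measure \<Otimes>\<^sub>M arc_measure)"
    using measurable_compose[OF measurable_fst[of arc_measure arc_measure], of "\<lambda>x. x" borel] by simp
  have [measurable]: "snd \<in> borel_measurable (arc_measure \<Otimes>\<^sub>M arc_measure)"
    using measurable_compose[OF measurable_snd[of arc_measure arc_measure], of "\<lambda>x. x" borel] by simp
  show ?thesis unfolding poisson_kernel_def case_prod_unfold by measurable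
qed

text \<open>On \<open>A\<close> the measure \<open>\<nu>\<close> is at least \<open>c\<close> times arc length, so the Poisson integral of \<open>\<nu>\<close> at \<open>z\<close> is at least \<open>c * p z\<close>, where
  \<open>p z\<close>, the Poisson integral of the indicator of \<open>A\<close>, lies between 0 and 1. By convexity of the exponential,
  \<open>norm (\<theta> z) \<le> 1 - \<beta> * p z\<close> with \<open>\<beta> = 1 - exp (-c)\<close>. The mean of \<open>p\<close> over every circle is the arc length of
  \<open>A\<close>, while the means of \<open>(norm \<theta>)\<^sup>2\<close> tend to one.\<close>

lemma dominated_arc_null:
  assumes \<theta>: "inner_function \<theta>" and "finite_measure \<nu>" and sets: "sets \<nu> = sets circle_borel"
    and bound: "\<And>z. norm z < 1 \<Longrightarrow> norm (\<theta> z) \<le> exp (- (\<integral>\<xi>. poisson_kernel z \<xi> \<partial>\<nu>))"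
    and A: "A \<in> sets circle_borel" and c: "c > 0"
    and dom: "\<And>X. X \<in> sets circle_borel \<Longrightarrow> X \<subseteq> A \<Longrightarrow> ennreal c * emeasure arc_measure X \<le> emeasure \<nu> X"
  shows "emeasure arc_measure A = 0"
proof -
  interpret \<nu>: finite_measure \<nu> by fact
  interpret m: prob_space arc_measure by (rule prob_space_arc_measure)
  interpret mm: pair_sigma_finite arc_measure arc_measure ..
  have sp: "space \<nu> = sphere 0 1" using sets_eq_imp_space_eq[OF sets] by simp
  have A': "A \<in> sets arc_measure" using A by simp
  have pm: "poisson_kernel z \<in> borel_measurable circle_borel" if "norm z < 1" for z
    by (rule borel_measurable_circle[OF continuous_on_poisson_kernel[OF that]])
  define \<kappa> where "\<kappa> = density arc_measure (\<lambda>\<xi>. ennreal c * indicator A \<xi>)"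
  have \<kappa>_le: "emeasure \<kappa> X \<le> emeasure \<nu> X" if "X \<in> sets circle_borel" for X
  proof -
    have "emeasure \<kappa> X = (\<integral>\<^sup>+\<xi>. ennreal c * indicator (A \<inter> X) \<xi> \<partial>arc_measure)"
      unfolding \<kappa>_def using that A'
      by (subst emeasure_density) (auto intro!: nn_integral_cong simp: indicator_def)
    also have "\<dots> = ennreal c * emeasure arc_measure (A \<inter> X)"
      using that A by (simp add: nn_integral_cmult_indicator)
    also have "\<dots> \<le> emeasure \<nu> (A \<inter> X)" using that A by (intro dom) auto
    also have "\<dots> \<le> emeasure \<nu> X" using that by (intro emeasure_mono) (auto simp: sets)
    finally show ?thesis .
  qed
  define p where "p z = (\<integral>\<xi>. indicator A \<xi> * poisson_kernel z \<xi> \<partial>arc_measure)" for z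
  have iA: "integrable arc_measure (\<lambda>\<xi>. indicator A \<xi> * poisson_kernel z \<xi>)" if z: "norm z < 1" for z
    using integrable_mult_indicator[OF A' arc_integrable[OF continuous_on_poisson_kernel[OF z]]] by simp
  have p0: "p z \<ge> 0" if "norm z < 1" for z
    unfolding p_def using poisson_kernel_nonneg[OF that] by (intro integral_nonneg_AE AE_I2) auto
  have pe: "ennreal (p z) = (\<integral>\<^sup>+\<xi>. indicator A \<xi> * ennreal (poisson_kernel z \<xi>) \<partial>arc_measure)" if z: "norm z < 1" for z
    unfolding p_def using poisson_kernel_nonneg[OF z]
    by (subst nn_integral_eq_integral[OF iA[OF z], symmetric]) (auto intro!: nn_integral_cong simp: indicator_def)
  have cp: "c * p z \<le> (\<integral>\<xi>. poisson_kernel z \<xi> \<partial>\<nu>)" if z: "norm z < 1" for z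
  proof -
    have i\<nu>: "integrable \<nu> (poisson_kernel z)"
      by (rule circle_integrable[OF \<open>finite_measure \<nu>\<close> sets continuous_on_poisson_kernel[OF z]])
    have "ennreal (c * p z) = (\<integral>\<^sup>+\<xi>. (ennreal c * indicator A \<xi>) * ennreal (poisson_kernel z \<xi>) \<partial>arc_measure)"
      using c pe[OF z] p0[OF z] pm[OF z] A by (simp add: ennreal_mult mult.assoc nn_integral_cmult)
    also have "\<dots> = (\<integral>\<^sup>+\<xi>. ennreal (poisson_kernel z \<xi>) \<partial>\<kappa>)"
      unfolding \<kappa>_def using pm[OF z] A by (subst nn_integral_density) auto
    also have "\<dots> \<le> (\<integral>\<^sup>+\<xi>. ennreal (poisson_kernel z \<xi>) \<partial>\<nu>)"
      using \<kappa>_le by (intro nn_integral_mono_measure) (auto simp: sets \<kappa>_def)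
    also have "\<dots> = ennreal (\<integral>\<xi>. poisson_kernel z \<xi> \<partial>\<nu>)"
      using poisson_kernel_nonneg[OF z] by (intro nn_integral_eq_integral i\<nu>) auto
    finally show ?thesis
      using poisson_kernel_nonneg[OF z] by (subst (asm) ennreal_le_iff) (auto intro!: integral_nonneg_AE)
  qed
  define \<alpha> where "\<alpha> = measure arc_measure A"
  have r: "0 \<le> radii k" "radii k < 1" for k using radii_bounds[of k] by auto
  have lt: "norm (of_real (radii k) * \<xi>) < 1" if "norm \<xi> = 1" for k and \<xi> :: complex
    using r[of k] that by (simp add: norm_mult)
  have Fm: "(\<lambda>(\<xi>, \<eta>). indicator A \<eta> * ennreal (poisson_kernel (of_real (radii k) * \<xi>) \<eta>))
      \<in> borel_measurable (arc_measure \<Otimes>\<^sub>M arc_measure)" for k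
  proof -
    from borel_measurable_times_ennreal[OF
        measurable_compose[OF measurable_snd borel_measurable_indicator[OF A']]
        measurable_compose[OF borel_measurable_poisson_kernel_pair[of "radii k"] measurable_ennreal]]
    show ?thesis by (simp add: case_prod_unfold)
  qed
  have pmeas: "(\<lambda>\<xi>. ennreal (p (of_real (radii k) * \<xi>))) \<in> borel_measurable arc_measure" for k
    using m.borel_measurable_nn_integral_fst[OF Fm[of k]]
    by (subst measurable_cong[of arc_measure _ "\<lambda>\<xi>. \<integral>\<^sup>+\<eta>. indicator A \<eta> * ennreal (poisson_kernel (of_real (radii k) * \<xi>) \<eta>) \<partial>arc_measure"])
      (use pe[OF lt] in auto)
  have mean_p: "(\<integral>\<^sup>+\<xi>. ennreal (p (of_real (radii k) * \<xi>)) \<partial>arc_measure) = ennreal \<alpha>" for k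
  proof -
    have "(\<integral>\<^sup>+\<xi>. ennreal (p (of_real (radii k) * \<xi>)) \<partial>arc_measure) =
      (\<integral>\<^sup>+\<xi>. (\<integral>\<^sup>+\<eta>. indicator A \<eta> * ennreal (poisson_kernel (of_real (radii k) * \<xi>) \<eta>) \<partial>arc_measure) \<partial>arc_measure)"
      using pe[OF lt] by (intro nn_integral_cong) simp
    also have "\<dots> = (\<integral>\<^sup>+\<eta>. (\<integral>\<^sup>+\<xi>. indicator A \<eta> * ennreal (poisson_kernel (of_real (radii k) * \<xi>) \<eta>) \<partial>arc_measure) \<partial>arc_measure)"
      by (rule mm.Fubini'[symmetric]) (rule Fm)
    also have "\<dots> = (\<integral>\<^sup>+\<eta>. indicator A \<eta> \<partial>arc_measure)"
    proof (rule nn_integral_cong)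
      fix \<eta> assume "\<eta> \<in> space arc_measure"
      hence \<eta>: "norm \<eta> = 1" by simp
      show "(\<integral>\<^sup>+\<xi>. indicator A \<eta> * ennreal (poisson_kernel (of_real (radii k) * \<xi>) \<eta>) \<partial>arc_measure) = indicator A \<eta>"
        by (cases "\<eta> \<in> A") (simp_all add: poisson_kernel_mean[OF \<eta> r])
    qed
    also have "\<dots> = ennreal \<alpha>" using A' by (simp add: \<alpha>_def m.emeasure_eq_measure)
    finally show ?thesis .
  qed
  have p1: "p (of_real (radii k) * \<xi>) \<le> 1" if x: "norm \<xi> = 1" for k \<xi>
  proof -
    have "ennreal (p (of_real (radii k) * \<xi>)) \<le> (\<integral>\<^sup>+\<eta>. ennreal (poisson_kernel (of_real (radii k) * \<xi>) \<eta>) \<partial>arc_measure)"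
      unfolding pe[OF lt[OF x]] by (intro nn_integral_mono) (auto simp: indicator_def)
    also have "\<dots> = (\<integral>\<^sup>+\<eta>. ennreal (poisson_kernel (of_real (radii k) * \<eta>) \<xi>) \<partial>arc_measure)"
      using x by (intro nn_integral_cong) (simp add: poisson_kernel_radial_swap)
    also have "\<dots> = ennreal 1" using poisson_kernel_mean[OF x r] by simp
    finally show ?thesis by (subst (asm) ennreal_le_iff) auto
  qed
  define \<beta> where "\<beta> = 1 - exp (- c)"
  have \<beta>: "\<beta> > 0" "\<beta> \<le> 1" using c by (auto simp: \<beta>_def)
  have key: "(norm (\<theta> (of_real (radii k) * \<xi>)))\<^sup>2 + \<beta> * p (of_real (radii k) * \<xi>) \<le> 1" if x: "norm \<xi> = 1" for k \<xi>
  proof -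
    let ?z = "of_real (radii k) * \<xi>" and ?x = "p (of_real (radii k) * \<xi>)"
    have "(norm (\<theta> ?z))\<^sup>2 \<le> norm (\<theta> ?z)"
      using inner_functionD(2)[OF \<theta> lt[OF x], of k] by (simp add: power2_eq_square mult_left_le)
    also have "\<dots> \<le> exp (- (\<integral>\<xi>. poisson_kernel ?z \<xi> \<partial>\<nu>))" by (rule bound[OF lt[OF x]])
    also have "\<dots> \<le> exp (- (c * ?x))" using cp[OF lt[OF x], of k] by simp
    also have "\<dots> = exp ((1 - ?x) *\<^sub>R 0 + ?x *\<^sub>R (- c))" by (simp add: mult.commute)
    also have "\<dots> \<le> (1 - ?x) * exp 0 + ?x * exp (- c)"
      using p0[OF lt[OF x], of k] p1[OF x, of k]
      by (intro convex_onD[OF exp_convex]) auto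
    finally show ?thesis by (simp add: \<beta>_def algebra_simps)
  qed
  have "(\<integral>\<xi>. (norm (\<theta> (of_real (radii k) * \<xi>)))\<^sup>2 \<partial>arc_measure) + \<beta> * \<alpha> \<le> 1" for k
  proof -
    have "ennreal ((\<integral>\<xi>. (norm (\<theta> (of_real (radii k) * \<xi>)))\<^sup>2 \<partial>arc_measure) + \<beta> * \<alpha>) =
      (\<integral>\<^sup>+\<xi>. ennreal ((norm (\<theta> (of_real (radii k) * \<xi>)))\<^sup>2) \<partial>arc_measure) + ennreal \<beta> * ennreal \<alpha>"
    proof -
      have "integrable arc_measure (\<lambda>\<xi>. (norm (\<theta> (of_real (radii k) * \<xi>)))\<^sup>2)"
        by (intro arc_integrable continuous_intros disc_circle_continuous inner_functionD[OF \<theta>] r)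
      hence "(\<integral>\<^sup>+\<xi>. ennreal ((norm (\<theta> (of_real (radii k) * \<xi>)))\<^sup>2) \<partial>arc_measure) =
          ennreal (\<integral>\<xi>. (norm (\<theta> (of_real (radii k) * \<xi>)))\<^sup>2 \<partial>arc_measure)"
        by (rule nn_integral_eq_integral) simp
      thus ?thesis using \<beta> by (simp add: \<alpha>_def ennreal_mult ennreal_plus integral_nonneg_AE)
    qed
    also have "ennreal \<beta> * ennreal \<alpha> = (\<integral>\<^sup>+\<xi>. ennreal \<beta> * ennreal (p (of_real (radii k) * \<xi>)) \<partial>arc_measure)"
      unfolding mean_p[of k, symmetric] by (rule nn_integral_cmult[OF pmeas, symmetric])
    also have "(\<integral>\<^sup>+\<xi>. ennreal ((norm (\<theta> (of_real (radii k) * \<xi>)))\<^sup>2) \<partial>arc_measure) +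
        (\<integral>\<^sup>+\<xi>. ennreal \<beta> * ennreal (p (of_real (radii k) * \<xi>)) \<partial>arc_measure) =
        (\<integral>\<^sup>+\<xi>. ennreal ((norm (\<theta> (of_real (radii k) * \<xi>)))\<^sup>2) + ennreal \<beta> * ennreal (p (of_real (radii k) * \<xi>)) \<partial>arc_measure)"
    proof -
      have "(\<lambda>\<xi>. (norm (\<theta> (of_real (radii k) * \<xi>)))\<^sup>2) \<in> borel_measurable circle_borel"
        by (intro borel_measurable_circle continuous_intros disc_circle_continuous inner_functionD[OF \<theta>] r)
      hence "(\<lambda>\<xi>. ennreal ((norm (\<theta> (of_real (radii k) * \<xi>)))\<^sup>2)) \<in> borel_measurable arc_measure" by simp
      thus ?thesis by (intro nn_integral_add[symmetric] borel_measurable_times_ennreal borel_measurable_const pmeas)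
    qed
    also have "\<dots> \<le> (\<integral>\<^sup>+\<xi>. 1 \<partial>arc_measure)"
    proof (rule nn_integral_mono)
      fix \<xi> assume "\<xi> \<in> space arc_measure"
      hence x: "norm \<xi> = 1" by simp
      have "ennreal ((norm (\<theta> (of_real (radii k) * \<xi>)))\<^sup>2) + ennreal \<beta> * ennreal (p (of_real (radii k) * \<xi>)) =
        ennreal ((norm (\<theta> (of_real (radii k) * \<xi>)))\<^sup>2 + \<beta> * p (of_real (radii k) * \<xi>))"
        using \<beta> p0[OF lt[OF x], of k] by (simp add: ennreal_mult ennreal_plus)
      also have "\<dots> \<le> ennreal 1" using key[OF x, of k] by (rule ennreal_leI)
      finally show "ennreal ((norm (\<theta> (of_real (radii k) * \<xi>)))\<^sup>2) + ennreal \<beta> * ennreal (p (of_real (radii k) * \<xi>)) \<le> 1" by simp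
    qed
    also have "\<dots> = ennreal 1" using emeasure_arc_measure_space by simp
    finally show ?thesis by (subst (asm) ennreal_le_iff) auto
  qed
  moreover have "(\<lambda>k. (\<integral>\<xi>. (norm (\<theta> (of_real (radii k) * \<xi>)))\<^sup>2 \<partial>arc_measure) + \<beta> * \<alpha>) \<longlonglongrightarrow> 1 + \<beta> * \<alpha>"
    using inner_function_mean_limit[OF \<theta>, of "\<lambda>_. 1"] m.prob_space by (intro tendsto_intros) simp
  ultimately have "1 + \<beta> * \<alpha> \<le> 1" by (intro tendsto_upperbound[OF _ always_eventually]) auto
  hence "\<beta> * \<alpha> \<le> 0" by simp
  hence "\<alpha> = 0" using \<beta> by (simp add: mult_le_0_iff \<alpha>_def) (smt (verit) measure_nonneg)
  thus ?thesis by (simp add: \<alpha>_def m.emeasure_eq_measure)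
qed

text \<open>Hahn decompositions of \<open>\<nu>\<close> against small multiples \<open>c k\<close> of arc length. The parts \<open>Y k\<close> where \<open>\<nu>\<close> dominates have
  length zero by \<open>dominated_arc_null\<close>. Off their union \<open>\<nu>\<close> is dominated by every \<open>c k\<close> times arc length, so it
  vanishes there.\<close>

lemma herglotz_measure_singular:
  assumes \<theta>: "inner_function \<theta>" and fin: "finite_measure \<nu>" and sets: "sets \<nu> = sets circle_borel"
    and bound: "\<And>z. norm z < 1 \<Longrightarrow> norm (\<theta> z) \<le> exp (- (\<integral>\<xi>. poisson_kernel z \<xi> \<partial>\<nu>))"
  shows "singular_circle_measure \<nu>"
proof -
  interpret m: prob_space arc_measure by (rule prob_space_arc_measure)
  define c where "c k = inverse (real (Suc k))" for k
  have c: "c k > 0" for k by (simp add: c_def)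
  have "\<exists>Y\<in>sets \<nu>. (\<forall>X\<in>sets \<nu>. X \<subseteq> Y \<longrightarrow> scale_measure (ennreal (c k)) arc_measure X \<le> \<nu> X) \<and>
     (\<forall>X\<in>sets \<nu>. X \<inter> Y = {} \<longrightarrow> \<nu> X \<le> scale_measure (ennreal (c k)) arc_measure X)" for k
  proof (rule finite_unsigned_Hahn_decomposition[OF fin])
    show "finite_measure (scale_measure (ennreal (c k)) arc_measure)"
      by (rule finite_measureI) (simp add: ennreal_mult_eq_top_iff space_scale_measure)
  qed (simp add: sets)
  then obtain Y where Y: "\<And>k. Y k \<in> sets circle_borel"
    and lo: "\<And>k X. X \<in> sets circle_borel \<Longrightarrow> X \<subseteq> Y k \<Longrightarrow> ennreal (c k) * emeasure arc_measure X \<le> emeasure \<nu> X"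
    and hi: "\<And>k X. X \<in> sets circle_borel \<Longrightarrow> X \<inter> Y k = {} \<Longrightarrow> emeasure \<nu> X \<le> ennreal (c k) * emeasure arc_measure X"
    unfolding sets emeasure_scale_measure by metis
  have Y0: "emeasure arc_measure (Y k) = 0" for k
    using dominated_arc_null[OF \<theta> fin sets bound Y c lo] by blast
  define N where "N = (\<Union>k. Y k)"
  have N: "N \<in> sets circle_borel" unfolding N_def using Y by auto
  have "emeasure arc_measure N = 0"
    unfolding N_def using Y Y0 by (intro emeasure_UN_eq_0) auto
  moreover have "emeasure \<nu> (sphere 0 1 - N) = 0"
  proof -
    have D: "sphere 0 1 - N \<in> sets circle_borel"
      using sets.compl_sets[OF N] by simp
    have "emeasure \<nu> (sphere 0 1 - N) \<le> ennreal (c k)" for k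
    proof -
      have "emeasure \<nu> (sphere 0 1 - N) \<le> ennreal (c k) * emeasure arc_measure (sphere 0 1 - N)"
        by (rule hi[OF D]) (auto simp: N_def)
      also have "\<dots> \<le> ennreal (c k) * 1"
        by (intro mult_left_mono m.emeasure_le_1) auto
      finally show ?thesis by simp
    qed
    moreover have "(\<lambda>k. ennreal (c k)) \<longlonglongrightarrow> ennreal 0"
      unfolding c_def by (intro tendsto_ennrealI LIMSEQ_inverse_real_of_nat)
    ultimately have "emeasure \<nu> (sphere 0 1 - N) \<le> ennreal 0"
      by (intro tendsto_lowerbound[OF _ always_eventually]) auto
    thus ?thesis by simp
  qed
  ultimately show ?thesis using N fin sets by (auto simp: singular_circle_measure_def)
qed

section \<open>The canonical factorization\<close>

text \<open>The means of \<open>(norm \<theta>)\<^sup>2\<close> over circles tend to one.\<close>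

lemma inner_function_not_zero:
  assumes \<theta>: "inner_function \<theta>"
  obtains z0 where "norm z0 < 1" "\<theta> z0 \<noteq> 0"
proof -
  interpret m: prob_space arc_measure by (rule prob_space_arc_measure)
  have "\<exists>z0. norm z0 < 1 \<and> \<theta> z0 \<noteq> 0"
  proof (rule ccontr)
    assume neg: "\<not> ?thesis"
    have "(\<integral>\<xi>. (norm (\<theta> (of_real (radii k) * \<xi>)))\<^sup>2 \<partial>arc_measure) = (\<integral>\<xi>. 0 \<partial>arc_measure)" for k
    proof (rule Bochner_Integration.integral_cong[OF refl])
      fix \<xi> assume "\<xi> \<in> space arc_measure"
      hence "norm (of_real (radii k) * \<xi>) < 1" using radii_bounds[of k] by (simp add: norm_mult)
      thus "(norm (\<theta> (of_real (radii k) * \<xi>)))\<^sup>2 = 0" using neg by simp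
    qed
    hence "(\<lambda>k. 0::real) \<longlonglongrightarrow> 1"
      using inner_function_mean_limit[OF \<theta>, of "\<lambda>_. 1"] m.prob_space by simp
    thus False using LIMSEQ_unique[OF _ tendsto_const] by fastforce
  qed
  thus ?thesis using that by blast
qed

lemma norm_singular_inner:
  assumes "finite_measure \<nu>" and sets: "sets \<nu> = sets circle_borel" and z: "norm z < 1"
  shows "norm (singular_inner \<nu> z) = exp (- (\<integral>\<xi>. poisson_kernel z \<xi> \<partial>\<nu>))"
proof -
  interpret finite_measure \<nu> by fact
  have sp: "space \<nu> = sphere 0 1" using sets_eq_imp_space_eq[OF sets] by simp
  have "integrable \<nu> (\<lambda>\<xi>. (\<xi> + z) / (\<xi> - z))"
    by (intro circle_integrable assms continuous_intros) (use z in auto)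
  from integral_Re[OF this] have "Re (\<integral>\<xi>. (\<xi> + z) / (\<xi> - z) \<partial>\<nu>) = (\<integral>\<xi>. Re ((\<xi> + z) / (\<xi> - z)) \<partial>\<nu>)" by simp
  also have "\<dots> = (\<integral>\<xi>. poisson_kernel z \<xi> \<partial>\<nu>)"
    by (intro Bochner_Integration.integral_cong refl Re_herglotz_kernel z) (simp add: sp)
  finally show ?thesis by (simp add: singular_inner_def)
qed

text \<open>The quotient of \<open>\<theta>\<close> by its Blaschke product has no zeros and is bounded by one, so it is \<open>exp (- H)\<close> with
  \<open>Re H\<close> nonnegative. The Herglotz measure of \<open>H\<close> generates the singular factor. The second conclusion is
  \<open>norm \<theta> = norm B * norm S\<close> with the Blaschke product \<open>B\<close> bounded by its partial products.\<close>

lemma canonical_factorization: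
  assumes \<theta>: "inner_function \<theta>"
  obtains \<nu> where "generates_singular_factor \<nu> \<theta>"
    "\<And>z F. norm z < 1 \<Longrightarrow> finite F \<Longrightarrow> F \<subseteq> disc_zeros \<theta> \<Longrightarrow>
       norm (\<theta> z) * exp (\<integral>\<xi>. poisson_kernel z \<xi> \<partial>\<nu>) \<le> norm (partial_blaschke \<theta> F z)"
proof -
  note \<theta>' = inner_functionD[OF \<theta>]
  obtain z0 where z0: "norm z0 < 1" "\<theta> z0 \<noteq> 0" using inner_function_not_zero[OF \<theta>] .
  obtain g where g: "g holomorphic_on ball 0 1" "\<And>z. norm z < 1 \<Longrightarrow> norm (g z) \<le> 1" "\<And>z. norm z < 1 \<Longrightarrow> g z \<noteq> 0"
    and eq: "\<And>z. norm z < 1 \<Longrightarrow> \<theta> z = blaschke_product \<theta> z * g z"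
    and Ble: "\<And>z F. norm z < 1 \<Longrightarrow> finite F \<Longrightarrow> F \<subseteq> disc_zeros \<theta> \<Longrightarrow> norm (blaschke_product \<theta> z) \<le> norm (partial_blaschke \<theta> F z)"
    using divide_blaschke_product[OF \<theta>'(1) \<theta>'(2) z0] by blast
  obtain L where L: "L holomorphic_on ball 0 1" "\<And>z. z \<in> ball 0 1 \<Longrightarrow> exp (L z) = g z"
    using holomorphic_logarithm_exists[of "ball 0 1" g 0] g by auto
  define H where "H z = - L z" for z
  have H: "H holomorphic_on ball 0 1" unfolding H_def using L by (intro holomorphic_intros)
  have gH: "g z = exp (- H z)" if "norm z < 1" for z using L(2)[of z] that by (simp add: H_def)
  have ReH: "Re (H z) \<ge> 0" if z: "norm z < 1" for z
  proof -
    have "exp (- Re (H z)) \<le> 1" using g(2)[OF z] gH[OF z] by simp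
    thus ?thesis by simp
  qed
  obtain \<nu> where \<nu>: "finite_measure \<nu>" "sets \<nu> = sets circle_borel"
    and rep: "\<And>z. norm z < 1 \<Longrightarrow> H z = \<i> * of_real (Im (H 0)) + (\<integral>\<xi>. (\<xi> + z) / (\<xi> - z) \<partial>\<nu>)"
    using herglotz_representation[OF H ReH] by blast
  define c where "c = exp (- (\<i> * of_real (Im (H 0))))"
  have c: "norm c = 1" by (simp add: c_def)
  have gS: "g z = c * singular_inner \<nu> z" if z: "norm z < 1" for z
    unfolding gH[OF z] rep[OF z] c_def singular_inner_def by (simp add: exp_diff exp_minus field_simps flip: exp_add)
  have ng: "norm (g z) = exp (- (\<integral>\<xi>. poisson_kernel z \<xi> \<partial>\<nu>))" if z: "norm z < 1" for z
    using gS[OF z] c norm_singular_inner[OF \<nu> z] by (simp add: norm_mult)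
  have n\<theta>: "norm (\<theta> z) \<le> norm (partial_blaschke \<theta> F z) * exp (- (\<integral>\<xi>. poisson_kernel z \<xi> \<partial>\<nu>))"
    if "norm z < 1" "finite F" "F \<subseteq> disc_zeros \<theta>" for z F
    using mult_right_mono[OF Ble[OF that], of "norm (g z)"] eq[OF that(1)] ng[OF that(1)] by (simp add: norm_mult)
  have "singular_circle_measure \<nu>"
    by (rule herglotz_measure_singular[OF \<theta> \<nu>]) (use n\<theta>[of _ "{}"] in \<open>simp add: partial_blaschke_def\<close>)
  hence gen: "generates_singular_factor \<nu> \<theta>"
    unfolding generates_singular_factor_def using c eq gS by (intro conjI exI[of _ c]) (auto simp: mult.left_commute mult.assoc)
  show ?thesis
  proof (rule that[OF gen])
    fix z :: complex and F assume "norm z < 1" "finite F" "F \<subseteq> disc_zeros \<theta>"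
    from n\<theta>[OF this] show "norm (\<theta> z) * exp (\<integral>\<xi>. poisson_kernel z \<xi> \<partial>\<nu>) \<le> norm (partial_blaschke \<theta> F z)"
      by (simp add: exp_minus field_simps)
  qed
qed

section \<open>The Ahern--Clark condition\<close>

text \<open>The factorization bounds both \<open>1 - (norm b)\<^sup>2\<close> summed over the Blaschke factors and the Poisson integral of
  \<open>\<nu>\<close> by \<open>- ln (norm \<theta>)\<close>, which is comparable to \<open>1 - (norm \<theta>)\<^sup>2\<close>. Each of these quantities carries the factor
  \<open>1 - (norm z)\<^sup>2\<close>, which is divided out.\<close>

lemma ahern_clark_finite_bound:
  assumes z: "norm z < 1" and F: "finite F" "F \<subseteq> ball 0 1"
    and fact: "norm (\<theta> z) * exp (\<integral>\<xi>. poisson_kernel z \<xi> \<partial>\<nu>) \<le> norm (partial_blaschke \<theta> F z)"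
    and le1: "norm (\<theta> z) \<le> 1" and big: "(norm (\<theta> z))\<^sup>2 \<ge> 1/2" and C: "(1 - (norm (\<theta> z))\<^sup>2) / (1 - (norm z)\<^sup>2) \<le> C"
  shows "(\<Sum>a\<in>F. real (zero_mult \<theta> a) * ((1 - (norm a)\<^sup>2) / (norm (1 - cnj a * z))\<^sup>2)) +
     2 * (\<integral>\<xi>. 1 / (norm (\<xi> - z))\<^sup>2 \<partial>\<nu>) \<le> 2 * C"
proof -
  let ?I = "\<integral>\<xi>. 1 / (norm (\<xi> - z))\<^sup>2 \<partial>\<nu>"
  let ?S = "\<Sum>a\<in>F. real (zero_mult \<theta> a) * ((1 - (norm a)\<^sup>2) / (norm (1 - cnj a * z))\<^sup>2)"
  have q: "1 - (norm z)\<^sup>2 > 0" using z by (simp add: abs_square_less_1)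
  have t: "norm (\<theta> z) > 0" using big by (cases "\<theta> z = 0") auto
  have I: "(\<integral>\<xi>. poisson_kernel z \<xi> \<partial>\<nu>) = (1 - (norm z)\<^sup>2) * ?I"
    unfolding poisson_kernel_def
    using integral_mult_right_zero[of \<nu> "1 - (norm z)\<^sup>2" "\<lambda>\<xi>. 1 / (norm (\<xi> - z))\<^sup>2"] by simp
  have "(\<Sum>a\<in>F. real (zero_mult \<theta> a) * (1 - (norm (blaschke_factor a z))\<^sup>2)) = (1 - (norm z)\<^sup>2) * ?S"
    unfolding sum_distrib_left
    by (intro sum.cong refl) (use F z in \<open>auto simp: one_minus_norm_blaschke_factor_sq subset_eq\<close>)
  moreover have "(\<Sum>a\<in>F. real (zero_mult \<theta> a) * (1 - (norm (blaschke_factor a z))\<^sup>2)) \<le>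
     - 2 * ln (norm (\<theta> z) * exp (\<integral>\<xi>. poisson_kernel z \<xi> \<partial>\<nu>))"
    using t by (intro blaschke_log_sum_le F z fact) auto
  moreover have "ln (norm (\<theta> z) * exp (\<integral>\<xi>. poisson_kernel z \<xi> \<partial>\<nu>)) = ln (norm (\<theta> z)) + (1 - (norm z)\<^sup>2) * ?I"
    using t by (simp add: ln_mult I)
  moreover have "- 2 * ln (norm (\<theta> z)) \<le> 2 * (1 - (norm (\<theta> z))\<^sup>2)"
  proof -
    have "- 2 * ln (norm (\<theta> z)) = ln (1 / (norm (\<theta> z))\<^sup>2)"
      using t by (simp add: ln_div ln_realpow)
    also have "\<dots> \<le> 1 / (norm (\<theta> z))\<^sup>2 - 1" using t by (intro ln_le_minus_one) simp
    also have "\<dots> = (1 - (norm (\<theta> z))\<^sup>2) * (1 / (norm (\<theta> z))\<^sup>2)" using t by (simp add: field_simps)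
    also have "\<dots> \<le> (1 - (norm (\<theta> z))\<^sup>2) * 2"
      using big t le1 by (intro mult_left_mono) (auto simp: field_simps abs_square_le_1)
    also have "\<dots> = 2 * (1 - (norm (\<theta> z))\<^sup>2)" by simp
    finally show ?thesis .
  qed
  moreover have "1 - (norm (\<theta> z))\<^sup>2 \<le> C * (1 - (norm z)\<^sup>2)" using C q by (simp add: pos_divide_le_eq)
  ultimately have "(1 - (norm z)\<^sup>2) * (?S + 2 * ?I) \<le> (1 - (norm z)\<^sup>2) * (2 * C)"
    by (simp add: algebra_simps)
  thus ?thesis using q by simp
qed

text \<open>The squared norm of the kernel is the quotient bounded in \<open>ahern_clark_finite_bound\<close>. The points \<open>z k\<close> tend
  to \<open>\<zeta>\<close>: finite sums over zeros converge, and the integral is treated by Fatou's lemma, which also covers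
  a possible atom of \<open>\<nu>\<close> at \<open>\<zeta>\<close>.\<close>

lemma ahern_clark_of_bounded_kernels:
  assumes \<theta>: "inner_function \<theta>" and \<zeta>: "norm \<zeta> = 1" and z: "\<And>k. norm (z k) < 1" "z \<longlonglongrightarrow> \<zeta>"
    and bounded: "\<And>k. hardy2_norm (model_kernel \<theta> (z k)) \<le> C"
  shows "\<zeta> \<in> ahern_clark_set \<theta>"
proof -
  obtain \<nu> where gen: "generates_singular_factor \<nu> \<theta>"
    and fact: "\<And>z F. norm z < 1 \<Longrightarrow> finite F \<Longrightarrow> F \<subseteq> disc_zeros \<theta> \<Longrightarrow>
       norm (\<theta> z) * exp (\<integral>\<xi>. poisson_kernel z \<xi> \<partial>\<nu>) \<le> norm (partial_blaschke \<theta> F z)"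
    using canonical_factorization[OF \<theta>] by blast
  have \<nu>: "finite_measure \<nu>" "sets \<nu> = sets circle_borel"
    using gen by (auto simp: generates_singular_factor_def singular_circle_measure_def)
  have sp: "space \<nu> = sphere 0 1" using sets_eq_imp_space_eq[OF \<nu>(2)] by simp
  have K: "(1 - (norm (\<theta> (z k)))\<^sup>2) / (1 - (norm (z k))\<^sup>2) \<le> C\<^sup>2" for k
    unfolding model_kernel_norm_sq[OF \<theta> z(1), symmetric]
    using bounded[of k] model_spaceD(1)[OF model_kernel(1)[OF \<theta> z(1)], of k] by (intro power_mono) auto
  have "(\<lambda>k. 1 - C\<^sup>2 * (1 - (norm (z k))\<^sup>2)) \<longlonglongrightarrow> 1 - C\<^sup>2 * (1 - (norm \<zeta>)\<^sup>2)" by (intro tendsto_intros z)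
  hence "\<forall>\<^sub>F k in sequentially. 1 - C\<^sup>2 * (1 - (norm (z k))\<^sup>2) > 1/2"
    using \<zeta> by (intro order_tendstoD(1)) auto
  hence big: "\<forall>\<^sub>F k in sequentially. (norm (\<theta> (z k)))\<^sup>2 \<ge> 1/2"
  proof eventually_elim
    case (elim k)
    have "1 - (norm (z k))\<^sup>2 > 0" using z(1)[of k] by (simp add: abs_square_less_1)
    with K[of k] have "1 - (norm (\<theta> (z k)))\<^sup>2 \<le> C\<^sup>2 * (1 - (norm (z k))\<^sup>2)" by (simp add: pos_divide_le_eq)
    with elim show ?case by simp
  qed
  have inonneg: "(\<integral>\<xi>. 1 / (norm (\<xi> - z k))\<^sup>2 \<partial>\<nu>) \<ge> 0" for k by (intro integral_nonneg_AE AE_I2) simp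
  let ?t = "\<lambda>z a. real (zero_mult \<theta> a) * ((1 - (norm a)\<^sup>2) / (norm (1 - cnj a * z))\<^sup>2)"
  have tpos: "?t z a \<ge> 0" if "a \<in> disc_zeros \<theta>" for a z
    using that by (auto simp: disc_zeros_def abs_square_le_1)
  have Fsum: "(\<Sum>a\<in>F. real (zero_mult \<theta> a) * ((1 - (norm a)\<^sup>2) / (norm (\<zeta> - a))\<^sup>2)) \<le> 2 * C\<^sup>2"
    if F: "finite F" "F \<subseteq> disc_zeros \<theta>" for F
  proof -
    have Fb: "F \<subseteq> ball 0 1" using F by (auto simp: disc_zeros_def)
    have "norm (1 - cnj a * \<zeta>) = norm (\<zeta> - a)" for a
    proof -
      have "\<zeta> * cnj \<zeta> = 1" using complex_norm_square[of \<zeta>] \<zeta> by simp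
      hence "1 - cnj a * \<zeta> = \<zeta> * cnj (\<zeta> - a)" by (simp add: algebra_simps)
      thus ?thesis using \<zeta> by (metis complex_mod_cnj mult_1 norm_mult)
    qed
    hence "(\<Sum>a\<in>F. real (zero_mult \<theta> a) * ((1 - (norm a)\<^sup>2) / (norm (\<zeta> - a))\<^sup>2)) = (\<Sum>a\<in>F. ?t \<zeta> a)" by simp
    also have "\<dots> \<le> 2 * C\<^sup>2"
    proof (rule tendsto_upperbound)
      show "(\<lambda>k. \<Sum>a\<in>F. ?t (z k) a) \<longlonglongrightarrow> (\<Sum>a\<in>F. ?t \<zeta> a)"
      proof (intro tendsto_intros z)
        fix a assume "a \<in> F"
        hence "norm (cnj a * \<zeta>) < 1" using Fb \<zeta> by (auto simp: norm_mult)
        thus "(norm (1 - cnj a * \<zeta>))\<^sup>2 \<noteq> 0" by auto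
      qed
      show "\<forall>\<^sub>F k in sequentially. (\<Sum>a\<in>F. ?t (z k) a) \<le> 2 * C\<^sup>2"
        using big
      proof eventually_elim
        case (elim k)
        show ?case
          using ahern_clark_finite_bound[OF z(1) F(1) Fb fact[OF z(1) F] inner_functionD(2)[OF \<theta> z(1)] elim K] inonneg[of k] by linarith
      qed
    qed simp
    finally show ?thesis .
  qed
  have "(\<Sum>\<^sub>\<infinity>a\<in>disc_zeros \<theta>. ennreal (real (zero_mult \<theta> a) * ((1 - (norm a)\<^sup>2) / (norm (\<zeta> - a))\<^sup>2))) \<le> ennreal (2 * C\<^sup>2)"
  proof (subst nonneg_infsum_complete)
    show "(SUP F\<in>{F. finite F \<and> F \<subseteq> disc_zeros \<theta>}. \<Sum>a\<in>F. ennreal (real (zero_mult \<theta> a) * ((1 - (norm a)\<^sup>2) / (norm (\<zeta> - a))\<^sup>2)))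
        \<le> ennreal (2 * C\<^sup>2)"
    proof (rule SUP_least)
      fix F assume "F \<in> {F. finite F \<and> F \<subseteq> disc_zeros \<theta>}"
      hence F: "finite F" "F \<subseteq> disc_zeros \<theta>" by auto
      have "(\<Sum>a\<in>F. ennreal (real (zero_mult \<theta> a) * ((1 - (norm a)\<^sup>2) / (norm (\<zeta> - a))\<^sup>2))) =
         ennreal (\<Sum>a\<in>F. real (zero_mult \<theta> a) * ((1 - (norm a)\<^sup>2) / (norm (\<zeta> - a))\<^sup>2))"
        using F by (intro sum_ennreal) (auto simp: disc_zeros_def abs_square_le_1)
      also have "\<dots> \<le> ennreal (2 * C\<^sup>2)" using Fsum[OF F] by (rule ennreal_leI)
      finally show "(\<Sum>a\<in>F. ennreal (real (zero_mult \<theta> a) * ((1 - (norm a)\<^sup>2) / (norm (\<zeta> - a))\<^sup>2))) \<le> ennreal (2 * C\<^sup>2)" .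
    qed
  qed simp
  moreover have "(\<integral>\<^sup>+\<xi>. 1 / ennreal ((norm (\<zeta> - \<xi>))\<^sup>2) \<partial>\<nu>) \<le> ennreal (C\<^sup>2)"
  proof -
    let ?u = "\<lambda>k \<xi>. inverse (ennreal ((norm (z k - \<xi>))\<^sup>2))"
    have um: "?u k \<in> borel_measurable \<nu>" for k
    proof -
      have "(\<lambda>\<xi>. (norm (z k - \<xi>))\<^sup>2) \<in> borel_measurable circle_borel" by (intro borel_measurable_circle continuous_intros)
      hence "(\<lambda>\<xi>. (norm (z k - \<xi>))\<^sup>2) \<in> borel_measurable \<nu>" by (simp add: measurable_cong_sets[OF \<nu>(2) refl])
      thus ?thesis by measurable
    qed
    have lim: "(\<lambda>k. ?u k \<xi>) \<longlonglongrightarrow> inverse (ennreal ((norm (\<zeta> - \<xi>))\<^sup>2))" for \<xi>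
    proof -
      have "isCont (\<lambda>x::ennreal. inverse x) y" for y
        using continuous_on_inverse_ennreal[OF continuous_on_id, of UNIV] by (simp add: continuous_on_eq_continuous_at)
      moreover have "(\<lambda>k. ennreal ((norm (z k - \<xi>))\<^sup>2)) \<longlonglongrightarrow> ennreal ((norm (\<zeta> - \<xi>))\<^sup>2)"
        by (intro tendsto_ennrealI tendsto_intros z)
      ultimately show ?thesis by (rule isCont_tendsto_compose)
    qed
    have "(\<integral>\<^sup>+\<xi>. 1 / ennreal ((norm (\<zeta> - \<xi>))\<^sup>2) \<partial>\<nu>) = (\<integral>\<^sup>+\<xi>. liminf (\<lambda>k. ?u k \<xi>) \<partial>\<nu>)"
      using lim_imp_Liminf[OF sequentially_bot lim] by (intro nn_integral_cong) (simp add: divide_ennreal_def)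
    also have "\<dots> \<le> liminf (\<lambda>k. \<integral>\<^sup>+\<xi>. ?u k \<xi> \<partial>\<nu>)" by (rule nn_integral_liminf[OF um])
    also have "\<dots> \<le> liminf (\<lambda>k. ennreal (C\<^sup>2))"
    proof (rule Liminf_mono)
      show "\<forall>\<^sub>F k in sequentially. (\<integral>\<^sup>+\<xi>. ?u k \<xi> \<partial>\<nu>) \<le> ennreal (C\<^sup>2)"
        using big
      proof eventually_elim
        case (elim k)
        have q: "1 - (norm (z k))\<^sup>2 > 0" using z(1)[of k] by (simp add: abs_square_less_1)
        have "(\<lambda>\<xi>. 1 / (norm (\<xi> - z k))\<^sup>2) = (\<lambda>\<xi>. 1 / (1 - (norm (z k))\<^sup>2) * poisson_kernel (z k) \<xi>)"
          using q by (simp add: poisson_kernel_def fun_eq_iff)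
        hence int: "integrable \<nu> (\<lambda>\<xi>. 1 / (norm (\<xi> - z k))\<^sup>2)"
          using circle_integrable[OF \<nu> continuous_on_poisson_kernel[OF z(1)[of k]]] by simp
        have "(\<integral>\<^sup>+\<xi>. ?u k \<xi> \<partial>\<nu>) = (\<integral>\<^sup>+\<xi>. ennreal (1 / (norm (\<xi> - z k))\<^sup>2) \<partial>\<nu>)"
        proof (rule nn_integral_cong)
          fix \<xi> assume "\<xi> \<in> space \<nu>"
          hence "\<xi> \<noteq> z k" using z(1)[of k] by (auto simp: sp)
          hence "(norm (z k - \<xi>))\<^sup>2 > 0" by simp
          from inverse_ennreal[OF this] show "?u k \<xi> = ennreal (1 / (norm (\<xi> - z k))\<^sup>2)"
            by (simp add: inverse_eq_divide norm_minus_commute)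
        qed
        also have "\<dots> = ennreal (\<integral>\<xi>. 1 / (norm (\<xi> - z k))\<^sup>2 \<partial>\<nu>)"
          by (intro nn_integral_eq_integral int) simp
        also have "\<dots> \<le> ennreal (C\<^sup>2)"
          using ahern_clark_finite_bound[of "z k" "{}", OF z(1) _ _ fact[OF z(1), of "{}"] inner_functionD(2)[OF \<theta> z(1)] elim K]
          by (intro ennreal_leI) simp
        finally show ?case .
      qed
    qed
    also have "\<dots> = ennreal (C\<^sup>2)" by (rule Liminf_const) simp
    finally show ?thesis .
  qed
  ultimately have "(\<Sum>\<^sub>\<infinity>a\<in>disc_zeros \<theta>. ennreal (real (zero_mult \<theta> a) * ((1 - (norm a)\<^sup>2) / (norm (\<zeta> - a))\<^sup>2)))
       + (\<integral>\<^sup>+\<xi>. 1 / ennreal ((norm (\<zeta> - \<xi>))\<^sup>2) \<partial>\<nu>) \<le> ennreal (2 * C\<^sup>2) + ennreal (C\<^sup>2)"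
    by (rule add_mono)
  also have "\<dots> < \<infinity>" by simp
  finally show ?thesis
    unfolding ahern_clark_set_def using gen \<zeta> by auto
qed

lemma localization_imp_ahern_clark:
  assumes \<theta>: "inner_function \<theta>" and \<zeta>: "norm \<zeta> = 1" and loc: "localization_property \<theta> \<zeta>"
  shows "\<zeta> \<in> ahern_clark_set \<theta>"
proof -
  define w where "w n = of_real (radii n) * \<zeta>" for n
  have w: "norm (w n) < 1" for n using \<zeta> radii_bounds[of n] by (simp add: w_def norm_mult)
  have wl: "w \<longlonglongrightarrow> of_real 1 * \<zeta>" unfolding w_def by (intro tendsto_intros radii_tendsto)
  have "\<not> filterlim (\<lambda>n. hardy2_norm (model_kernel \<theta> (w n))) at_top sequentially"
    using localization_imp_kernels_not_unbounded[OF \<theta> \<zeta> loc] by (simp add: w_def)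
  then obtain C where C: "\<not> (\<forall>\<^sub>F n in sequentially. C \<le> hardy2_norm (model_kernel \<theta> (w n)))"
    by (auto simp: filterlim_at_top)
  from C have "\<exists>\<^sub>F n in sequentially. hardy2_norm (model_kernel \<theta> (w n)) \<le> C"
    unfolding frequently_def
  proof (rule contrapos_nn)
    assume "\<forall>\<^sub>F n in sequentially. \<not> hardy2_norm (model_kernel \<theta> (w n)) \<le> C"
    thus "\<forall>\<^sub>F n in sequentially. C \<le> hardy2_norm (model_kernel \<theta> (w n))" by (rule eventually_mono) simp
  qed
  hence "infinite {n. hardy2_norm (model_kernel \<theta> (w n)) \<le> C}"
    by (simp add: frequently_cofinite flip: cofinite_eq_sequentially)
  then obtain s :: "nat \<Rightarrow> nat" where s: "strict_mono s" "\<And>n. hardy2_norm (model_kernel \<theta> (w (s n))) \<le> C"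
    using infinite_enumerate by blast
  have "(\<lambda>n. w (s n)) \<longlonglongrightarrow> \<zeta>" using LIMSEQ_subseq_LIMSEQ[OF wl s(1)] by (simp add: comp_def)
  from ahern_clark_of_bounded_kernels[OF \<theta> \<zeta> w this s(2)] show ?thesis .
qed

theorem theorem1p2:
  fixes \<theta> :: "complex \<Rightarrow> complex" and \<zeta> :: complex
  assumes "inner_function \<theta>" and "\<zeta> \<in> sphere 0 1"
  shows "((\<exists>w::nat \<Rightarrow> complex. (\<forall>n. w n \<in> ball 0 1) \<and> w \<longlonglongrightarrow> \<zeta> \<and>
             overcomplete_in (model_space \<theta>) (\<lambda>n. model_kernel \<theta> (w n)))
           \<longleftrightarrow> localization_property \<theta> \<zeta>)
         \<and> (localization_property \<theta> \<zeta> \<longrightarrow> \<zeta> \<in> ahern_clark_set \<theta>)"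
proof (intro conjI iffI impI)
  have \<zeta>: "norm \<zeta> = 1" using assms(2) by simp
  show "localization_property \<theta> \<zeta>" if "\<exists>w::nat \<Rightarrow> complex. (\<forall>n. w n \<in> ball 0 1) \<and> w \<longlonglongrightarrow> \<zeta> \<and>
             overcomplete_in (model_space \<theta>) (\<lambda>n. model_kernel \<theta> (w n))"
    using that overcomplete_imp_localization[OF assms(1) \<zeta>] by auto
  show "\<exists>w::nat \<Rightarrow> complex. (\<forall>n. w n \<in> ball 0 1) \<and> w \<longlonglongrightarrow> \<zeta> \<and>
             overcomplete_in (model_space \<theta>) (\<lambda>n. model_kernel \<theta> (w n))" if loc: "localization_property \<theta> \<zeta>"
  proof (intro exI conjI allI)
    show "of_real (radii n) * \<zeta> \<in> ball 0 1" for n using \<zeta> radii_bounds[of n] by (simp add: norm_mult)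
    have "(\<lambda>n. of_real (radii n) * \<zeta>) \<longlonglongrightarrow> of_real 1 * \<zeta>" by (intro tendsto_intros radii_tendsto)
    thus "(\<lambda>n. of_real (radii n) * \<zeta>) \<longlonglongrightarrow> \<zeta>" by simp
    show "overcomplete_in (model_space \<theta>) (\<lambda>n. model_kernel \<theta> (of_real (radii n) * \<zeta>))"
      by (rule localization_imp_overcomplete[OF assms(1) \<zeta> loc])
  qed
  show "\<zeta> \<in> ahern_clark_set \<theta>" if "localization_property \<theta> \<zeta>"
    by (rule localization_imp_ahern_clark[OF assms(1) \<zeta> that])
qed

end
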